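(* Let $\mathbb{k}\in\{\mathbb{R},\mathbb{C}\}$. The internal homs $\underline{\mathrm{Hom}}_w$ on $\mathsf{TVS}_w$ and $\underline{\mathrm{Hom}}_m$ on $\mathsf{TVS}_m$ satisfy $$\underline{\mathrm{Hom}}_w(V,W)\cong\bigl(L(V,W),\,\sigma(L(V,W),V\otimes_{\mathbb{k}}W')\bigr),\qquad V,W\in\mathsf{TVS}_w,$$ $$\underline{\mathrm{Hom}}_m(V,W)\cong\bigl(L(V,W),\,\tau(L(V,W),V\otimes_{\mathbb{k}}W')\bigr),\qquad V,W\in\mathsf{TVS}_m,$$ where $L(V,W)$ denotes the space of continuous linear maps $V\to W$ and the pairing between $L(V,W)$ and $V\otimes_{\mathbb{k}}W'$ is $\langle f,v\otimes w'\rangle=w'(f(v))$.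
   Context: $\mathsf{TVS}$ is the category of Hausdorff locally convex topological $\mathbb{k}$-vector spaces and continuous linear maps; $V'$ is the space of continuous linear functionals on $V$. $\mathsf{chu}$ is the category of triples $(V,W,\langle-,-\rangle)$ with $V,W$ vector spaces and $\langle-,-\rangle: V\otimes_{\mathbb{k}}W\to\mathbb{k}$ linear such that both $V\to W^\star$ and $W\to V^\star$ are injective; a morphism $(V_1,W_1)\to(V_2,W_2)$ is a pair of linear maps $f: V_1\to V_2$, $g: W_2\to W_1$ with $\langle f(v),w\rangle_2=\langle v,g(w)\rangle_1$. The internal hom is $\underline{\mathrm{Hom}}((V_1,W_1),(V_2,W_2))=(\mathrm{Hom}_{\mathsf{chu}}((V_1,W_1),(V_2,W_2)),\,V_1\otimes_{\mathbb{k}}W_2)$ with pairing $\langle(f,g),v\otimes w\rangle=\langle f(v),w\rangle_2=\langle v,g(w)\rangle_1$. For a pair $(V,W)\in\mathsf{chu}$, a dual topology on $V$ is a Hausdorff locally convex topology for which $W\to V^\star$ induces an isomorphism of $W$ onto the topological dual; $\sigma(V,W)$ is the weakest and $\tau(V,W)$ the strongest dual topology. $\mathsf{TVS}_w$ (resp. $\mathsf{TVS}_m$) is the full subcategory of $\mathsf{TVS}$ of spaces whose topology is $\sigma(V,V')$ (resp. $\tau(V,V')$). $T_w$ and $T_m$ send $V$ to $(V,V',\mathrm{eval})$ and a morphism $f$ to $(f,f^\star)$. The functors $R:\mathsf{chu}\to\mathsf{TVS}_w$ and $\mathcal{L}:\mathsf{chu}\to\mathsf{TVS}_m$ send $(V,W)$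 to $(V,\sigma(V,W))$ and $(V,\tau(V,W))$ respectively. By definition $\underline{\mathrm{Hom}}_w(V,W)=R(\underline{\mathrm{Hom}}(T_wV,T_wW))$ and $\underline{\mathrm{Hom}}_m(V,W)=\mathcal{L}(\underline{\mathrm{Hom}}(T_mV,T_mW))$. *)

theory Defs
  imports "HOL-Analysis.Analysis" "HOL-Algebra.Algebraic_Closure_Type"
    "HOL-Library.Poly_Mapping"
begin

section \<open>The ground field\<close>

text \<open>
  The field is spanned over the reals by 1 and an element that is either real (so that
  the field is \<open>\<real>\<close>) or a square root of -1 (so that it is \<open>\<complex>\<close>). Up to isomorphism of
  normed fields the members of this class are exactly \<open>\<real>\<close> and \<open>\<complex>\<close>.
\<close>

class real_or_complex = real_normed_field +
  assumes real_or_complex_span: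
    "\<exists>i. ((\<exists>c. i = c *\<^sub>R 1) \<or> i * i = - 1) \<and> (\<forall>x. \<exists>a b. x = a *\<^sub>R 1 + b *\<^sub>R i)"

instance real :: real_or_complex
proof
  show "\<exists>i::real. ((\<exists>c. i = c *\<^sub>R 1) \<or> i * i = - 1) \<and>
      (\<forall>x. \<exists>a b. x = a *\<^sub>R 1 + b *\<^sub>R i)"
    by (rule exI[of _ 1]) (auto intro: exI[of _ 1] exI[of _ 0])
qed

instance complex :: real_or_complex
proof
  have "\<exists>a b. x = a *\<^sub>R 1 + b *\<^sub>R \<i>" for x :: complex
    by (rule exI[of _ "Re x"], rule exI[of _ "Im x"]) (simp add: complex_eq_iff)
  then show "\<exists>i::complex. ((\<exists>c. i = c *\<^sub>R 1) \<or> i * i = - 1) \<and>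
      (\<forall>x. \<exists>a b. x = a *\<^sub>R 1 + b *\<^sub>R i)"
    by (intro exI[of _ \<i>]) auto
qed


section \<open>Vector spaces and linear maps\<close>

text \<open>
  Vector spaces are modules over the ring of scalars, with explicit carriers. The
  \<open>mult\<close> and \<open>one\<close> fields that the module record inherits from rings are never used.
\<close>

abbreviation vector_sp :: "('k::real_or_complex, 'a, 'z) module_scheme \<Rightarrow> bool" where
  "vector_sp V \<equiv> Module.module (ring_of_type_algebra :: 'k ring) V"

text \<open>
  Maps are extensional (undefined off the carrier), so equality of linear maps
  is equality of functions.
\<close>

definition linear_maps ::
  "('k, 'a, 'y) module_scheme \<Rightarrow> ('k, 'b, 'z) module_scheme \<Rightarrow> ('a \<Rightarrow> 'b) set" where
  "linear_maps V W = {f \<in> carrier V \<rightarrow>\<^sub>E carrier W.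
     (\<forall>x\<in>carrier V. \<forall>y\<in>carrier V. f (x \<oplus>\<^bsub>V\<^esub> y) = f x \<oplus>\<^bsub>W\<^esub> f y) \<and>
     (\<forall>c. \<forall>x\<in>carrier V. f (c \<odot>\<^bsub>V\<^esub> x) = c \<odot>\<^bsub>W\<^esub> f x)}"

definition map_space ::
  "('a \<Rightarrow> 'b) set \<Rightarrow> ('k, 'a, 'y) module_scheme \<Rightarrow> ('k, 'b, 'z) module_scheme
    \<Rightarrow> ('k, 'a \<Rightarrow> 'b) module" where
  "map_space F V W =
    \<lparr>carrier = F, monoid.mult = undefined, one = undefined,
     zero = (\<lambda>x\<in>carrier V. \<zero>\<^bsub>W\<^esub>),
     add = (\<lambda>f g. \<lambda>x\<in>carrier V. f x \<oplus>\<^bsub>W\<^esub> g x),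
     smult = (\<lambda>c f. \<lambda>x\<in>carrier V. c \<odot>\<^bsub>W\<^esub> f x)\<rparr>"


section \<open>Tensor product of vector spaces\<close>

text \<open>
  The free vector space on \<open>carrier V \<times> carrier W\<close> modulo the subspace spanned by
  the bilinearity relations; elements are cosets of that subspace.
\<close>

definition fscale :: "'k::real_or_complex \<Rightarrow> ('x \<Rightarrow>\<^sub>0 'k) \<Rightarrow> ('x \<Rightarrow>\<^sub>0 'k)" where
  "fscale c r = Poly_Mapping.map ((*) c) r"

abbreviation gen :: "'a \<Rightarrow> 'b \<Rightarrow> ('a \<times> 'b \<Rightarrow>\<^sub>0 'k::real_or_complex)" where
  "gen v w \<equiv> Poly_Mapping.single (v, w) 1"

definition tensor_relations ::
  "('k::real_or_complex, 'a, 'y) module_scheme \<Rightarrow> ('k, 'b, 'z) module_scheme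
    \<Rightarrow> ('a \<times> 'b \<Rightarrow>\<^sub>0 'k) set" where
  "tensor_relations V W = Modules.module.span fscale
     ({gen (v \<oplus>\<^bsub>V\<^esub> v') w - gen v w - gen v' w | v v' w.
         v \<in> carrier V \<and> v' \<in> carrier V \<and> w \<in> carrier W} \<union>
      {gen v (w \<oplus>\<^bsub>W\<^esub> w') - gen v w - gen v w' | v w w'.
         v \<in> carrier V \<and> w \<in> carrier W \<and> w' \<in> carrier W} \<union>
      {gen (c \<odot>\<^bsub>V\<^esub> v) w - fscale c (gen v w) | c v w.
         v \<in> carrier V \<and> w \<in> carrier W} \<union>
      {gen v (c \<odot>\<^bsub>W\<^esub> w) - fscale c (gen v w) | c v w.
         v \<in> carrier V \<and> w \<in> carrier W})"

definition tensor_class ::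
  "('k::real_or_complex, 'a, 'y) module_scheme \<Rightarrow> ('k, 'b, 'z) module_scheme
    \<Rightarrow> ('a \<times> 'b \<Rightarrow>\<^sub>0 'k) \<Rightarrow> ('a \<times> 'b \<Rightarrow>\<^sub>0 'k) set" where
  "tensor_class V W r = {r + n | n. n \<in> tensor_relations V W}"

text \<open>
  In \<open>smult\<close>, the added relation \<open>n\<close> only matters for \<open>c = 0\<close>, where
  the elementwise multiple of a coset is not a coset.
\<close>

definition tensor ::
  "('k::real_or_complex, 'a, 'y) module_scheme \<Rightarrow> ('k, 'b, 'z) module_scheme
    \<Rightarrow> ('k, ('a \<times> 'b \<Rightarrow>\<^sub>0 'k) set) module" where
  "tensor V W =
    \<lparr>carrier = tensor_class V W ` {r. Poly_Mapping.keys r \<subseteq> carrier V \<times> carrier W},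
     monoid.mult = undefined, one = undefined,
     zero = tensor_class V W 0,
     add = (\<lambda>s t. {a + b | a b. a \<in> s \<and> b \<in> t}),
     smult = (\<lambda>c t. {fscale c a + n | a n. a \<in> t \<and> n \<in> tensor_relations V W})\<rparr>"

definition pure_tensor ::
  "('k::real_or_complex, 'a, 'y) module_scheme \<Rightarrow> ('k, 'b, 'z) module_scheme
    \<Rightarrow> 'a \<Rightarrow> 'b \<Rightarrow> ('a \<times> 'b \<Rightarrow>\<^sub>0 'k) set" where
  "pure_tensor V W v w = tensor_class V W (gen v w)"


section \<open>Topological vector spaces\<close>

record ('k, 'a) tvs = "('k, 'a) module" +
  vtop :: "'a topology"

definition with_topology :: "('k, 'a) module \<Rightarrow> 'a topology \<Rightarrow> ('k, 'a) tvs" where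
  "with_topology V T = module.extend V (tvs.fields T)"

definition convex_in :: "('k::real_or_complex, 'a, 'z) module_scheme \<Rightarrow> 'a set \<Rightarrow> bool" where
  "convex_in V C \<longleftrightarrow> C \<subseteq> carrier V \<and>
     (\<forall>x\<in>C. \<forall>y\<in>C. \<forall>t::real. 0 \<le> t \<and> t \<le> 1 \<longrightarrow>
        (of_real t \<odot>\<^bsub>V\<^esub> x) \<oplus>\<^bsub>V\<^esub> (of_real (1 - t) \<odot>\<^bsub>V\<^esub> y) \<in> C)"


definition TVS :: "('k::real_or_complex, 'a) tvs \<Rightarrow> bool" where
  "TVS V \<longleftrightarrow> vector_sp V \<and> topspace (vtop V) = carrier V \<and>
     continuous_map (prod_topology (vtop V) (vtop V)) (vtop V) (\<lambda>(x, y). x \<oplus>\<^bsub>V\<^esub> y) \<and>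
     continuous_map (prod_topology euclidean (vtop V)) (vtop V) (\<lambda>(c, x). c \<odot>\<^bsub>V\<^esub> x) \<and>
     Hausdorff_space (vtop V) \<and>
     (\<forall>U. openin (vtop V) U \<and> \<zero>\<^bsub>V\<^esub> \<in> U \<longrightarrow>
        (\<exists>C. openin (vtop V) C \<and> convex_in V C \<and> \<zero>\<^bsub>V\<^esub> \<in> C \<and> C \<subseteq> U))"

definition L :: "('k, 'a) tvs \<Rightarrow> ('k, 'b) tvs \<Rightarrow> ('a \<Rightarrow> 'b) set" where
  "L V W = {f \<in> linear_maps V W. continuous_map (vtop V) (vtop W) f}"

definition L_space :: "('k, 'a) tvs \<Rightarrow> ('k, 'b) tvs \<Rightarrow> ('k, 'a \<Rightarrow> 'b) module" where
  "L_space V W = map_space (L V W) V W"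

text \<open>The ground field as a topological vector space over itself, and \<open>V'\<close>.\<close>

definition ground :: "('k::real_or_complex, 'k) tvs" where
  "ground = \<lparr>carrier = UNIV, monoid.mult = (*), one = 1, zero = 0, add = (+),
             smult = (*), vtop = euclidean\<rparr>"

definition tdual :: "('k::real_or_complex, 'a) tvs \<Rightarrow> ('k, 'a \<Rightarrow> 'k) module" where
  "tdual V = L_space V ground"

text \<open>Isomorphism of topological vector spaces, as isomorphism in the category \<open>TVS\<close>.\<close>

definition tvs_iso :: "('k, 'a) tvs \<Rightarrow> ('k, 'b) tvs \<Rightarrow> bool" (infix \<open>\<cong>\<^sub>T\<close> 50) where
  "A \<cong>\<^sub>T B \<longleftrightarrow> (\<exists>f\<in>L A B. \<exists>g\<in>L B A.
     (\<forall>x\<in>carrier A. g (f x) = x) \<and> (\<forall>y\<in>carrier B. f (g y) = y))"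

text \<open>
  The linear functional on \<open>V \<otimes> W\<close> taking \<open>v \<otimes> w\<close> to \<open>b v w\<close>,
  for \<open>b\<close> bilinear. It is unique because pure tensors span.
\<close>

definition tensor_lift ::
  "('k::real_or_complex, 'a, 'y) module_scheme \<Rightarrow> ('k, 'b, 'z) module_scheme
    \<Rightarrow> ('a \<Rightarrow> 'b \<Rightarrow> 'k) \<Rightarrow> ('a \<times> 'b \<Rightarrow>\<^sub>0 'k) set \<Rightarrow> 'k" where
  "tensor_lift V W b = (THE l. l \<in> linear_maps (tensor V W) ground \<and>
     (\<forall>v\<in>carrier V. \<forall>w\<in>carrier W. l (pure_tensor V W v w) = b v w))"


section \<open>The category chu\<close>

text \<open>
  The pairing, a linear map \<open>V \<otimes> W \<rightarrow> k\<close>, is represented by the corresponding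
  bilinear map; its values off the carriers are irrelevant.
\<close>

record ('k, 'a, 'b) chu =
  lspace :: "('k, 'a) module"
  rspace :: "('k, 'b) module"
  pairing :: "'a \<Rightarrow> 'b \<Rightarrow> 'k"

definition left_map :: "('k, 'a, 'b) chu \<Rightarrow> 'a \<Rightarrow> 'b \<Rightarrow> 'k" where
  "left_map P = (\<lambda>v\<in>carrier (lspace P). \<lambda>w\<in>carrier (rspace P). pairing P v w)"

definition right_map :: "('k, 'a, 'b) chu \<Rightarrow> 'b \<Rightarrow> 'a \<Rightarrow> 'k" where
  "right_map P = (\<lambda>w\<in>carrier (rspace P). \<lambda>v\<in>carrier (lspace P). pairing P v w)"

definition alg_dual :: "('k::real_or_complex, 'a, 'z) module_scheme \<Rightarrow> ('k, 'a \<Rightarrow> 'k) module" where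
  "alg_dual V = map_space (linear_maps V ground) V ground"

text \<open>The two membership conditions together say that the pairing is bilinear.\<close>

definition is_chu :: "('k::real_or_complex, 'a, 'b) chu \<Rightarrow> bool" where
  "is_chu P \<longleftrightarrow> vector_sp (lspace P) \<and> vector_sp (rspace P) \<and>
     left_map P \<in> linear_maps (lspace P) (alg_dual (rspace P)) \<and>
     right_map P \<in> linear_maps (rspace P) (alg_dual (lspace P)) \<and>
     inj_on (left_map P) (carrier (lspace P)) \<and>
     inj_on (right_map P) (carrier (rspace P))"

definition chu_hom ::
  "('k, 'a, 'b) chu \<Rightarrow> ('k, 'c, 'd) chu \<Rightarrow> (('a \<Rightarrow> 'c) \<times> ('d \<Rightarrow> 'b)) set" where
  "chu_hom P Q = {(f, g). f \<in> linear_maps (lspace P) (lspace Q) \<and>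
     g \<in> linear_maps (rspace Q) (rspace P) \<and>
     (\<forall>v\<in>carrier (lspace P). \<forall>w\<in>carrier (rspace Q). pairing Q (f v) w = pairing P v (g w))}"

definition chu_hom_space ::
  "('k, 'a, 'b) chu \<Rightarrow> ('k, 'c, 'd) chu \<Rightarrow> ('k, ('a \<Rightarrow> 'c) \<times> ('d \<Rightarrow> 'b)) module" where
  "chu_hom_space P Q =
    (let F = map_space UNIV (lspace P) (lspace Q); G = map_space UNIV (rspace Q) (rspace P) in
     \<lparr>carrier = chu_hom P Q, monoid.mult = undefined, one = undefined,
      zero = (\<zero>\<^bsub>F\<^esub>, \<zero>\<^bsub>G\<^esub>),
      add = (\<lambda>(f, g) (f', g'). (f \<oplus>\<^bsub>F\<^esub> f', g \<oplus>\<^bsub>G\<^esub> g')),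
      smult = (\<lambda>c (f, g). (c \<odot>\<^bsub>F\<^esub> f, c \<odot>\<^bsub>G\<^esub> g))\<rparr>)"

definition chu_internal_hom ::
  "('k::real_or_complex, 'a, 'b) chu \<Rightarrow> ('k, 'c, 'd) chu
    \<Rightarrow> ('k, ('a \<Rightarrow> 'c) \<times> ('d \<Rightarrow> 'b), ('a \<times> 'd \<Rightarrow>\<^sub>0 'k) set) chu" where
  "chu_internal_hom P Q =
    \<lparr>lspace = chu_hom_space P Q,
     rspace = tensor (lspace P) (rspace Q),
     pairing = (\<lambda>(f, g). tensor_lift (lspace P) (rspace Q) (\<lambda>v w. pairing Q (f v) w))\<rparr>"


section \<open>Dual topologies\<close>

definition dual_topology :: "('k::real_or_complex, 'a, 'b) chu \<Rightarrow> 'a topology \<Rightarrow> bool" where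
  "dual_topology P T \<longleftrightarrow> TVS (with_topology (lspace P) T) \<and>
     right_map P \<in> linear_maps (rspace P) (tdual (with_topology (lspace P) T)) \<and>
     bij_betw (right_map P) (carrier (rspace P)) (carrier (tdual (with_topology (lspace P) T)))"

definition coarser :: "'a topology \<Rightarrow> 'a topology \<Rightarrow> bool" where
  "coarser S T \<longleftrightarrow> (\<forall>U. openin S U \<longrightarrow> openin T U)"

text \<open>The topologies \<open>\<sigma>(V, W)\<close> and \<open>\<tau>(V, W)\<close> for \<open>P = (V, W)\<close>.\<close>

definition weak_topology :: "('k::real_or_complex, 'a, 'b) chu \<Rightarrow> 'a topology" where
  "weak_topology P = (THE T. dual_topology P T \<and> (\<forall>S. dual_topology P S \<longrightarrow> coarser T S))"

definition mackey_topology :: "('k::real_or_complex, 'a, 'b) chu \<Rightarrow> 'a topology" where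
  "mackey_topology P = (THE T. dual_topology P T \<and> (\<forall>S. dual_topology P S \<longrightarrow> coarser S T))"

text \<open>The functors \<open>R\<close> and \<open>\<L>\<close> on objects.\<close>

definition R_functor :: "('k::real_or_complex, 'a, 'b) chu \<Rightarrow> ('k, 'a) tvs" where
  "R_functor P = with_topology (lspace P) (weak_topology P)"

definition L_functor :: "('k::real_or_complex, 'a, 'b) chu \<Rightarrow> ('k, 'a) tvs" where
  "L_functor P = with_topology (lspace P) (mackey_topology P)"

text \<open>
  \<open>(V, V', eval)\<close>; both \<open>T\<^sub>w\<close> and \<open>T\<^sub>m\<close> are given by this formula on objects.
\<close>

definition T_functor :: "('k::real_or_complex, 'a) tvs \<Rightarrow> ('k, 'a, 'a \<Rightarrow> 'k) chu" where
  "T_functor V = \<lparr>lspace = module.truncate V, rspace = tdual V, pairing = (\<lambda>v \<phi>. \<phi> v)\<rparr>"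

definition TVS_w :: "('k::real_or_complex, 'a) tvs \<Rightarrow> bool" where
  "TVS_w V \<longleftrightarrow> TVS V \<and> vtop V = weak_topology (T_functor V)"

definition TVS_m :: "('k::real_or_complex, 'a) tvs \<Rightarrow> bool" where
  "TVS_m V \<longleftrightarrow> TVS V \<and> vtop V = mackey_topology (T_functor V)"


section \<open>Internal homs\<close>

definition Hom_w ::
  "('k::real_or_complex, 'a) tvs \<Rightarrow> ('k, 'b) tvs
    \<Rightarrow> ('k, ('a \<Rightarrow> 'b) \<times> (('b \<Rightarrow> 'k) \<Rightarrow> ('a \<Rightarrow> 'k))) tvs" where
  "Hom_w V W = R_functor (chu_internal_hom (T_functor V) (T_functor W))"

definition Hom_m ::
  "('k::real_or_complex, 'a) tvs \<Rightarrow> ('k, 'b) tvs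
    \<Rightarrow> ('k, ('a \<Rightarrow> 'b) \<times> (('b \<Rightarrow> 'k) \<Rightarrow> ('a \<Rightarrow> 'k))) tvs" where
  "Hom_m V W = L_functor (chu_internal_hom (T_functor V) (T_functor W))"

text \<open>The pair \<open>(L(V, W), V \<otimes> W')\<close> with \<open>\<langle>f, v \<otimes> w'\<rangle> = w' (f v)\<close>.\<close>

definition L_pair ::
  "('k::real_or_complex, 'a) tvs \<Rightarrow> ('k, 'b) tvs
    \<Rightarrow> ('k, 'a \<Rightarrow> 'b, ('a \<times> ('b \<Rightarrow> 'k) \<Rightarrow>\<^sub>0 'k) set) chu" where
  "L_pair V W =
    \<lparr>lspace = L_space V W,
     rspace = tensor V (tdual W),
     pairing = (\<lambda>f. tensor_lift V (tdual W) (\<lambda>v w'. w' (f v)))\<rparr>"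

end

(*
  The Mackey topology is generated by the seminorms p such that every functional dominated by a
  multiple of p is given by the pairing. By Hahn-Banach a functional dominated by p + q is a sum of
  functionals dominated by multiples of p and of q, so these seminorms are closed under sums; the
  weak topology is generated by a subfamily of them. Extending functionals along linear maps, again
  by Hahn-Banach, shows that the first component of a chu morphism is continuous both for the weak
  and for the Mackey topologies. Hence, for V and W both weak or both Mackey, the chu morphisms
  from (V, V') to (W, W') are exactly the pairs (f, transpose of f) with f continuous, and
  f |-> (f, transpose of f) is an isomorphism of pairs from (L(V, W), V (x) W') to the internal hom,
  with the identity on V (x) W'. It therefore identifies the weak topologies and the Mackey topologies.
*)

theory Submission
  imports Defs
begin

section \<open>Vector spaces\<close>

text \<open>\<open>weak_topology\<close> and \<open>mackey_topology\<close> are definite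
  descriptions, so nothing is known about them until a coarsest and a finest dual topology have been
  constructed. The usual model of the latter is uniform convergence on weakly compact convex sets;
  describing it by seminorms leaves Hahn-Banach as the only analytic input. Each passage through
  real parts costs a factor 2 in the bounds. This is harmless, because membership in the Mackey
  family is tested with arbitrary multiples of a seminorm.

  The other obstacle is algebraic. The topologies on the internal hom make sense only once it is
  known to be a chu object, and the delicate half is that a tensor in V (x) W' annihilated by all
  morphisms must vanish. Morphisms of rank one suffice for this, by an induction on the number of
  pure tensors.

  No topology on a hom space is ever computed: a map and its inverse that both belong to chu
  morphisms are continuous for the weak and for the Mackey topologies, hence homeomorphisms.\<close>

lemma vector_spI:
  fixes V :: "('k::real_or_complex, 'a, 'z) module_scheme" (structure)
  assumes "\<And>x y. x \<in> carrier V \<Longrightarrow> y \<in> carrier V \<Longrightarrow> x \<oplus> y \<in> carrier V"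
    and "\<zero> \<in> carrier V"
    and "\<And>c x. x \<in> carrier V \<Longrightarrow> c \<odot> x \<in> carrier V"
    and "\<And>x y z. x \<in> carrier V \<Longrightarrow> y \<in> carrier V \<Longrightarrow> z \<in> carrier V \<Longrightarrow>
      (x \<oplus> y) \<oplus> z = x \<oplus> (y \<oplus> z)"
    and "\<And>x y. x \<in> carrier V \<Longrightarrow> y \<in> carrier V \<Longrightarrow> x \<oplus> y = y \<oplus> x"
    and "\<And>x. x \<in> carrier V \<Longrightarrow> \<zero> \<oplus> x = x"
    and zero: "\<And>x. x \<in> carrier V \<Longrightarrow> 0 \<odot> x = \<zero>"
    and l_distr: "\<And>a b x. x \<in> carrier V \<Longrightarrow> (a + b) \<odot> x = a \<odot> x \<oplus> b \<odot> x"
    and "\<And>a x y. x \<in> carrier V \<Longrightarrow> y \<in> carrier V \<Longrightarrow> a \<odot> (x \<oplus> y) = a \<odot> x \<oplus> a \<odot> y"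
    and "\<And>a b x. x \<in> carrier V \<Longrightarrow> (a * b) \<odot> x = a \<odot> (b \<odot> x)"
    and one: "\<And>x. x \<in> carrier V \<Longrightarrow> 1 \<odot> x = x"
  shows "vector_sp V"
proof (rule moduleI)
  show "cring (ring_of_type_algebra :: 'k ring)"
    by (rule cring_from_type_algebra)
  show "abelian_group V"
  proof (rule abelian_groupI)
    fix x assume x: "x \<in> carrier V"
    \<comment> \<open>Additive inverses come from the scalars: \<open>(-1 + 1) \<odot> x\<close> is
      zero.\<close>
    have "(-1) \<odot> x \<oplus> x = \<zero>"
      using l_distr[OF x, of "-1" 1] zero[OF x] one[OF x] by simp
    then show "\<exists>y\<in>carrier V. y \<oplus> x = \<zero>"
      using assms(3)[OF x] by blast
  qed (use assms in auto)
qed (use assms in \<open>auto simp: ring_of_type_algebra_def\<close>)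

text \<open>The scalar ring of \<open>vector_sp\<close> is a record built from the type of scalars.
  The locale restates the module axioms with the arithmetic of the type itself, so that the
  simplifier can compute with scalars.\<close>

locale kspace =
  fixes V :: "('k::real_or_complex, 'a, 'z) module_scheme" (structure)
  assumes vector_sp: "vector_sp V"
begin

sublocale abelian_group V
  using vector_sp by (rule module.axioms)

lemma smult_mem [simp, intro]: "x \<in> carrier V \<Longrightarrow> c \<odot> x \<in> carrier V"
  using module.smult_closed[OF vector_sp, of c x] by (simp add: ring_of_type_algebra_def)

lemma smult_add_left: "x \<in> carrier V \<Longrightarrow> (a + b) \<odot> x = a \<odot> x \<oplus> b \<odot> x"
  using module.smult_l_distr[OF vector_sp, of a b x] by (simp add: ring_of_type_algebra_def)

lemma smult_add_right:
  "x \<in> carrier V \<Longrightarrow> y \<in> carrier V \<Longrightarrow> a \<odot> (x \<oplus> y) = a \<odot> x \<oplus> a \<odot> y"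
  using module.smult_r_distr[OF vector_sp, of a x y] by (simp add: ring_of_type_algebra_def)

lemma smult_smult: "x \<in> carrier V \<Longrightarrow> a \<odot> (b \<odot> x) = (a * b) \<odot> x"
  using module.smult_assoc1[OF vector_sp, of a b x] by (simp add: ring_of_type_algebra_def)

lemma smult_1 [simp]: "x \<in> carrier V \<Longrightarrow> 1 \<odot> x = x"
  using module.smult_one[OF vector_sp, of x] by (simp add: ring_of_type_algebra_def)

lemma smult_0 [simp]: "x \<in> carrier V \<Longrightarrow> 0 \<odot> x = \<zero>"
  using module.smult_l_null[OF vector_sp, of x] by (simp add: ring_of_type_algebra_def)

lemma smult_zero [simp]: "a \<odot> \<zero> = \<zero>"
  using module.smult_r_null[OF vector_sp, of a] by (simp add: ring_of_type_algebra_def)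

lemma smult_minus_1: "x \<in> carrier V \<Longrightarrow> (-1) \<odot> x = \<ominus> x"
  using smult_add_left[of x "-1" 1] by (simp add: minus_equality)

lemma smult_minus_right: "x \<in> carrier V \<Longrightarrow> a \<odot> (\<ominus> x) = \<ominus> (a \<odot> x)"
  by (simp add: smult_minus_1[symmetric] smult_smult)

lemma add_neg_cancel [simp]: "x \<in> carrier V \<Longrightarrow> y \<in> carrier V \<Longrightarrow> (x \<oplus> y) \<oplus> \<ominus> y = x"
  by (simp add: a_assoc r_neg)

lemma neg_add_cancel [simp]: "x \<in> carrier V \<Longrightarrow> y \<in> carrier V \<Longrightarrow> (x \<oplus> \<ominus> y) \<oplus> y = x"
  by (simp add: a_assoc l_neg)

lemma add_add_swap:
  "\<lbrakk>a \<in> carrier V; b \<in> carrier V; c \<in> carrier V; d \<in> carrier V\<rbrakk> \<Longrightarrow>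
    (a \<oplus> b) \<oplus> (c \<oplus> d) = (a \<oplus> c) \<oplus> (b \<oplus> d)"
  by (simp add: a_ac)

end

section \<open>The Hahn--Banach theorem\<close>

text \<open>
  In place of subspaces and extensions, the theorem is stated for the constraints
  \<open>\<psi> y \<ge> - s\<close> with \<open>(y, s)\<close> ranging over a convex cone. Extending a functional
  along a linear map, and splitting a functional that is dominated by a sum
  of two seminorms, are both instances of this.
\<close>

context kspace
begin

definition sublinear :: "('a \<Rightarrow> real) \<Rightarrow> bool" where
  "sublinear p \<longleftrightarrow> (\<forall>x\<in>carrier V. \<forall>y\<in>carrier V. p (x \<oplus> y) \<le> p x + p y) \<and>
    (\<forall>t>0. \<forall>x\<in>carrier V. p (of_real t \<odot> x) = t * p x)"

definition real_linear :: "('a \<Rightarrow> real) \<Rightarrow> bool" where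
  "real_linear f \<longleftrightarrow> (\<forall>x\<in>carrier V. \<forall>y\<in>carrier V. f (x \<oplus> y) = f x + f y) \<and>
    (\<forall>t. \<forall>x\<in>carrier V. f (of_real t \<odot> x) = t * f x)"

definition cone :: "('a \<times> real) set \<Rightarrow> bool" where
  "cone K \<longleftrightarrow> K \<subseteq> carrier V \<times> UNIV \<and> (\<zero>, 0) \<in> K \<and>
    (\<forall>y s y' s'. (y, s) \<in> K \<and> (y', s') \<in> K \<longrightarrow> (y \<oplus> y', s + s') \<in> K) \<and>
    (\<forall>t>0. \<forall>y s. (y, s) \<in> K \<longrightarrow> (of_real t \<odot> y, t * s) \<in> K)"

text \<open>A linear functional lies below \<open>cone_inf p K\<close> exactly when it lies below
  \<open>p\<close> and satisfies the constraints of \<open>K\<close>: from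
  \<open>f y \<ge> - s\<close> follows
  \<open>f x = f (x \<oplus> y) - f y \<le> p (x \<oplus> y) + s\<close>. The constraints are thus
  absorbed into the sublinear functional.\<close>

definition cone_inf :: "('a \<Rightarrow> real) \<Rightarrow> ('a \<times> real) set \<Rightarrow> 'a \<Rightarrow> real" where
  "cone_inf p K x = (INF (y, s)\<in>K. p (x \<oplus> y) + s)"

lemma sublinear_add:
  "sublinear p \<Longrightarrow> x \<in> carrier V \<Longrightarrow> y \<in> carrier V \<Longrightarrow> p (x \<oplus> y) \<le> p x + p y"
  by (simp add: sublinear_def)

lemma sublinear_scale:
  "sublinear p \<Longrightarrow> 0 < t \<Longrightarrow> x \<in> carrier V \<Longrightarrow> p (of_real t \<odot> x) = t * p x"
  by (simp add: sublinear_def)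

lemma sublinear_zero: "sublinear p \<Longrightarrow> p \<zero> = 0"
  using sublinear_scale[of p 2 \<zero>] by simp

text \<open>Keeps the infimum in \<open>cone_inf\<close> finite: together with
  \<open>0 \<le> p y + s\<close> it bounds \<open>p (x \<oplus> y) + s\<close> from below by
  \<open>- p (\<ominus> x)\<close>, uniformly in \<open>(y, s)\<close>.\<close>

lemma sublinear_lower:
  assumes "sublinear p" "x \<in> carrier V" "y \<in> carrier V"
  shows "p y - p (\<ominus> x) \<le> p (x \<oplus> y)"
proof -
  have "p y = p (\<ominus> x \<oplus> (x \<oplus> y))"
    using assms by (simp add: a_assoc[symmetric] l_neg)
  then show ?thesis
    using sublinear_add[OF assms(1), of "\<ominus> x" "x \<oplus> y"] assms by simp
qed

text \<open>Closure of \<open>K\<close> under sums yields subadditivity, closure under positive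
  multiples yields homogeneity, and \<open>pos\<close> excludes the value minus infinity. The bound
  by \<open>p\<close> itself is the element \<open>(\<zero>, 0)\<close> of \<open>K\<close>.\<close>

lemma cone_inf:
  assumes p: "sublinear p" and K: "cone K" and pos: "\<And>y s. (y, s) \<in> K \<Longrightarrow> 0 \<le> p y + s"
  shows "sublinear (cone_inf p K)"
    and "\<And>x y s. x \<in> carrier V \<Longrightarrow> (y, s) \<in> K \<Longrightarrow> cone_inf p K x \<le> p (x \<oplus> y) + s"
    and "\<And>x. x \<in> carrier V \<Longrightarrow> cone_inf p K x \<le> p x"
proof -
  have mem: "y \<in> carrier V" if "(y, s) \<in> K" for y s
    using K that by (auto simp: cone_def)
  have bdd: "bdd_below ((\<lambda>(y, s). p (x \<oplus> y) + s) ` K)" if x: "x \<in> carrier V" for x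
  proof (rule bdd_belowI2)
    fix z assume "z \<in> K"
    then show "- p (\<ominus> x) \<le> (case z of (y, s) \<Rightarrow> p (x \<oplus> y) + s)"
      using sublinear_lower[OF p x mem[of "fst z" "snd z"]] pos[of "fst z" "snd z"]
      by (simp add: case_prod_unfold)
  qed
  show lower: "cone_inf p K x \<le> p (x \<oplus> y) + s" if "x \<in> carrier V" "(y, s) \<in> K" for x y s
    using cINF_lower[OF bdd[OF that(1)] that(2)] by (simp add: cone_inf_def)
  have K0: "(\<zero>, 0) \<in> K"
    using K by (simp add: cone_def)
  show "cone_inf p K x \<le> p x" if "x \<in> carrier V" for x
    using lower[OF that K0] that by simp
  have greatest: "m \<le> cone_inf p K x"
    if "\<And>y s. (y, s) \<in> K \<Longrightarrow> m \<le> p (x \<oplus> y) + s" for m x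
    unfolding cone_inf_def using K0 that by (intro cINF_greatest) auto
  have scale_le: "cone_inf p K (of_real t \<odot> x) \<le> t * cone_inf p K x"
    if t: "0 < t" and x: "x \<in> carrier V" for t x
  proof -
    have "cone_inf p K (of_real t \<odot> x) / t \<le> cone_inf p K x"
    proof (rule greatest)
      fix y s assume ys: "(y, s) \<in> K"
      then have "(of_real t \<odot> y, t * s) \<in> K"
        using K t by (simp add: cone_def)
      then have "cone_inf p K (of_real t \<odot> x) \<le> p (of_real t \<odot> x \<oplus> of_real t \<odot> y) + t * s"
        using lower x by simp
      also have "\<dots> = t * (p (x \<oplus> y) + s)"
        using t x mem[OF ys]
        by (simp add: smult_add_right[symmetric] sublinear_scale[OF p] distrib_left)
      finally show "cone_inf p K (of_real t \<odot> x) / t \<le> p (x \<oplus> y) + s"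
        using t by (simp add: field_simps)
    qed
    then show ?thesis
      using t by (simp add: field_simps)
  qed
  have "cone_inf p K (x \<oplus> x') \<le> cone_inf p K x + cone_inf p K x'"
    if x: "x \<in> carrier V" and x': "x' \<in> carrier V" for x x'
  proof -
    \<comment> \<open>Moving one infimum to the other side lets \<open>greatest\<close> handle the
      two infima one after the other.\<close>
    have "cone_inf p K (x \<oplus> x') - cone_inf p K x' \<le> cone_inf p K x"
    proof (rule greatest)
      fix y s assume ys: "(y, s) \<in> K"
      have "cone_inf p K (x \<oplus> x') - (p (x \<oplus> y) + s) \<le> cone_inf p K x'"
      proof (rule greatest)
        fix y' s' assume ys': "(y', s') \<in> K"
        have "(y \<oplus> y', s + s') \<in> K"
          using K ys ys' by (simp add: cone_def)
        then have "cone_inf p K (x \<oplus> x') \<le> p ((x \<oplus> x') \<oplus> (y \<oplus> y')) + (s + s')"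
          using lower x x' by simp
        also have "(x \<oplus> x') \<oplus> (y \<oplus> y') = (x \<oplus> y) \<oplus> (x' \<oplus> y')"
          using x x' mem[OF ys] mem[OF ys'] by (rule add_add_swap)
        also have "p \<dots> \<le> p (x \<oplus> y) + p (x' \<oplus> y')"
          using x x' mem[OF ys] mem[OF ys'] by (simp add: sublinear_add[OF p])
        finally show "cone_inf p K (x \<oplus> x') - (p (x \<oplus> y) + s) \<le> p (x' \<oplus> y') + s'"
          by simp
      qed
      then show "cone_inf p K (x \<oplus> x') - cone_inf p K x' \<le> p (x \<oplus> y) + s"
        by simp
    qed
    then show ?thesis
      by simp
  qed
  moreover have "cone_inf p K (of_real t \<odot> x) = t * cone_inf p K x"
    if t: "0 < t" and x: "x \<in> carrier V" for t x
  proof (rule antisym[OF scale_le[OF that]])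
    \<comment> \<open>The reverse inequality is \<open>scale_le\<close> for the factor
      \<open>1 / t\<close> at the point \<open>of_real t \<odot> x\<close>.\<close>
    have "cone_inf p K (of_real (1 / t) \<odot> (of_real t \<odot> x)) \<le> (1 / t) * cone_inf p K (of_real t \<odot> x)"
      using t x by (intro scale_le) auto
    moreover have "of_real (1 / t) \<odot> (of_real t \<odot> x) = x"
      using t x by (simp add: smult_smult)
    ultimately show "t * cone_inf p K x \<le> cone_inf p K (of_real t \<odot> x)"
      using t by (simp add: field_simps)
  qed
  ultimately show "sublinear (cone_inf p K)"
    by (simp add: sublinear_def)
qed

text \<open>Zorn's lemma applies because the pointwise infimum of a chain is again sublinear. It is
  finite, since \<open>0 \<le> q x + q (\<ominus> x)\<close> and \<open>q \<le> p\<close> give the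
  common lower bound \<open>- p (\<ominus> x)\<close>.\<close>

lemma minimal_sublinear:
  assumes p: "sublinear p"
  obtains m where "sublinear m" "\<And>x. x \<in> carrier V \<Longrightarrow> m x \<le> p x"
    "\<And>q x. \<lbrakk>sublinear q; \<And>y. y \<in> carrier V \<Longrightarrow> q y \<le> m y; x \<in> carrier V\<rbrakk> \<Longrightarrow> q x = m x"
proof -
  \<comment> \<open>Values off the carrier are normalised to 0, so that domination on the carrier
    becomes the pointwise order of functions.\<close>
  define A where "A = {q. sublinear q \<and> (\<forall>x\<in>carrier V. q x \<le> p x) \<and> (\<forall>x. x \<notin> carrier V \<longrightarrow> q x = 0)}"
  \<comment> \<open>The order is reversed: a maximal element for \<open>P\<close> is a pointwise
    minimal functional.\<close>
  define P where "P = (\<lambda>q q' :: 'a \<Rightarrow> real. q' \<le> q)"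
  define cut where "cut = (\<lambda>(q :: 'a \<Rightarrow> real) x. if x \<in> carrier V then q x else 0)"
  have cut: "sublinear (cut q)" if "sublinear q" for q
    using that by (simp add: sublinear_def cut_def)
  have po: "partial_order_on A (relation_of P A)"
    unfolding partial_order_on_def preorder_on_def relation_of_def P_def
      refl_on_def trans_def antisym_def by auto
  have "\<exists>m\<in>A. \<forall>a\<in>A. P m a \<longrightarrow> a = m"
  proof (rule predicate_Zorn[OF po])
    fix C assume "C \<in> Chains (relation_of P A)"
    then have CA: "C \<subseteq> A" and tot: "q \<le> q' \<or> q' \<le> q" if "q \<in> C" "q' \<in> C" for q q'
      using that by (auto simp: Chains_def relation_of_def P_def)
    have CA: "C \<subseteq> A"
      using CA by blast
    show "\<exists>u\<in>A. \<forall>a\<in>C. P a u"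
    proof (cases "C = {}")
      case True
      then show ?thesis
        using cut[OF p] by (intro bexI[of _ "cut p"]) (auto simp: A_def cut_def)
    next
      case False
      define u where "u = cut (\<lambda>x. INF q\<in>C. q x)"
      have sub: "sublinear q" if "q \<in> C" for q
        using CA that by (auto simp: A_def)
      have bdd: "bdd_below ((\<lambda>q. q x) ` C)" if x: "x \<in> carrier V" for x
      proof (rule bdd_belowI2)
        fix q assume q: "q \<in> C"
        have "q (\<ominus> x) \<le> p (\<ominus> x)"
          using CA q x by (auto simp: A_def)
        moreover have "0 \<le> q x + q (\<ominus> x)"
          using sublinear_add[OF sub[OF q] x, of "\<ominus> x"] x sublinear_zero[OF sub[OF q]]
          by (simp add: r_neg)
        ultimately show "- p (\<ominus> x) \<le> q x"
          by linarith
      qed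
      have lower: "u x \<le> q x" if "x \<in> carrier V" "q \<in> C" for x q
        using cINF_lower[OF bdd[OF that(1)] that(2)] that by (simp add: u_def cut_def)
      have greatest: "m \<le> u x" if "x \<in> carrier V" "\<And>q. q \<in> C \<Longrightarrow> m \<le> q x" for m x
        using cINF_greatest[OF False, of m "\<lambda>q. q x"] that by (simp add: u_def cut_def)
      have "u (x \<oplus> y) \<le> u x + u y" if x: "x \<in> carrier V" and y: "y \<in> carrier V" for x y
      proof -
        have "u (x \<oplus> y) - u y \<le> u x"
        proof (rule greatest[OF x])
          fix q assume q: "q \<in> C"
          have "u (x \<oplus> y) - q x \<le> u y"
          proof (rule greatest[OF y])
            fix q' assume q': "q' \<in> C"
            \<comment> \<open>Subadditivity needs a single functional in both terms. In a chain one
              member lies below \<open>q\<close> and \<open>q'\<close> alike.\<close>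
            obtain r where r: "r \<in> C" "r \<le> q" "r \<le> q'"
              using tot[OF q q'] q q' by blast
            have "u (x \<oplus> y) \<le> r x + r y"
              using lower[OF _ r(1), of "x \<oplus> y"] sublinear_add[OF sub[OF r(1)] x y] x y by simp
            then show "u (x \<oplus> y) - q x \<le> q' y"
              using r(2,3) le_funD[of r q x] le_funD[of r q' y] by linarith
          qed
          then show "u (x \<oplus> y) - u y \<le> q x"
            by linarith
        qed
        then show ?thesis
          by linarith
      qed
      moreover have "u (of_real t \<odot> x) = t * u x" if t: "0 < t" and x: "x \<in> carrier V" for t x
      proof (rule antisym)
        have "u (of_real t \<odot> x) / t \<le> u x"
        proof (rule greatest[OF x])
          fix q assume q: "q \<in> C"
          then show "u (of_real t \<odot> x) / t \<le> q x"
            using lower[OF _ q, of "of_real t \<odot> x"] sublinear_scale[OF sub[OF q] t x] t x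
            by (simp add: field_simps)
        qed
        then show "u (of_real t \<odot> x) \<le> t * u x"
          using t by (simp add: field_simps)
        show "t * u x \<le> u (of_real t \<odot> x)"
          using x t lower[OF x] by (intro greatest) (auto simp: sublinear_scale[OF sub])
      qed
      ultimately have "sublinear u"
        by (simp add: sublinear_def)
      moreover have "u x \<le> p x" if x: "x \<in> carrier V" for x
      proof -
        obtain q where "q \<in> C"
          using False by blast
        then show ?thesis
          using lower[OF x, of q] CA x by (force simp: A_def)
      qed
      ultimately have "u \<in> A"
        by (simp add: A_def u_def cut_def)
      moreover have "u \<le> q" if "q \<in> C" for q
        using lower[OF _ that] CA that by (auto simp: le_fun_def A_def u_def cut_def)
      ultimately show ?thesis
        by (auto simp: P_def)
    qed
  qed
  then obtain m where m: "m \<in> A" and min: "\<And>a. a \<in> A \<Longrightarrow> a \<le> m \<Longrightarrow> a = m"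
    by (auto simp: P_def)
  show thesis
  proof
    show "sublinear m" "\<And>x. x \<in> carrier V \<Longrightarrow> m x \<le> p x"
      using m by (auto simp: A_def)
    fix q x assume q: "sublinear q" "\<And>y. y \<in> carrier V \<Longrightarrow> q y \<le> m y" and x: "x \<in> carrier V"
    have "cut q \<in> A" "cut q \<le> m"
      using q m cut[OF q(1)] by (fastforce simp: A_def cut_def le_fun_def)+
    from min[OF this] show "q x = m x"
      using x by (metis cut_def)
  qed
qed

text \<open>Additivity forces \<open>f (\<ominus> x) = - f x\<close>, which carries homogeneity from
  positive to all real factors.\<close>

lemma real_linearI:
  assumes add: "\<And>x y. x \<in> carrier V \<Longrightarrow> y \<in> carrier V \<Longrightarrow> f (x \<oplus> y) = f x + f y"
    and scale: "\<And>t x. 0 < t \<Longrightarrow> x \<in> carrier V \<Longrightarrow> f (of_real t \<odot> x) = t * f x"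
  shows "real_linear f"
proof -
  have z: "f \<zero> = 0"
    using add[of \<zero> \<zero>] by simp
  have neg: "f (\<ominus> x) = - f x" if "x \<in> carrier V" for x
    using add[of x "\<ominus> x"] that z by (simp add: r_neg)
  have "f (of_real t \<odot> x) = t * f x" if x: "x \<in> carrier V" for t x
  proof (cases t "0 :: real" rule: linorder_cases)
    case less
    have "\<ominus> (of_real (- t) \<odot> x) = (- 1 * of_real (- t)) \<odot> x"
      using x by (simp only: smult_minus_1[symmetric] smult_smult smult_mem)
    also have "- 1 * of_real (- t) = (of_real t :: 'k)"
      by simp
    finally have "of_real t \<odot> x = \<ominus> (of_real (- t) \<odot> x)" ..
    then show ?thesis
      using neg[of "of_real (- t) \<odot> x"] scale[of "- t" x] less x by simp
  qed (use x z scale in auto)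
  with add show ?thesis
    by (simp add: real_linear_def)
qed

text \<open>A minimal sublinear \<open>m\<close> is already linear. For fixed \<open>y\<close> let
  \<open>K\<close> be the ray through \<open>(y, - m y)\<close>. Then \<open>cone_inf m K\<close> is
  sublinear and below \<open>m\<close>, hence equal to it, and its value at \<open>x\<close> is at
  most \<open>m (x \<oplus> y) - m y\<close>. This is superadditivity.\<close>

lemma sublinear_dominates_linear:
  assumes p: "sublinear p"
  obtains f where "real_linear f" "\<And>x. x \<in> carrier V \<Longrightarrow> f x \<le> p x"
proof -
  obtain m where m: "sublinear m" "\<And>x. x \<in> carrier V \<Longrightarrow> m x \<le> p x"
    and min: "\<And>q x. \<lbrakk>sublinear q; \<And>y. y \<in> carrier V \<Longrightarrow> q y \<le> m y; x \<in> carrier V\<rbrakk> \<Longrightarrow> q x = m x"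
    using minimal_sublinear[OF p] by blast
  have ge: "m x + m y \<le> m (x \<oplus> y)" if x: "x \<in> carrier V" and y: "y \<in> carrier V" for x y
  proof -
    define K where "K = {(of_real t \<odot> y, - t * m y) | t. 0 \<le> t}"
    have ray: "m (of_real t \<odot> y) = t * m y" if "0 \<le> t" for t
      using that y sublinear_scale[OF m(1), of t y] sublinear_zero[OF m(1)]
      by (cases "t = 0") auto
    have K: "cone K"
      unfolding cone_def
    proof (intro conjI allI impI)
      show "K \<subseteq> carrier V \<times> UNIV"
        using y by (auto simp: K_def)
      show "(\<zero>, 0) \<in> K"
        using y by (auto simp: K_def intro!: exI[of _ "0 :: real"])
    next
      fix a s a' s' assume "(a, s) \<in> K \<and> (a', s') \<in> K"
      then obtain t t' where "0 \<le> t" "0 \<le> t'" "a = of_real t \<odot> y" "s = - t * m y"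
        "a' = of_real t' \<odot> y" "s' = - t' * m y"
        by (auto simp: K_def)
      then show "(a \<oplus> a', s + s') \<in> K"
        using y unfolding K_def
        by (intro CollectI exI[of _ "t + t'"]) (auto simp: smult_add_left left_diff_distrib)
    next
      fix r :: real and a s assume r: "0 < r" and "(a, s) \<in> K"
      then obtain t where "0 \<le> t" "a = of_real t \<odot> y" "s = - t * m y"
        by (auto simp: K_def)
      then show "(of_real r \<odot> a, r * s) \<in> K"
        using y r unfolding K_def
        by (intro CollectI exI[of _ "r * t"]) (auto simp: smult_smult)
    qed
    have pos: "0 \<le> m a + s" if "(a, s) \<in> K" for a s
      using that ray by (auto simp: K_def)
    have r: "sublinear (cone_inf m K)"
      "\<And>x a s. x \<in> carrier V \<Longrightarrow> (a, s) \<in> K \<Longrightarrow> cone_inf m K x \<le> m (x \<oplus> a) + s"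
      "\<And>x. x \<in> carrier V \<Longrightarrow> cone_inf m K x \<le> m x"
      using cone_inf[OF m(1) K] pos by blast+
    have "cone_inf m K x = m x"
      using r(1,3) x by (intro min) auto
    moreover have "(y, - m y) \<in> K"
      using y by (auto simp: K_def intro!: exI[of _ "1 :: real"])
    ultimately show ?thesis
      using r(2)[OF x, of y "- m y"] by simp
  qed
  have "real_linear m"
    using ge sublinear_add[OF m(1)] sublinear_scale[OF m(1)]
    by (intro real_linearI) (auto intro: antisym)
  with m(2) that show thesis
    by blast
qed

lemma real_linear_neg:
  assumes "real_linear f" "x \<in> carrier V"
  shows "f (\<ominus> x) = - f x"
proof -
  have "f (of_real (- 1) \<odot> x) = (- 1) * f x"
    using assms unfolding real_linear_def by blast
  then show ?thesis
    using assms(2) by (simp add: smult_minus_1)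
qed

theorem Hahn_Banach_cone:
  assumes p: "sublinear p" and K: "cone K" and pos: "\<And>y s. (y, s) \<in> K \<Longrightarrow> 0 \<le> p y + s"
  obtains f where "real_linear f" "\<And>x. x \<in> carrier V \<Longrightarrow> f x \<le> p x"
    "\<And>y s. (y, s) \<in> K \<Longrightarrow> - s \<le> f y"
proof -
  have r: "sublinear (cone_inf p K)"
    "\<And>x y s. x \<in> carrier V \<Longrightarrow> (y, s) \<in> K \<Longrightarrow> cone_inf p K x \<le> p (x \<oplus> y) + s"
    "\<And>x. x \<in> carrier V \<Longrightarrow> cone_inf p K x \<le> p x"
    using cone_inf[OF p K] pos by blast+
  obtain f where f: "real_linear f" "\<And>x. x \<in> carrier V \<Longrightarrow> f x \<le> cone_inf p K x"
    using sublinear_dominates_linear[OF r(1)] by blast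
  show thesis
  proof
    show "real_linear f" by fact
    show "f x \<le> p x" if "x \<in> carrier V" for x
      using f(2)[OF that] r(3)[OF that] by linarith
    fix y s assume ys: "(y, s) \<in> K"
    then have y: "y \<in> carrier V"
      using K by (auto simp: cone_def)
    \<comment> \<open>Evaluating the infimum at \<open>\<ominus> y\<close> cancels \<open>y\<close>
      inside \<open>p\<close> and leaves only \<open>s\<close>.\<close>
    have "f (\<ominus> y) \<le> p (\<ominus> y \<oplus> y) + s"
      using f(2)[of "\<ominus> y"] r(2)[of "\<ominus> y", OF _ ys] y by simp
    then show "- s \<le> f y"
      using y by (simp add: l_neg sublinear_zero[OF p] real_linear_neg[OF f(1)])
  qed
qed

end

section \<open>Linear functionals dominated by seminorms\<close>

lemma ground_simps [simp]:
  "carrier ground = UNIV" "\<zero>\<^bsub>ground\<^esub> = 0" "x \<oplus>\<^bsub>ground\<^esub> y = x + y" "c \<odot>\<^bsub>ground\<^esub> x = c * x"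
  "vtop ground = euclidean"
  by (simp_all add: ground_def)

lemma vector_sp_ground: "vector_sp ground"
  by (rule vector_spI) (auto simp: algebra_simps)

lemma linear_mapsI:
  assumes "\<And>x. x \<in> carrier V \<Longrightarrow> f x \<in> carrier W" "f \<in> extensional (carrier V)"
    and "\<And>x y. x \<in> carrier V \<Longrightarrow> y \<in> carrier V \<Longrightarrow> f (x \<oplus>\<^bsub>V\<^esub> y) = f x \<oplus>\<^bsub>W\<^esub> f y"
    and "\<And>c x. x \<in> carrier V \<Longrightarrow> f (c \<odot>\<^bsub>V\<^esub> x) = c \<odot>\<^bsub>W\<^esub> f x"
  shows "f \<in> linear_maps V W"
  using assms by (auto simp: linear_maps_def PiE_def)

lemma linear_mapsD:
  assumes "f \<in> linear_maps V W"
  shows "x \<in> carrier V \<Longrightarrow> f x \<in> carrier W" "f \<in> extensional (carrier V)"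
    "x \<in> carrier V \<Longrightarrow> y \<in> carrier V \<Longrightarrow> f (x \<oplus>\<^bsub>V\<^esub> y) = f x \<oplus>\<^bsub>W\<^esub> f y"
    "x \<in> carrier V \<Longrightarrow> f (c \<odot>\<^bsub>V\<^esub> x) = c \<odot>\<^bsub>W\<^esub> f x"
  using assms by (auto simp: linear_maps_def PiE_def)

lemma linear_maps_eqI:
  assumes "f \<in> linear_maps V W" "g \<in> linear_maps V W'" "\<And>x. x \<in> carrier V \<Longrightarrow> f x = g x"
  shows "f = g"
  using assms by (metis extensionalityI linear_mapsD(2))

text \<open>
  In the real case \<open>j = 0\<close>, in the complex case \<open>j\<close> is the imaginary unit. The
  factor 2 spares the proof that the norm on the field is the usual absolute value.
\<close>

locale real_part =
  fixes re :: "'k::real_or_complex \<Rightarrow> real" and j :: 'k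
  assumes re_add: "re (x + y) = re x + re y"
    and re_scale: "re (of_real t * x) = t * re x"
    and re_1: "re 1 = 1"
    and re_j: "re j = 0"
    and decompose: "z = of_real (re z) - j * of_real (re (j * z))"
    and j_cases: "j = 0 \<or> j * j = - 1"
    and abs_re_le: "\<bar>re z\<bar> \<le> 2 * norm z"
begin

lemma re_of_real [simp]: "re (of_real t) = t"
  using re_scale[of t 1] re_1 by simp

lemma re_neg: "re (- z) = - re z"
  using re_scale[of "-1" z] by simp

lemma re_diff: "re (x - y) = re x - re y"
  using re_add[of x "- y"] re_neg by simp

lemma re_j_of_real [simp]: "re (j * of_real t) = 0"
  using re_scale[of t j] re_j by (simp add: mult.commute)

end

text \<open>The class supplies only a spanning pair 1, \<open>i\<close>. If \<open>i\<close> is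
  real, every scalar is real and \<open>j = 0\<close> works. Otherwise \<open>i * i = - 1\<close>
  and the pair is independent over the reals, so the coordinate functions are well defined and
  additive, and \<open>j = i\<close>.\<close>

lemma real_part_exists: "\<exists>(re :: 'k::real_or_complex \<Rightarrow> real) j. real_part re j"
proof -
  obtain i :: 'k where i: "(\<exists>c. i = c *\<^sub>R 1) \<or> i * i = - 1"
    and span: "\<And>x. \<exists>a b. x = a *\<^sub>R 1 + b *\<^sub>R i"
    using real_or_complex_span by blast
  show ?thesis
  proof (cases "\<exists>c. i = c *\<^sub>R 1")
    case True
    then obtain c where c: "i = c *\<^sub>R 1" ..
    have "\<exists>a. x = of_real a" for x :: 'k
    proof -
      obtain a b where "x = a *\<^sub>R 1 + b *\<^sub>R i"
        using span by blast
      then have "x = of_real (a + b * c)"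
        by (simp add: c of_real_def algebra_simps)
      then show ?thesis ..
    qed
    then obtain re where re: "\<And>x :: 'k. x = of_real (re x)"
      by metis
    have inj: "re (of_real t) = t" for t
      using re[of "of_real t"] by (metis of_real_eq_iff)
    have "real_part re 0"
    proof
      fix x y z :: 'k and t
      show "re (x + y) = re x + re y"
        by (metis inj of_real_add re)
      show "re (of_real t * x) = t * re x"
        by (metis inj of_real_mult re)
      show "re 1 = 1"
        by (metis inj of_real_1)
      show "re 0 = 0"
        by (metis inj of_real_0)
      show "z = of_real (re z) - 0 * of_real (re (0 * z))"
        using re by simp
      have "norm z = \<bar>re z\<bar>"
        by (metis norm_of_real re)
      then show "\<bar>re z\<bar> \<le> 2 * norm z"
        by simp
    qed simp
    then show ?thesis by blast
  next
    case False
    with i have ii: "i * i = - 1"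
      by blast
    \<comment> \<open>A relation with nonzero coefficient of \<open>i\<close> could be solved for
      \<open>i\<close> and would make it real.\<close>
    have indep: "a = 0 \<and> b = 0" if "of_real a + of_real b * i = 0" for a b :: real
    proof (cases "b = 0")
      case True
      then show ?thesis using that by simp
    next
      case b: False
      have "of_real b * i = of_real (- a)"
        using that by (simp add: eq_neg_iff_add_eq_0 add.commute)
      then have "i = of_real (- a / b)"
        using b by (simp add: field_simps)
      then have "i = (- a / b) *\<^sub>R 1"
        by (simp add: of_real_def)
      then show ?thesis
        using False by blast
    qed
    have uniq: "a = a' \<and> b = b'"
      if "of_real a + of_real b * i = of_real a' + of_real b' * i" for a b a' b' :: real
      using indep[of "a - a'" "b - b'"] that by (simp add: algebra_simps)
    have "\<forall>x. \<exists>a b. x = of_real a + of_real b * i"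
      using span by (simp add: of_real_def)
    then obtain re im where ri: "\<And>x. x = of_real (re x) + of_real (im x) * i"
      by metis
    have re_eq: "re x = a \<and> im x = b" if "x = of_real a + of_real b * i" for x a b
      using that ri uniq by metis
    have "real_part re i"
    proof
      fix x y z :: 'k and t
      have "x + y = of_real (re x + re y) + of_real (im x + im y) * i"
        using ri[of x] ri[of y] by (simp add: algebra_simps)
      then show "re (x + y) = re x + re y"
        using re_eq by blast
      have "of_real t * x = of_real (t * re x) + of_real (t * im x) * i"
        by (subst ri[of x]) (simp add: algebra_simps)
      then show "re (of_real t * x) = t * re x"
        using re_eq by blast
      show "re 1 = 1"
        using re_eq[of 1 1 0] by simp
      show "re i = 0"
        using re_eq[of i 0 1] by simp
      have "i * z = i * of_real (re z) + i * of_real (im z) * i"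
        by (subst ri[of z]) (simp add: algebra_simps)
      also have "\<dots> = (i * i) * of_real (im z) + of_real (re z) * i"
        by (simp add: algebra_simps)
      also have "\<dots> = of_real (- im z) + of_real (re z) * i"
        by (simp add: ii)
      finally have "re (i * z) = - im z"
        using re_eq by blast
      then show "z = of_real (re z) - i * of_real (re (i * z))"
        using ri[of z] by (simp add: mult.commute)
      show "i = 0 \<or> i * i = - 1"
        using ii by blast
      define a b where "a = re z" and "b = im z"
      have z: "z = of_real a + of_real b * i"
        using ri a_def b_def by blast
      have i1: "norm i = 1"
      proof -
        have "norm i * norm i = 1"
          by (simp add: norm_mult[symmetric] ii)
        then show ?thesis
          by (metis abs_norm_cancel real_sqrt_abs2 real_sqrt_one)
      qed
      \<comment> \<open>Multiplying by the conjugate gives the sum of squares, while the norm of the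
        conjugate is at most \<open>\<bar>a\<bar> + \<bar>b\<bar>\<close>. With
        \<open>(\<bar>a\<bar> + \<bar>b\<bar>)^2 \<le> 2 * (a^2 + b^2)\<close> this yields
        \<open>\<bar>a\<bar> + \<bar>b\<bar> \<le> 2 * norm z\<close>, which is where the factor 2
        arises.\<close>
      have "z * (of_real a - of_real b * i) = of_real a * of_real a - of_real b * of_real b * (i * i)"
        unfolding z by (simp add: algebra_simps)
      also have "\<dots> = of_real (a * a + b * b)"
        by (simp add: ii)
      finally have "norm z * norm (of_real a - of_real b * i) = \<bar>a * a + b * b\<bar>"
        by (metis norm_mult norm_of_real)
      moreover have "norm (of_real a - of_real b * i) \<le> \<bar>a\<bar> + \<bar>b\<bar>"
        using norm_triangle_ineq4[of "of_real a" "of_real b * i"] by (simp add: norm_mult i1)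
      ultimately have "\<bar>a * a + b * b\<bar> \<le> norm z * (\<bar>a\<bar> + \<bar>b\<bar>)"
        by (metis mult_left_mono norm_ge_zero)
      moreover have "(\<bar>a\<bar> + \<bar>b\<bar>) * (\<bar>a\<bar> + \<bar>b\<bar>) \<le> 2 * \<bar>a * a + b * b\<bar>"
        using zero_le_square[of "\<bar>a\<bar> - \<bar>b\<bar>"] by (simp add: algebra_simps)
      ultimately have le: "(\<bar>a\<bar> + \<bar>b\<bar>) * (\<bar>a\<bar> + \<bar>b\<bar>) \<le> (2 * norm z) * (\<bar>a\<bar> + \<bar>b\<bar>)"
        by simp
      have "\<bar>a\<bar> \<le> 2 * norm z"
      proof (cases "\<bar>a\<bar> + \<bar>b\<bar> = 0")
        case False
        then have "\<bar>a\<bar> + \<bar>b\<bar> \<le> 2 * norm z"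
          using le by (metis abs_ge_zero add_nonneg_nonneg linorder_le_less_linear
              mult_right_le_imp_le order_antisym_conv)
        then show ?thesis
          by linarith
      qed (use norm_ge_zero[of z] in linarith)
      then show "\<bar>re z\<bar> \<le> 2 * norm z"
        by (simp add: a_def)
    qed
    then show ?thesis by blast
  qed
qed

section \<open>Seminorms, and functionals recovered from their real parts\<close>

context kspace
begin

definition seminorm :: "('a \<Rightarrow> real) \<Rightarrow> bool" where
  "seminorm p \<longleftrightarrow> (\<forall>x\<in>carrier V. \<forall>y\<in>carrier V. p (x \<oplus> y) \<le> p x + p y) \<and>
    (\<forall>c. \<forall>x\<in>carrier V. p (c \<odot> x) = norm c * p x)"

lemma seminorm_add:
  "seminorm p \<Longrightarrow> x \<in> carrier V \<Longrightarrow> y \<in> carrier V \<Longrightarrow> p (x \<oplus> y) \<le> p x + p y"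
  by (simp add: seminorm_def)

lemma seminorm_scale: "seminorm p \<Longrightarrow> x \<in> carrier V \<Longrightarrow> p (c \<odot> x) = norm c * p x"
  by (simp add: seminorm_def)

lemma seminorm_zero: "seminorm p \<Longrightarrow> p \<zero> = 0"
  using seminorm_scale[of p \<zero> 0] by simp

lemma seminorm_neg: "seminorm p \<Longrightarrow> x \<in> carrier V \<Longrightarrow> p (\<ominus> x) = p x"
  using seminorm_scale[of p x "-1"] by (simp add: smult_minus_1)

lemma seminorm_nonneg: "seminorm p \<Longrightarrow> x \<in> carrier V \<Longrightarrow> 0 \<le> p x"
  using seminorm_add[of p x "\<ominus> x"] by (simp add: seminorm_neg seminorm_zero r_neg)

lemma seminorm_plus: "seminorm p \<Longrightarrow> seminorm q \<Longrightarrow> seminorm (\<lambda>x. p x + q x)"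
proof -
  assume p: "seminorm p" and q: "seminorm q"
  have "p (x \<oplus> y) + q (x \<oplus> y) \<le> (p x + q x) + (p y + q y)"
    if "x \<in> carrier V" "y \<in> carrier V" for x y
    using seminorm_add[OF p that] seminorm_add[OF q that] by linarith
  then show "seminorm (\<lambda>x. p x + q x)"
    using p q by (simp add: seminorm_def distrib_left)
qed

lemma seminorm_times: "seminorm p \<Longrightarrow> 0 \<le> c \<Longrightarrow> seminorm (\<lambda>x. c * p x)"
  unfolding seminorm_def by (auto simp: mult_left_mono distrib_left[symmetric])

lemma seminorm_null: "seminorm (\<lambda>_. 0)"
  by (simp add: seminorm_def)

lemma seminorm_norm_functional: "\<phi> \<in> linear_maps V ground \<Longrightarrow> seminorm (\<lambda>x. norm (\<phi> x))"
  by (auto simp: seminorm_def linear_mapsD norm_mult norm_triangle_ineq)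

lemma seminorm_imp_sublinear: "seminorm p \<Longrightarrow> sublinear p"
  by (simp add: seminorm_def sublinear_def)

end

locale kspace_real_part = kspace V + real_part re j
  for V :: "('k::real_or_complex, 'a, 'z) module_scheme" (structure) and re :: "'k \<Rightarrow> real" and j :: 'k
begin

text \<open>Shows that a functional is determined by its real part, so that later equalities need
  checking for real parts only.\<close>

lemma functional_decompose:
  assumes "\<phi> \<in> linear_maps V ground" "x \<in> carrier V"
  shows "\<phi> x = of_real (re (\<phi> x)) - j * of_real (re (\<phi> (j \<odot> x)))"
  using decompose[of "\<phi> x"] linear_mapsD(4)[OF assms] by simp

text \<open>The functional is forced by the decomposition: \<open>f x - j * f (j \<odot> x)\<close>.
  Every scalar is a real combination of 1 and \<open>j\<close>, so linearity over the field reduces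
  to real homogeneity and compatibility with \<open>j\<close>.\<close>

lemma functional_of_real_part:
  assumes f: "real_linear f"
  obtains \<phi> where "\<phi> \<in> linear_maps V ground" "\<And>x. x \<in> carrier V \<Longrightarrow> re (\<phi> x) = f x"
proof -
  define \<phi> where "\<phi> = (\<lambda>x\<in>carrier V. of_real (f x) - j * of_real (f (j \<odot> x)))"
  have add: "f (x \<oplus> y) = f x + f y" if "x \<in> carrier V" "y \<in> carrier V" for x y
    using f that by (simp add: real_linear_def)
  have scale: "f (of_real t \<odot> x) = t * f x" if "x \<in> carrier V" for t x
    using f that by (simp add: real_linear_def)
  have \<phi>_add: "\<phi> (x \<oplus> y) = \<phi> x + \<phi> y" if "x \<in> carrier V" "y \<in> carrier V" for x y
    using that by (simp add: \<phi>_def add smult_add_right algebra_simps)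
  have \<phi>_real: "\<phi> (of_real t \<odot> x) = of_real t * \<phi> x" if x: "x \<in> carrier V" for t x
  proof -
    have "j \<odot> (of_real t \<odot> x) = of_real t \<odot> (j \<odot> x)"
      using x by (simp add: smult_smult mult.commute)
    then show ?thesis
      using x by (simp add: \<phi>_def scale algebra_simps)
  qed
  have \<phi>_j: "\<phi> (j \<odot> x) = j * \<phi> x" if x: "x \<in> carrier V" for x
    using j_cases
  proof
    assume "j = 0"
    then show ?thesis
      using x scale[of x 0] scale[of \<zero> 0] by (simp add: \<phi>_def)
  next
    assume jj: "j * j = - 1"
    have "f (j \<odot> (j \<odot> x)) = - f x"
      using x scale[of x "-1"] by (simp add: smult_smult jj)
    moreover have "j * (j * c) = - c" for c
      by (simp add: mult.assoc[symmetric] jj)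
    ultimately show ?thesis
      using x by (simp add: \<phi>_def right_diff_distrib)
  qed
  have "\<phi> \<in> linear_maps V ground"
  proof (rule linear_mapsI)
    show "\<phi> \<in> extensional (carrier V)"
      by (simp add: \<phi>_def)
    fix c x assume x: "x \<in> carrier V"
    \<comment> \<open>Coordinates of \<open>c\<close> with respect to 1 and \<open>j\<close>, read
      off from \<open>decompose\<close>.\<close>
    define s t where "s = re c" and "t = - re (j * c)"
    have c: "c = of_real s + of_real t * j"
      using decompose[of c] by (simp add: s_def t_def mult.commute)
    have "c \<odot> x = of_real s \<odot> x \<oplus> of_real t \<odot> (j \<odot> x)"
      using x by (simp add: c smult_add_left smult_smult)
    then have "\<phi> (c \<odot> x) = of_real s * \<phi> x + of_real t * (j * \<phi> x)"
      using x by (simp add: \<phi>_add \<phi>_real \<phi>_j)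
    then show "\<phi> (c \<odot> x) = c \<odot>\<^bsub>ground\<^esub> \<phi> x"
      by (simp add: c algebra_simps)
  qed (use \<phi>_add in auto)
  moreover have "re (\<phi> x) = f x" if "x \<in> carrier V" for x
    using that by (simp add: \<phi>_def re_diff)
  ultimately show thesis
    using that by blast
qed

text \<open>Rotate \<open>x\<close> by a scalar of modulus one that makes \<open>\<phi> x\<close> equal to its modulus.\<close>

lemma norm_functional_le:
  assumes \<phi>: "\<phi> \<in> linear_maps V ground" and p: "seminorm p"
    and le: "\<And>x. x \<in> carrier V \<Longrightarrow> re (\<phi> x) \<le> p x" and x: "x \<in> carrier V"
  shows "norm (\<phi> x) \<le> p x"
proof (cases "\<phi> x = 0")
  case True
  then show ?thesis
    using seminorm_nonneg[OF p x] by simp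
next
  case False
  define u where "u = of_real (norm (\<phi> x)) / \<phi> x"
  have "norm u = 1"
    using False by (simp add: u_def norm_divide)
  moreover have "\<phi> (u \<odot> x) = of_real (norm (\<phi> x))"
    using linear_mapsD(4)[OF \<phi> x] False by (simp add: u_def)
  ultimately show ?thesis
    using le[of "u \<odot> x"] x seminorm_scale[OF p x, of u] by simp
qed

end

text \<open>The cone \<open>K\<close> encodes \<open>f (h x) \<ge> re (\<phi> x)\<close>. As the
  image of a subspace it contains the constraint for the negative of \<open>x\<close> too, which
  turns these inequalities into equalities. The bound on \<open>\<phi>\<close> makes the constraints
  consistent with \<open>2 * p\<close>, the 2 coming from \<open>abs_re_le\<close>.\<close>

lemma extend_functional_along:
  fixes V :: "('k::real_or_complex, 'a, 'y) module_scheme"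
    and W :: "('k, 'b, 'z) module_scheme"
  assumes "kspace V" "kspace W" and h: "h \<in> linear_maps V W"
    and \<phi>: "\<phi> \<in> linear_maps V ground" and p: "kspace.seminorm W p"
    and le: "\<And>x. x \<in> carrier V \<Longrightarrow> norm (\<phi> x) \<le> p (h x)"
  obtains \<psi> where "\<psi> \<in> linear_maps W ground" "\<And>y. y \<in> carrier W \<Longrightarrow> norm (\<psi> y) \<le> 2 * p y"
    "\<And>x. x \<in> carrier V \<Longrightarrow> \<psi> (h x) = \<phi> x"
proof -
  obtain re :: "'k \<Rightarrow> real" and j where re: "real_part re j"
    using real_part_exists by blast
  interpret V: kspace_real_part V re j
    using assms(1) re by (simp add: kspace_real_part_def)
  interpret W: kspace_real_part W re j
    using assms(2) re by (simp add: kspace_real_part_def)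
  define K where "K = (\<lambda>x. (h x, - re (\<phi> x))) ` carrier V"
  have p2: "W.seminorm (\<lambda>y. 2 * p y)"
    by (rule W.seminorm_times[OF p]) simp
  have h0: "h \<zero>\<^bsub>V\<^esub> = \<zero>\<^bsub>W\<^esub>"
    using linear_mapsD(4)[OF h V.zero_closed, of 0] linear_mapsD(1)[OF h V.zero_closed] by simp
  have \<phi>0: "\<phi> \<zero>\<^bsub>V\<^esub> = 0"
    using linear_mapsD(4)[OF \<phi> V.zero_closed, of 0] by simp
  have K: "W.cone K"
    unfolding W.cone_def
  proof (intro conjI allI impI)
    show "K \<subseteq> carrier W \<times> UNIV"
      using linear_mapsD(1)[OF h] by (auto simp: K_def)
    show "(\<zero>\<^bsub>W\<^esub>, 0) \<in> K"
      using h0 \<phi>0 V.re_of_real[of 0] by (auto simp: K_def intro!: image_eqI[of _ _ "\<zero>\<^bsub>V\<^esub>"])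
  next
    fix y s y' s' assume "(y, s) \<in> K \<and> (y', s') \<in> K"
    then obtain x x' where "x \<in> carrier V" "x' \<in> carrier V" "y = h x" "s = - re (\<phi> x)"
      "y' = h x'" "s' = - re (\<phi> x')"
      by (auto simp: K_def)
    then show "(y \<oplus>\<^bsub>W\<^esub> y', s + s') \<in> K"
      unfolding K_def
      by (intro image_eqI[of _ _ "x \<oplus>\<^bsub>V\<^esub> x'"])
        (auto simp: linear_mapsD(3)[OF h] linear_mapsD(3)[OF \<phi>] V.re_add)
  next
    fix t :: real and y s assume "0 < t" "(y, s) \<in> K"
    then obtain x where "x \<in> carrier V" "y = h x" "s = - re (\<phi> x)"
      by (auto simp: K_def)
    then show "(of_real t \<odot>\<^bsub>W\<^esub> y, t * s) \<in> K"
      unfolding K_def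
      by (intro image_eqI[of _ _ "of_real t \<odot>\<^bsub>V\<^esub> x"])
        (auto simp: linear_mapsD(4)[OF h] linear_mapsD(4)[OF \<phi>] V.re_scale)
  qed
  have pos: "0 \<le> 2 * p y + s" if "(y, s) \<in> K" for y s
  proof -
    from that obtain x where "x \<in> carrier V" "y = h x" "s = - re (\<phi> x)"
      by (auto simp: K_def)
    then show ?thesis
      using le[of x] V.abs_re_le[of "\<phi> x"] by simp
  qed
  obtain f where f: "W.real_linear f" "\<And>y. y \<in> carrier W \<Longrightarrow> f y \<le> 2 * p y"
    "\<And>y s. (y, s) \<in> K \<Longrightarrow> - s \<le> f y"
    using W.Hahn_Banach_cone[OF W.seminorm_imp_sublinear[OF p2] K pos] by blast
  have ge: "re (\<phi> x) \<le> f (h x)" if "x \<in> carrier V" for x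
    using f(3)[of "h x" "- re (\<phi> x)"] that by (simp add: K_def)
  have f_h: "f (h x) = re (\<phi> x)" if x: "x \<in> carrier V" for x
  proof -
    have "re (\<phi> (\<ominus>\<^bsub>V\<^esub> x)) = - re (\<phi> x)"
      using linear_mapsD(4)[OF \<phi> x, of "-1"] V.re_neg x by (simp add: V.smult_minus_1)
    moreover have "h (\<ominus>\<^bsub>V\<^esub> x) = \<ominus>\<^bsub>W\<^esub> h x"
      using linear_mapsD(4)[OF h x, of "-1"] linear_mapsD(1)[OF h x] x
      by (simp add: V.smult_minus_1 W.smult_minus_1)
    ultimately show ?thesis
      using ge[of x] ge[of "\<ominus>\<^bsub>V\<^esub> x"] x W.real_linear_neg[OF f(1) linear_mapsD(1)[OF h x]] by simp
  qed
  obtain \<psi> where \<psi>: "\<psi> \<in> linear_maps W ground" "\<And>y. y \<in> carrier W \<Longrightarrow> re (\<psi> y) = f y"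
    using W.functional_of_real_part[OF f(1)] by blast
  show thesis
  proof
    show "\<psi> \<in> linear_maps W ground" by fact
    show "norm (\<psi> y) \<le> 2 * p y" if "y \<in> carrier W" for y
      using W.norm_functional_le[OF \<psi>(1) p2 _ that] \<psi>(2) f(2) by simp
    show "\<psi> (h x) = \<phi> x" if x: "x \<in> carrier V" for x
    proof -
      \<comment> \<open>Equal real parts at \<open>x\<close> and at its multiple by \<open>j\<close>
        give equal values, by \<open>functional_decompose\<close> on both sides.\<close>
      have "j \<odot>\<^bsub>W\<^esub> h x = h (j \<odot>\<^bsub>V\<^esub> x)"
        using linear_mapsD(4)[OF h x] by simp
      then show ?thesis
        using W.functional_decompose[OF \<psi>(1), of "h x"] V.functional_decompose[OF \<phi> x]
          linear_mapsD(1)[OF h] x \<psi>(2) f_h by simp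
    qed
  qed
qed

context kspace
begin

text \<open>The first summand must satisfy \<open>re (\<phi>1 x) \<le> 2 * p x\<close>, and the
  bound on the second one reads \<open>re (\<phi>1 x) \<ge> re (\<phi> x) - 2 * q x\<close>. The
  latter is a family of constraints indexed by the epigraph \<open>K\<close> of the sublinear
  functional \<open>2 * q - re \<phi>\<close>, hence by a convex cone. Consistency with
  \<open>2 * p\<close> is the assumed bound on \<open>\<phi>\<close>.\<close>

lemma split_functional:
  assumes \<phi>: "\<phi> \<in> linear_maps V ground" and p: "seminorm p" and q: "seminorm q"
    and le: "\<And>x. x \<in> carrier V \<Longrightarrow> norm (\<phi> x) \<le> p x + q x"
  obtains \<phi>1 \<phi>2 where "\<phi>1 \<in> linear_maps V ground" "\<phi>2 \<in> linear_maps V ground"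
    "\<And>x. x \<in> carrier V \<Longrightarrow> \<phi> x = \<phi>1 x + \<phi>2 x"
    "\<And>x. x \<in> carrier V \<Longrightarrow> norm (\<phi>1 x) \<le> 2 * p x" "\<And>x. x \<in> carrier V \<Longrightarrow> norm (\<phi>2 x) \<le> 2 * q x"
proof -
  obtain re :: "'k \<Rightarrow> real" and j where re: "real_part re j"
    using real_part_exists by blast
  interpret kspace_real_part V re j
    using vector_sp re by (simp add: kspace_real_part_def kspace_def)
  define K where "K = {(x, s). x \<in> carrier V \<and> 2 * q x - re (\<phi> x) \<le> s}"
  have p2: "seminorm (\<lambda>y. 2 * p y)" and q2: "seminorm (\<lambda>y. 2 * q y)"
    by (rule seminorm_times[OF p] seminorm_times[OF q]; simp)+
  have \<phi>0: "\<phi> \<zero> = 0"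
    using linear_mapsD(4)[OF \<phi> zero_closed, of 0] by simp
  have K: "cone K"
    unfolding cone_def
  proof (intro conjI allI impI)
    show "K \<subseteq> carrier V \<times> UNIV"
      by (auto simp: K_def)
    show "(\<zero>, 0) \<in> K"
      using re_of_real[of 0] by (simp add: K_def \<phi>0 seminorm_zero[OF q])
  next
    fix y s y' s' assume "(y, s) \<in> K \<and> (y', s') \<in> K"
    then show "(y \<oplus> y', s + s') \<in> K"
      using seminorm_add[OF q, of y y'] by (auto simp: K_def linear_mapsD(3)[OF \<phi>] re_add)
  next
    fix t :: real and y s assume t: "0 < t" "(y, s) \<in> K"
    then have "t * (2 * q y - re (\<phi> y)) \<le> t * s"
      by (simp add: K_def)
    then show "(of_real t \<odot> y, t * s) \<in> K"
      using t by (auto simp: K_def linear_mapsD(4)[OF \<phi>] re_scale seminorm_scale[OF q] algebra_simps)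
  qed
  have pos: "0 \<le> 2 * p y + s" if "(y, s) \<in> K" for y s
    using le[of y] abs_re_le[of "\<phi> y"] that by (auto simp: K_def)
  obtain f where f: "real_linear f" "\<And>y. y \<in> carrier V \<Longrightarrow> f y \<le> 2 * p y"
    "\<And>y s. (y, s) \<in> K \<Longrightarrow> - s \<le> f y"
    using Hahn_Banach_cone[OF seminorm_imp_sublinear[OF p2] K pos] by blast
  obtain \<phi>1 where \<phi>1: "\<phi>1 \<in> linear_maps V ground" "\<And>y. y \<in> carrier V \<Longrightarrow> re (\<phi>1 y) = f y"
    using functional_of_real_part[OF f(1)] by blast
  define \<phi>2 where "\<phi>2 = (\<lambda>x\<in>carrier V. \<phi> x - \<phi>1 x)"
  have \<phi>2: "\<phi>2 \<in> linear_maps V ground"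
    by (rule linear_mapsI)
      (auto simp: \<phi>2_def linear_mapsD[OF \<phi>] linear_mapsD[OF \<phi>1(1)] right_diff_distrib)
  show thesis
  proof
    show "\<phi>1 \<in> linear_maps V ground" "\<phi>2 \<in> linear_maps V ground" by fact+
    fix x assume x: "x \<in> carrier V"
    show "\<phi> x = \<phi>1 x + \<phi>2 x"
      using x by (simp add: \<phi>2_def)
    show "norm (\<phi>1 x) \<le> 2 * p x"
      using norm_functional_le[OF \<phi>1(1) p2 _ x] \<phi>1(2) f(2) by simp
    have "re (\<phi>2 y) \<le> 2 * q y" if y: "y \<in> carrier V" for y
      using f(3)[of y "2 * q y - re (\<phi> y)"] \<phi>1(2)[OF y] y by (simp add: K_def \<phi>2_def re_diff)
    then show "norm (\<phi>2 x) \<le> 2 * q x"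
      using norm_functional_le[OF \<phi>2 q2 _ x] by simp
  qed
qed

end

section \<open>Locally convex topologies and seminorms\<close>

lemma with_topology_simps [simp]:
  "carrier (with_topology M T) = carrier M" "zero (with_topology M T) = zero M"
  "add (with_topology M T) = add M" "smult (with_topology M T) = smult M"
  "vtop (with_topology M T) = T"
  by (simp_all add: with_topology_def module.defs tvs.defs)

lemma a_inv_with_topology [simp]: "a_inv (with_topology M T) = a_inv M"
  by (simp add: a_inv_def m_inv_def fun_eq_iff)

lemma a_minus_with_topology [simp]: "a_minus (with_topology M T) = a_minus M"
  by (simp add: a_minus_def fun_eq_iff)

lemma linear_maps_with_topology [simp]:
  "linear_maps (with_topology M T) W = linear_maps M W"
  "linear_maps W (with_topology M T) = linear_maps W M"
  by (simp_all add: linear_maps_def)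

lemma vector_sp_with_topology [simp]: "vector_sp (with_topology M T) \<longleftrightarrow> vector_sp M"
proof
  show "vector_sp (with_topology M T)" if "vector_sp M"
  proof -
    interpret kspace M by (rule kspace.intro) fact
    show ?thesis
      by (rule vector_spI)
        (auto simp: a_ac smult_add_left smult_add_right smult_smult)
  qed
  show "vector_sp M" if "vector_sp (with_topology M T)"
  proof -
    interpret kspace "with_topology M T" by (rule kspace.intro) fact
    show ?thesis
      using a_closed zero_closed smult_mem a_assoc a_comm l_zero smult_add_left
        smult_add_right smult_smult smult_1 smult_0
      by (intro vector_spI) simp_all
  qed
qed

section \<open>Differences, convex sets and the Minkowski gauge\<close>

context kspace
begin

lemma minus_self [simp]: "x \<in> carrier V \<Longrightarrow> x \<ominus> x = \<zero>"
  by (simp add: a_minus_def r_neg)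

lemma minus_zero_right [simp]: "x \<in> carrier V \<Longrightarrow> x \<ominus> \<zero> = x"
  using minus_equality[of \<zero> \<zero>] by (simp add: a_minus_def)

lemma minus_minus_cancel:
  assumes "x \<in> carrier V" "y \<in> carrier V" "z \<in> carrier V"
  shows "(z \<ominus> y) \<oplus> (y \<ominus> x) = z \<ominus> x"
  using assms by (simp add: a_minus_def a_assoc[symmetric])

lemma add_minus_cancel: "x \<in> carrier V \<Longrightarrow> y \<in> carrier V \<Longrightarrow> x \<oplus> (y \<ominus> x) = y"
  using minus_minus_cancel[of \<zero> x y] by (simp add: a_comm)

lemma eq_if_minus_zero:
  assumes "x \<in> carrier V" "y \<in> carrier V" "x \<ominus> y = \<zero>"
  shows "x = y"
  using add_minus_cancel[OF assms(2,1)] assms by simp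

lemma add_minus_add:
  assumes "a \<in> carrier V" "b \<in> carrier V" "c \<in> carrier V" "d \<in> carrier V"
  shows "(a \<oplus> b) \<ominus> (c \<oplus> d) = (a \<ominus> c) \<oplus> (b \<ominus> d)"
  using assms by (simp add: a_minus_def minus_add a_ac)

lemma smult_minus: "x \<in> carrier V \<Longrightarrow> y \<in> carrier V \<Longrightarrow> c \<odot> (x \<ominus> y) = c \<odot> x \<ominus> c \<odot> y"
  by (simp add: a_minus_def smult_add_right smult_minus_right)

lemma smult_minus_left: "x \<in> carrier V \<Longrightarrow> (a - b) \<odot> x = a \<odot> x \<ominus> b \<odot> x"
  using smult_add_left[of x a "- b"] smult_smult[of x "-1" b]
  by (simp add: a_minus_def smult_minus_1)

lemma seminorm_triangle:
  assumes "seminorm p" "x \<in> carrier V" "y \<in> carrier V" "z \<in> carrier V"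
  shows "p (z \<ominus> x) \<le> p (z \<ominus> y) + p (y \<ominus> x)"
  using seminorm_add[OF assms(1), of "z \<ominus> y" "y \<ominus> x"] assms by (simp add: minus_minus_cancel)

lemma functional_minus:
  assumes "\<phi> \<in> linear_maps V ground" "x \<in> carrier V" "y \<in> carrier V"
  shows "\<phi> (x \<ominus> y) = \<phi> x - \<phi> y"
  using assms linear_mapsD(4)[OF assms(1,3), of "-1"]
  by (simp add: a_minus_def linear_mapsD(3) smult_minus_1)

lemma convex_inI:
  assumes "C \<subseteq> carrier V"
    and "\<And>x y t. \<lbrakk>x \<in> C; y \<in> C; 0 \<le> t; t \<le> 1\<rbrakk> \<Longrightarrow> of_real t \<odot> x \<oplus> of_real (1 - t) \<odot> y \<in> C"
  shows "convex_in V C"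
  using assms by (auto simp: convex_in_def)

lemma convex_inD:
  assumes "convex_in V C" "x \<in> C" "y \<in> C" "0 \<le> t" "t \<le> 1"
  shows "of_real t \<odot> x \<oplus> of_real (1 - t) \<odot> y \<in> C"
  using assms unfolding convex_in_def by blast

definition minkowski_gauge :: "'a set \<Rightarrow> 'a \<Rightarrow> real" where
  "minkowski_gauge D x = Inf {t. 0 < t \<and> of_real (1 / t) \<odot> x \<in> D}"

text \<open>Absorption makes the set of admissible \<open>t\<close> nonempty, convexity gives the
  triangle inequality and balancedness gives homogeneity for all scalars. The set \<open>D\<close>
  is caught between the open and the closed unit ball of its gauge, which is all that is needed to
  compare neighbourhoods.\<close>

lemma minkowski_gauge:
  assumes conv: "convex_in V D"
    and bal: "\<And>c x. x \<in> D \<Longrightarrow> norm c \<le> 1 \<Longrightarrow> c \<odot> x \<in> D"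
    and absorb: "\<And>x. x \<in> carrier V \<Longrightarrow> \<exists>t>0. of_real (1 / t) \<odot> x \<in> D"
  shows "seminorm (minkowski_gauge D)"
    and "\<And>x. x \<in> carrier V \<Longrightarrow> minkowski_gauge D x < 1 \<Longrightarrow> x \<in> D"
    and "\<And>x. x \<in> D \<Longrightarrow> minkowski_gauge D x \<le> 1"
proof -
  have DV: "D \<subseteq> carrier V"
    using conv by (simp add: convex_in_def)
  let ?G = "\<lambda>x. {t. 0 < t \<and> of_real (1 / t) \<odot> x \<in> D}"
  have bdd: "bdd_below (?G x)" for x
    by (rule bdd_belowI[of _ 0]) auto
  have lower: "minkowski_gauge D x \<le> t" if "0 < t" "of_real (1 / t) \<odot> x \<in> D" for x t
    unfolding minkowski_gauge_def using that bdd by (intro cInf_lower) auto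
  have greatest: "m \<le> minkowski_gauge D x"
    if "x \<in> carrier V" "\<And>t. 0 < t \<Longrightarrow> of_real (1 / t) \<odot> x \<in> D \<Longrightarrow> m \<le> t" for m x
    unfolding minkowski_gauge_def using that absorb[OF that(1)] by (intro cInf_greatest) auto
  show "minkowski_gauge D x \<le> 1" if "x \<in> D" for x
    using that DV by (intro lower) auto
  show "x \<in> D" if x: "x \<in> carrier V" and lt: "minkowski_gauge D x < 1" for x
  proof -
    have "\<exists>t\<in>?G x. t < 1"
    proof (rule ccontr)
      assume "\<not> ?thesis"
      then have "1 \<le> minkowski_gauge D x"
        using x by (intro greatest) force+
      then show False using lt by simp
    qed
    then obtain t where t: "0 < t" "t < 1" "of_real (1 / t) \<odot> x \<in> D"
      by blast
    have "of_real t \<odot> (of_real (1 / t) \<odot> x) \<in> D"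
      using bal[OF t(3), of "of_real t"] t by simp
    then show ?thesis
      using x t by (simp add: smult_smult)
  qed
  have add: "minkowski_gauge D (x \<oplus> y) \<le> minkowski_gauge D x + minkowski_gauge D y"
    if x: "x \<in> carrier V" and y: "y \<in> carrier V" for x y
  proof -
    have sum: "minkowski_gauge D (x \<oplus> y) \<le> s + t"
      if s: "0 < s" "of_real (1 / s) \<odot> x \<in> D" and t: "0 < t" "of_real (1 / t) \<odot> y \<in> D" for s t
    proof (rule lower)
      \<comment> \<open>The point \<open>x \<oplus> y\<close>, divided by \<open>s + t\<close>, is
        the convex combination of \<open>x / s\<close> and \<open>y / t\<close> with weights
        \<open>s / (s + t)\<close> and \<open>t / (s + t)\<close>.\<close>
      have "of_real (s / (s + t)) \<odot> (of_real (1 / s) \<odot> x) \<oplus>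
          of_real (1 - s / (s + t)) \<odot> (of_real (1 / t) \<odot> y) \<in> D"
        by (rule convex_inD[OF conv s(2) t(2)]) (use s t in simp_all)
      moreover have "1 - s / (s + t) = t / (s + t)"
        using s t by (simp add: field_simps)
      moreover have "of_real (s / (s + t)) * of_real (1 / s) = (of_real (1 / (s + t)) :: 'k)"
        "of_real (t / (s + t)) * of_real (1 / t) = (of_real (1 / (s + t)) :: 'k)"
        using s t by (simp_all only: of_real_mult[symmetric]) simp_all
      ultimately show "of_real (1 / (s + t)) \<odot> (x \<oplus> y) \<in> D"
        using x y by (simp only: smult_smult smult_add_right)
    qed (use s t in simp)
    have "minkowski_gauge D (x \<oplus> y) - minkowski_gauge D y \<le> minkowski_gauge D x"
    proof (rule greatest[OF x])
      fix s :: real assume s: "0 < s" "of_real (1 / s) \<odot> x \<in> D"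
      have "minkowski_gauge D (x \<oplus> y) - s \<le> minkowski_gauge D y"
      proof (rule greatest[OF y])
        fix t :: real assume "0 < t" "of_real (1 / t) \<odot> y \<in> D"
        from sum[OF s this] show "minkowski_gauge D (x \<oplus> y) - s \<le> t"
          by simp
      qed
      then show "minkowski_gauge D (x \<oplus> y) - minkowski_gauge D y \<le> s"
        by simp
    qed
    then show ?thesis
      by simp
  qed
  have scale_le: "minkowski_gauge D (c \<odot> x) \<le> norm c * minkowski_gauge D x"
    if c: "c \<noteq> 0" and x: "x \<in> carrier V" for c x
  proof -
    have "minkowski_gauge D (c \<odot> x) / norm c \<le> minkowski_gauge D x"
    proof (rule greatest[OF x])
      fix t :: real assume t: "0 < t" "of_real (1 / t) \<odot> x \<in> D"
      \<comment> \<open>The scalar \<open>c / norm c\<close> has modulus one, so a balanced set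
        admits it.\<close>
      have "(c / of_real (norm c)) \<odot> (of_real (1 / t) \<odot> x) \<in> D"
        using c by (intro bal[OF t(2)]) (simp add: norm_divide)
      then have "of_real (1 / (norm c * t)) \<odot> (c \<odot> x) \<in> D"
        using x by (simp add: smult_smult mult.commute)
      then have "minkowski_gauge D (c \<odot> x) \<le> norm c * t"
        using c t by (intro lower) auto
      then show "minkowski_gauge D (c \<odot> x) / norm c \<le> t"
        using c by (simp add: field_simps)
    qed
    then show ?thesis
      using c by (simp add: field_simps)
  qed
  have zero: "minkowski_gauge D \<zero> = 0"
  proof (rule antisym)
    obtain t :: real where "of_real (1 / t) \<odot> \<zero> \<in> D"
      using absorb[of \<zero>] by auto
    then have "minkowski_gauge D \<zero> \<le> t" if "0 < t" for t
      using that by (intro lower) auto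
    then show "minkowski_gauge D \<zero> \<le> 0"
      using field_le_epsilon[of "minkowski_gauge D \<zero>" 0] by simp
    show "0 \<le> minkowski_gauge D \<zero>"
      by (rule greatest) auto
  qed
  have "minkowski_gauge D (c \<odot> x) = norm c * minkowski_gauge D x" if x: "x \<in> carrier V" for c x
  proof (cases "c = 0")
    case False
    have "minkowski_gauge D ((1 / c) \<odot> (c \<odot> x)) \<le> norm (1 / c) * minkowski_gauge D (c \<odot> x)"
      using False x by (intro scale_le) auto
    moreover have "(1 / c) \<odot> (c \<odot> x) = x"
      using False x by (simp add: smult_smult)
    ultimately have "norm c * minkowski_gauge D x \<le> minkowski_gauge D (c \<odot> x)"
      using False by (simp add: norm_divide field_simps)
    then show ?thesis
      using scale_le[OF False x] by simp
  qed (use x zero in simp)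
  then show "seminorm (minkowski_gauge D)"
    using add by (simp add: seminorm_def)
qed

end

section \<open>Continuous seminorms of a locally convex space\<close>

locale tvs_space =
  fixes E :: "('k::real_or_complex, 'a) tvs" (structure)
  assumes TVS: "TVS E"
begin

sublocale kspace E
  using TVS by (simp add: TVS_def kspace_def)

lemma topspace_eq [simp]: "topspace (vtop E) = carrier E"
  using TVS by (simp add: TVS_def)

lemma openin_subset_carrier: "openin (vtop E) U \<Longrightarrow> U \<subseteq> carrier E"
  using openin_subset by fastforce

lemma continuous_add_const:
  assumes "a \<in> carrier E"
  shows "continuous_map (vtop E) (vtop E) (\<lambda>x. a \<oplus> x)"
proof -
  have "continuous_map (vtop E) (prod_topology (vtop E) (vtop E)) (\<lambda>x. (a, x))"
    using assms by (intro continuous_map_pairedI) auto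
  moreover have "continuous_map (prod_topology (vtop E) (vtop E)) (vtop E) (\<lambda>(x, y). x \<oplus> y)"
    using TVS by (simp add: TVS_def)
  ultimately show ?thesis
    using continuous_map_compose by (fastforce simp: o_def)
qed

lemma continuous_smult: "continuous_map (prod_topology euclidean (vtop E)) (vtop E) (\<lambda>(c, x). c \<odot> x)"
  using TVS by (simp add: TVS_def)

lemma continuous_smult_const: "continuous_map (vtop E) (vtop E) (\<lambda>x. c \<odot> x)"
proof -
  have "continuous_map (vtop E) (prod_topology euclidean (vtop E)) (\<lambda>x. (c, x))"
    by (intro continuous_map_pairedI) auto
  from continuous_map_compose[OF this continuous_smult] show ?thesis
    by (simp add: o_def)
qed

lemma continuous_smult_at:
  assumes "x \<in> carrier E"
  shows "continuous_map euclidean (vtop E) (\<lambda>c. c \<odot> x)"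
proof -
  have "continuous_map euclidean (prod_topology euclidean (vtop E)) (\<lambda>c. (c, x))"
    using assms by (intro continuous_map_pairedI) auto
  from continuous_map_compose[OF this continuous_smult] show ?thesis
    by (simp add: o_def)
qed

text \<open>For a seminorm a bound by 1 near zero amounts to continuity: scaling makes the bound
  arbitrarily small and the triangle inequality carries it to every point.\<close>

definition continuous_seminorm :: "('a \<Rightarrow> real) \<Rightarrow> bool" where
  "continuous_seminorm p \<longleftrightarrow> seminorm p \<and>
    (\<exists>U. openin (vtop E) U \<and> \<zero> \<in> U \<and> (\<forall>x\<in>U. p x \<le> 1))"

lemma continuous_seminorm_times:
  assumes "continuous_seminorm p" "0 \<le> c"
  shows "continuous_seminorm (\<lambda>x. c * p x)"
proof -
  obtain U where U: "openin (vtop E) U" "\<zero> \<in> U" "\<And>x. x \<in> U \<Longrightarrow> p x \<le> 1"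
    and p: "seminorm p"
    using assms by (auto simp: continuous_seminorm_def)
  define U' where "U' = {x \<in> carrier E. of_real c \<odot> x \<in> U}"
  have "openin (vtop E) U'"
    using openin_continuous_map_preimage[OF continuous_smult_const U(1)] by (simp add: U'_def)
  moreover have "c * p x \<le> 1" if "x \<in> U'" for x
    using that U(3)[of "of_real c \<odot> x"] assms(2) by (auto simp: U'_def seminorm_scale[OF p])
  ultimately show ?thesis
    using U(2) seminorm_times[OF p assms(2)] unfolding continuous_seminorm_def
    by (auto simp: U'_def intro!: exI[of _ U'])
qed

lemma continuous_seminorm_mono:
  assumes "continuous_seminorm q" "seminorm p" "\<And>x. x \<in> carrier E \<Longrightarrow> p x \<le> q x"
  shows "continuous_seminorm p"
proof -
  obtain U where U: "openin (vtop E) U" "\<zero> \<in> U" "\<And>x. x \<in> U \<Longrightarrow> q x \<le> 1"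
    using assms by (auto simp: continuous_seminorm_def)
  moreover have "p x \<le> 1" if "x \<in> U" for x
    using U(3)[OF that] assms(3)[of x] openin_subset_carrier[OF U(1)] that by force
  ultimately show ?thesis
    using assms(2) by (auto simp: continuous_seminorm_def)
qed

lemma continuous_seminorm_plus:
  assumes "continuous_seminorm p" "continuous_seminorm q"
  shows "continuous_seminorm (\<lambda>x. p x + q x)"
proof -
  have "continuous_seminorm (\<lambda>x. 2 * p x)" "continuous_seminorm (\<lambda>x. 2 * q x)"
    using assms by (auto intro: continuous_seminorm_times)
  then obtain U U' where U: "openin (vtop E) U" "\<zero> \<in> U" "\<And>x. x \<in> U \<Longrightarrow> 2 * p x \<le> 1"
    "openin (vtop E) U'" "\<zero> \<in> U'" "\<And>x. x \<in> U' \<Longrightarrow> 2 * q x \<le> 1"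
    by (auto simp: continuous_seminorm_def)
  have "p x + q x \<le> 1" if "x \<in> U \<inter> U'" for x
    using U(3)[of x] U(6)[of x] that by auto
  moreover have "openin (vtop E) (U \<inter> U')" "\<zero> \<in> U \<inter> U'"
    using U by auto
  ultimately show ?thesis
    using assms by (auto simp: continuous_seminorm_def seminorm_plus intro!: exI[of _ "U \<inter> U'"])
qed

lemma continuous_seminorm_null: "continuous_seminorm (\<lambda>_. 0)"
  using openin_topspace[of "vtop E"]
  by (auto simp: continuous_seminorm_def seminorm_null intro!: exI[of _ "carrier E"])

lemma openin_seminorm_ball:
  assumes p: "continuous_seminorm p" and a: "a \<in> carrier E"
  shows "openin (vtop E) {y \<in> carrier E. p (y \<ominus> a) < 1}" (is "openin _ ?B")
proof (subst openin_subopen, intro ballI)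
  have sp: "seminorm p"
    using p by (simp add: continuous_seminorm_def)
  fix y assume "y \<in> ?B"
  then have y: "y \<in> carrier E" and less: "p (y \<ominus> a) < 1"
    by auto
  define d where "d = 1 - p (y \<ominus> a)"
  have d: "0 < d"
    using less by (simp add: d_def)
  \<comment> \<open>The gap \<open>d\<close> is the room left around \<open>y\<close>. The factor
    \<open>2 / d\<close> yields \<open>p \<le> d / 2\<close> on \<open>U\<close>, so the final
    inequality is strict.\<close>
  have "continuous_seminorm (\<lambda>x. 2 / d * p x)"
    using p d by (intro continuous_seminorm_times) auto
  then obtain U where U: "openin (vtop E) U" "\<zero> \<in> U" "\<And>x. x \<in> U \<Longrightarrow> 2 / d * p x \<le> 1"
    by (auto simp: continuous_seminorm_def)
  define U' where "U' = {z \<in> carrier E. \<ominus> y \<oplus> z \<in> U}"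
  have "openin (vtop E) U'"
    using openin_continuous_map_preimage[OF continuous_add_const U(1), of "\<ominus> y"] y
    by (simp add: U'_def)
  moreover have "y \<in> U'"
    using y U(2) by (simp add: U'_def l_neg)
  moreover have "z \<in> ?B" if "z \<in> U'" for z
  proof -
    have z: "z \<in> carrier E" "z \<ominus> y \<in> U"
      using that y by (auto simp: U'_def a_minus_def a_comm)
    then have "p (z \<ominus> y) \<le> d / 2"
      using U(3)[OF z(2)] d by (simp add: field_simps)
    then have "p (z \<ominus> y) < d"
      using d by simp
    then show ?thesis
      using seminorm_triangle[OF sp a y z(1)] z by (simp add: d_def)
  qed
  ultimately show "\<exists>T. openin (vtop E) T \<and> y \<in> T \<and> T \<subseteq> ?B"
    by blast
qed

text \<open>The seminorm is the gauge of the balanced core of a convex neighbourhood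
  \<open>C\<close>. Continuity of scalar multiplication at the origin gives a neighbourhood
  \<open>N\<close> and a \<open>\<delta>\<close> such that all scalars of modulus below
  \<open>\<delta>\<close> map \<open>N\<close> into \<open>C\<close>; hence the core contains a
  multiple of \<open>N\<close> and its gauge is continuous.\<close>

lemma open_contains_seminorm_ball:
  assumes U: "openin (vtop E) U" "x \<in> U"
  obtains p where "continuous_seminorm p" "\<And>y. y \<in> carrier E \<Longrightarrow> p (y \<ominus> x) < 1 \<Longrightarrow> y \<in> U"
proof -
  have x: "x \<in> carrier E"
    using U openin_subset_carrier by blast
  define U0 where "U0 = {z \<in> carrier E. x \<oplus> z \<in> U}"
  have "openin (vtop E) U0"
    using openin_continuous_map_preimage[OF continuous_add_const[OF x] U(1)] by (simp add: U0_def)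
  moreover have "\<zero> \<in> U0"
    using x U(2) by (simp add: U0_def)
  ultimately obtain C where C: "openin (vtop E) C" "convex_in E C" "\<zero> \<in> C" "C \<subseteq> U0"
    using TVS unfolding TVS_def by blast
  have "openin (prod_topology euclidean (vtop E))
      {z \<in> topspace (prod_topology euclidean (vtop E)). (case z of (c, x) \<Rightarrow> c \<odot> x) \<in> C}"
    using openin_continuous_map_preimage[OF continuous_smult C(1)] .
  then have "\<exists>A N. openin euclidean A \<and> openin (vtop E) N \<and> (0 :: 'k) \<in> A \<and> \<zero> \<in> N \<and>
      A \<times> N \<subseteq> {z \<in> topspace (prod_topology euclidean (vtop E)). (case z of (c, x) \<Rightarrow> c \<odot> x) \<in> C}"
    using C(3) unfolding openin_prod_topology_alt by (auto simp: topspace_prod_topology)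
  then obtain A :: "'k set" and N where AN: "open A" "0 \<in> A" "openin (vtop E) N" "\<zero> \<in> N"
    "\<And>c x. c \<in> A \<Longrightarrow> x \<in> N \<Longrightarrow> c \<odot> x \<in> C"
    by (auto simp: subset_iff)
  obtain \<delta> where \<delta>: "0 < \<delta>" "ball 0 \<delta> \<subseteq> A"
    using AN(1,2) open_contains_ball by blast
  \<comment> \<open>The largest balanced subset of \<open>C\<close>; it inherits convexity, which
    the gauge requires alongside balancedness.\<close>
  define D where "D = {x \<in> carrier E. \<forall>c. norm c \<le> 1 \<longrightarrow> c \<odot> x \<in> C}"
  have N_D: "of_real (\<delta> / 2) \<odot> z \<in> D" if z: "z \<in> N" for z
  proof -
    have zE: "z \<in> carrier E"
      using z openin_subset_carrier AN(3) by blast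
    moreover have "c \<odot> (of_real (\<delta> / 2) \<odot> z) \<in> C" if c: "norm c \<le> 1" for c
    proof -
      have "norm c * (\<delta> / 2) \<le> 1 * (\<delta> / 2)"
        using c \<delta> by (intro mult_right_mono) auto
      then have "norm (c * of_real (\<delta> / 2)) < \<delta>"
        using \<delta> by (simp add: norm_mult)
      then have "c * of_real (\<delta> / 2) \<in> A"
        using \<delta>(2) by (auto simp: dist_norm)
      then show ?thesis
        using AN(5)[OF _ z] zE by (simp add: smult_smult)
    qed
    ultimately show ?thesis
      by (simp add: D_def)
  qed
  have conv: "convex_in E D"
  proof (rule convex_inI)
    show "D \<subseteq> carrier E"
      by (auto simp: D_def)
    fix a b and t :: real assume a: "a \<in> D" and b: "b \<in> D" and t: "0 \<le> t" "t \<le> 1"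
    have ab: "a \<in> carrier E" "b \<in> carrier E"
      using a b by (auto simp: D_def)
    have "c \<odot> (of_real t \<odot> a \<oplus> of_real (1 - t) \<odot> b) \<in> C" if c: "norm c \<le> 1" for c
    proof -
      have "c \<odot> (of_real t \<odot> a \<oplus> of_real (1 - t) \<odot> b)
          = of_real t \<odot> (c \<odot> a) \<oplus> of_real (1 - t) \<odot> (c \<odot> b)"
        using ab by (simp add: smult_add_right smult_smult mult.commute)
      moreover have "c \<odot> a \<in> C" "c \<odot> b \<in> C"
        using a b c by (auto simp: D_def)
      ultimately show ?thesis
        using C(2) t unfolding convex_in_def by simp
    qed
    then show "of_real t \<odot> a \<oplus> of_real (1 - t) \<odot> b \<in> D"
      using ab by (simp add: D_def)
  qed
  have bal: "c \<odot> z \<in> D" if "z \<in> D" "norm c \<le> 1" for c z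
    using that by (auto simp: D_def smult_smult norm_mult mult_le_one)
  have absorb: "\<exists>t>0. of_real (1 / t) \<odot> z \<in> D" if z: "z \<in> carrier E" for z
  proof -
    have "open {c. c \<odot> z \<in> N}"
      using openin_continuous_map_preimage[OF continuous_smult_at[OF z] AN(3)] by simp
    moreover have "0 \<in> {c. c \<odot> z \<in> N}"
      using z AN(4) by simp
    ultimately obtain \<eta> where \<eta>: "0 < \<eta>" "ball 0 \<eta> \<subseteq> {c. c \<odot> z \<in> N}"
      using open_contains_ball by blast
    have "of_real (\<eta> / 2) \<in> ball (0 :: 'k) \<eta>"
      using \<eta>(1) by simp
    then have "of_real (\<eta> / 2) \<odot> z \<in> N"
      using \<eta>(2) by blast
    from N_D[OF this] have "of_real (1 / (1 / (\<delta> / 2 * (\<eta> / 2)))) \<odot> z \<in> D"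
      using z by (simp add: smult_smult)
    then show ?thesis
      using \<delta>(1) \<eta>(1) by (intro exI[of _ "1 / (\<delta> / 2 * (\<eta> / 2))"]) auto
  qed
  have g: "seminorm (minkowski_gauge D)"
    "\<And>x. x \<in> carrier E \<Longrightarrow> minkowski_gauge D x < 1 \<Longrightarrow> x \<in> D"
    "\<And>x. x \<in> D \<Longrightarrow> minkowski_gauge D x \<le> 1"
    using minkowski_gauge[OF conv] bal absorb by blast+
  \<comment> \<open>The multiple of \<open>N\<close> by \<open>\<delta> / 2\<close> lies in
    \<open>D\<close>, where the gauge is at most 1. The factor is removed again by
    rescaling.\<close>
  have "continuous_seminorm (\<lambda>x. \<delta> / 2 * minkowski_gauge D x)"
    unfolding continuous_seminorm_def
  proof (intro conjI exI[of _ N] ballI)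
    show "seminorm (\<lambda>x. \<delta> / 2 * minkowski_gauge D x)"
      using g(1) \<delta>(1) by (intro seminorm_times) auto
    fix z assume z: "z \<in> N"
    then have zE: "z \<in> carrier E"
      using openin_subset_carrier AN(3) by blast
    have "minkowski_gauge D (of_real (\<delta> / 2) \<odot> z) \<le> 1"
      using N_D[OF z] by (rule g(3))
    then show "\<delta> / 2 * minkowski_gauge D z \<le> 1"
      using seminorm_scale[OF g(1) zE, of "of_real (\<delta> / 2)"] \<delta>(1) by simp
  qed (use AN in auto)
  from continuous_seminorm_times[OF this, of "2 / \<delta>"]
  have "continuous_seminorm (minkowski_gauge D)"
    using \<delta>(1) by simp
  moreover have "y \<in> U" if y: "y \<in> carrier E" and "minkowski_gauge D (y \<ominus> x) < 1" for y
  proof -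
    have "y \<ominus> x \<in> D"
      using that x by (intro g(2)) auto
    then have "1 \<odot> (y \<ominus> x) \<in> C"
      unfolding D_def by (auto simp del: smult_1)
    then have "y \<ominus> x \<in> U0"
      using C(4) x y by auto
    then show ?thesis
      using x y by (simp add: U0_def add_minus_cancel)
  qed
  ultimately show thesis
    using that by blast
qed

lemma tdual_carrier:
  "carrier (tdual E) = {\<phi> \<in> linear_maps E ground. continuous_map (vtop E) euclidean \<phi>}"
  by (simp add: tdual_def L_space_def map_space_def L_def)

text \<open>By linearity a bound near zero controls the differences
  \<open>\<phi> y - \<phi> x\<close> at every point. Topological duals are computed from seminorms
  through this equivalence.\<close>

lemma continuous_functional_iff:
  assumes \<phi>: "\<phi> \<in> linear_maps E ground"
  shows "\<phi> \<in> carrier (tdual E) \<longleftrightarrow> continuous_seminorm (\<lambda>x. norm (\<phi> x))"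
proof
  assume "\<phi> \<in> carrier (tdual E)"
  then have "continuous_map (vtop E) euclidean \<phi>"
    by (simp add: tdual_carrier)
  from openin_continuous_map_preimage[OF this, of "ball 0 1"]
  have "openin (vtop E) {x \<in> carrier E. norm (\<phi> x) < 1}"
    by (simp add: dist_norm)
  moreover have "\<phi> \<zero> = 0"
    using linear_mapsD(4)[OF \<phi> zero_closed, of 0] by simp
  ultimately show "continuous_seminorm (\<lambda>x. norm (\<phi> x))"
    unfolding continuous_seminorm_def
    by (intro conjI exI[of _ "{x \<in> carrier E. norm (\<phi> x) < 1}"] seminorm_norm_functional[OF \<phi>]) auto
next
  assume p: "continuous_seminorm (\<lambda>x. norm (\<phi> x))"
  have "openin (vtop E) {x \<in> carrier E. \<phi> x \<in> G}" if G: "open G" for G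
  proof (subst openin_subopen, intro ballI)
    fix x assume "x \<in> {x \<in> carrier E. \<phi> x \<in> G}"
    then have x: "x \<in> carrier E" "\<phi> x \<in> G"
      by auto
    obtain e where e: "0 < e" "ball (\<phi> x) e \<subseteq> G"
      using G x(2) open_contains_ball by blast
    have "openin (vtop E) {y \<in> carrier E. 1 / e * norm (\<phi> (y \<ominus> x)) < 1}"
      using e p by (intro openin_seminorm_ball[OF _ x(1)] continuous_seminorm_times) auto
    moreover have "x \<in> {y \<in> carrier E. 1 / e * norm (\<phi> (y \<ominus> x)) < 1}"
      using x functional_minus[OF \<phi> x(1) x(1)] by simp
    moreover have "y \<in> {x \<in> carrier E. \<phi> x \<in> G}"
      if "y \<in> {y \<in> carrier E. 1 / e * norm (\<phi> (y \<ominus> x)) < 1}" for y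
    proof -
      have "y \<in> carrier E" "norm (\<phi> x - \<phi> y) < e"
        using that e functional_minus[OF \<phi> _ x(1), of y] norm_minus_commute[of "\<phi> x" "\<phi> y"]
        by (simp_all add: divide_simps)
      then show ?thesis
        using e(2) by (auto simp: dist_norm)
    qed
    ultimately show "\<exists>T. openin (vtop E) T \<and> x \<in> T \<and> T \<subseteq> {x \<in> carrier E. \<phi> x \<in> G}"
      by blast
  qed
  then have "continuous_map (vtop E) euclidean \<phi>"
    by (simp add: continuous_map_def)
  then show "\<phi> \<in> carrier (tdual E)"
    using \<phi> by (simp add: tdual_carrier)
qed

end

section \<open>The topology generated by a family of seminorms\<close>

definition (in kspace) seminorm_topology :: "('a \<Rightarrow> real) set \<Rightarrow> 'a topology" where
  "seminorm_topology S = topology (\<lambda>U. U \<subseteq> carrier V \<and>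
     (\<forall>x\<in>U. \<exists>p\<in>S. \<forall>y\<in>carrier V. p (y \<ominus> x) < 1 \<longrightarrow> y \<in> U))"

text \<open>Closure under sums replaces finite intersections and closure under multiples replaces
  radii, so that in \<open>seminorm_topology\<close> one unit ball of one seminorm is enough at each
  point.\<close>

locale seminorm_family = kspace V
  for V :: "('k::real_or_complex, 'a) module" (structure) +
  fixes S :: "('a \<Rightarrow> real) set"
  assumes seminorm: "p \<in> S \<Longrightarrow> seminorm p"
    and null_mem: "(\<lambda>_. 0) \<in> S"
    and plus_mem: "p \<in> S \<Longrightarrow> q \<in> S \<Longrightarrow> (\<lambda>x. p x + q x) \<in> S"
    and times_mem: "p \<in> S \<Longrightarrow> 0 \<le> c \<Longrightarrow> (\<lambda>x. c * p x) \<in> S"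
begin

lemma openin_seminorm_topology:
  "openin (seminorm_topology S) U \<longleftrightarrow> U \<subseteq> carrier V \<and>
     (\<forall>x\<in>U. \<exists>p\<in>S. \<forall>y\<in>carrier V. p (y \<ominus> x) < 1 \<longrightarrow> y \<in> U)"
proof -
  let ?open = "\<lambda>U. U \<subseteq> carrier V \<and> (\<forall>x\<in>U. \<exists>p\<in>S. \<forall>y\<in>carrier V. p (y \<ominus> x) < 1 \<longrightarrow> y \<in> U)"
  have "istopology ?open"
    unfolding istopology_def
  proof (rule conjI; intro allI impI)
    fix A B assume A: "?open A" and B: "?open B"
    have "\<exists>r\<in>S. \<forall>y\<in>carrier V. r (y \<ominus> x) < 1 \<longrightarrow> y \<in> A \<inter> B" if x: "x \<in> A \<inter> B" for x
    proof -
      obtain p q where p: "p \<in> S" "\<And>y. y \<in> carrier V \<Longrightarrow> p (y \<ominus> x) < 1 \<Longrightarrow> y \<in> A"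
        and q: "q \<in> S" "\<And>y. y \<in> carrier V \<Longrightarrow> q (y \<ominus> x) < 1 \<Longrightarrow> y \<in> B"
        using A B x by blast
      have "y \<in> A \<inter> B" if y: "y \<in> carrier V" "p (y \<ominus> x) + q (y \<ominus> x) < 1" for y
      proof -
        have "y \<ominus> x \<in> carrier V"
          using A x y(1) by blast
        then show ?thesis
          using seminorm_nonneg[OF seminorm[OF p(1)], of "y \<ominus> x"]
            seminorm_nonneg[OF seminorm[OF q(1)], of "y \<ominus> x"] p(2)[OF y(1)] q(2)[OF y(1)] y(2)
          by auto
      qed
      then show ?thesis
        using plus_mem[OF p(1) q(1)] by (intro bexI[of _ "\<lambda>x. p x + q x"]) auto
    qed
    then show "?open (A \<inter> B)"
      using A by blast
  next
    fix K assume "\<forall>A\<in>K. ?open A"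
    then show "?open (\<Union>K)"
      by (meson Sup_le_iff UnionE UnionI)
  qed
  then show ?thesis
    by (simp add: seminorm_topology_def topology_inverse')
qed

lemma topspace_seminorm_topology [simp]: "topspace (seminorm_topology S) = carrier V"
proof
  have "openin (seminorm_topology S) (carrier V)"
    using null_mem by (auto simp: openin_seminorm_topology)
  then show "carrier V \<subseteq> topspace (seminorm_topology S)"
    by (rule openin_subset)
  show "topspace (seminorm_topology S) \<subseteq> carrier V"
    using openin_topspace[of "seminorm_topology S"] unfolding openin_seminorm_topology by blast
qed

lemma openin_ball:
  assumes p: "p \<in> S" and a: "a \<in> carrier V"
  shows "openin (seminorm_topology S) {y \<in> carrier V. p (y \<ominus> a) < e}"
  unfolding openin_seminorm_topology
proof (intro conjI ballI)
  fix x assume "x \<in> {y \<in> carrier V. p (y \<ominus> a) < e}"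
  then have x: "x \<in> carrier V" "p (x \<ominus> a) < e"
    by auto
  define d where "d = e - p (x \<ominus> a)"
  have d: "0 < d"
    using x by (simp add: d_def)
  have "y \<in> {y \<in> carrier V. p (y \<ominus> a) < e}" if y: "y \<in> carrier V" "1 / d * p (y \<ominus> x) < 1" for y
  proof -
    have "p (y \<ominus> x) < d"
      using y(2) d by (simp add: field_simps)
    then show ?thesis
      using seminorm_triangle[OF seminorm[OF p] a x(1) y(1)] y(1) by (simp add: d_def)
  qed
  then show "\<exists>q\<in>S. \<forall>y\<in>carrier V. q (y \<ominus> x) < 1 \<longrightarrow> y \<in> {y \<in> carrier V. p (y \<ominus> a) < e}"
    using times_mem[OF p, of "1 / d"] d by (intro bexI[of _ "\<lambda>x. 1 / d * p x"]) auto
qed auto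

lemma mem_ball_center: "p \<in> S \<Longrightarrow> a \<in> carrier V \<Longrightarrow> 0 < e \<Longrightarrow> a \<in> {y \<in> carrier V. p (y \<ominus> a) < e}"
  by (simp add: seminorm_zero seminorm)

lemma continuous_map_into_seminorm_topology:
  assumes f: "\<And>x. x \<in> topspace Y \<Longrightarrow> f x \<in> carrier V"
    and cont: "\<And>x p. x \<in> topspace Y \<Longrightarrow> p \<in> S \<Longrightarrow>
      \<exists>N. openin Y N \<and> x \<in> N \<and> (\<forall>y\<in>N. p (f y \<ominus> f x) < 1)"
  shows "continuous_map Y (seminorm_topology S) f"
  unfolding continuous_map_def
proof (intro conjI allI impI)
  show "f \<in> topspace Y \<rightarrow> topspace (seminorm_topology S)"
    using f by auto
  fix U assume U: "openin (seminorm_topology S) U"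
  show "openin Y {x \<in> topspace Y. f x \<in> U}"
  proof (subst openin_subopen, intro ballI)
    fix x assume "x \<in> {x \<in> topspace Y. f x \<in> U}"
    then have x: "x \<in> topspace Y" "f x \<in> U"
      by auto
    then obtain p where p: "p \<in> S" "\<And>y. y \<in> carrier V \<Longrightarrow> p (y \<ominus> f x) < 1 \<Longrightarrow> y \<in> U"
      using U unfolding openin_seminorm_topology by blast
    obtain N where N: "openin Y N" "x \<in> N" "\<And>y. y \<in> N \<Longrightarrow> p (f y \<ominus> f x) < 1"
      using cont[OF x(1) p(1)] by blast
    have "N \<subseteq> {x \<in> topspace Y. f x \<in> U}"
      using N(3) p(2) f openin_subset[OF N(1)] by blast
    with N show "\<exists>T. openin Y T \<and> x \<in> T \<and> T \<subseteq> {x \<in> topspace Y. f x \<in> U}"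
      by blast
  qed
qed

text \<open>Balls of seminorms are convex and form a base at each point, so local convexity is
  immediate and continuity of the operations is an estimate for one seminorm at a time. The
  separation hypothesis is what yields the Hausdorff property.\<close>

lemma TVS_seminorm_topology:
  assumes sep: "\<And>x. x \<in> carrier V \<Longrightarrow> x \<noteq> \<zero> \<Longrightarrow> \<exists>p\<in>S. p x \<noteq> 0"
  shows "TVS (with_topology V (seminorm_topology S))"
  unfolding TVS_def with_topology_simps vector_sp_with_topology
proof (intro conjI allI impI)
  let ?T = "seminorm_topology S"
  show "vector_sp V" by (rule vector_sp)
  show "topspace ?T = carrier V" by simp
  show "continuous_map (prod_topology ?T ?T) ?T (\<lambda>(x, y). x \<oplus> y)"
  proof (rule continuous_map_into_seminorm_topology)
    fix z p assume z: "z \<in> topspace (prod_topology ?T ?T)" and p: "p \<in> S"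
    obtain x y where xy: "z = (x, y)" "x \<in> carrier V" "y \<in> carrier V"
      using z by (cases z) auto
    define e :: real where "e = 1 / 2"
    have e: "0 < e" "e + e = 1"
      by (simp_all add: e_def)
    let ?B = "\<lambda>x. {y \<in> carrier V. p (y \<ominus> x) < e}"
    have "p (x' \<oplus> y' \<ominus> (x \<oplus> y)) < 1" if "x' \<in> ?B x" "y' \<in> ?B y" for x' y'
      using that xy e(2) seminorm_add[OF seminorm[OF p], of "x' \<ominus> x" "y' \<ominus> y"]
      by (auto simp: add_minus_add)
    then show "\<exists>N. openin (prod_topology ?T ?T) N \<and> z \<in> N \<and>
        (\<forall>y\<in>N. p ((case y of (x, y) \<Rightarrow> x \<oplus> y) \<ominus> (case z of (x, y) \<Rightarrow> x \<oplus> y)) < 1)"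
      using openin_ball[OF p] mem_ball_center[OF p _ e(1)] xy
      by (intro exI[of _ "?B x \<times> ?B y"]) (auto simp: openin_prod_Times_iff)
  qed auto
  show "continuous_map (prod_topology euclidean ?T) ?T (\<lambda>(c, x). c \<odot> x)"
  proof (rule continuous_map_into_seminorm_topology)
    fix z p assume z: "z \<in> topspace (prod_topology (euclidean :: 'k topology) ?T)" and p: "p \<in> S"
    obtain c x where cx: "z = (c, x)" "x \<in> carrier V"
      using z by (cases z) auto
    \<comment> \<open>The difference of products splits into
      \<open>c' \<odot> (x' \<ominus> x)\<close> and \<open>(c' - c) \<odot> x\<close>. As
      \<open>\<delta> \<le> 1\<close> gives \<open>norm c' \<le> norm c + 1\<close>, the choice of
      \<open>\<epsilon>\<close> bounds the first part by 1/2 and the choice of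
      \<open>\<delta>\<close> keeps the second below 1/2. Adding 1 in the denominators covers
      \<open>p x = 0\<close> and \<open>c = 0\<close>.\<close>
    define \<delta> where "\<delta> = 1 / (2 * (p x + 1))"
    define \<epsilon> where "\<epsilon> = 1 / (2 * (norm c + 1))"
    have px: "0 \<le> p x"
      using seminorm_nonneg[OF seminorm[OF p] cx(2)] .
    have \<delta>: "0 < \<delta>" "\<delta> \<le> 1" "\<delta> * p x < 1 / 2"
      using px by (simp_all add: \<delta>_def divide_simps)
    have \<epsilon>: "0 < \<epsilon>" "(norm c + 1) * \<epsilon> = 1 / 2"
    proof -
      have "n * (1 / (2 * n)) = 1 / 2" if "0 < n" for n :: real
        using that by simp
      then show "0 < \<epsilon>" "(norm c + 1) * \<epsilon> = 1 / 2"
        unfolding \<epsilon>_def using norm_ge_zero[of c]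
        by (simp add: add_nonneg_pos del: distrib_left_numeral, metis add_nonneg_pos zero_less_one)
    qed
    let ?B = "{y \<in> carrier V. p (y \<ominus> x) < \<epsilon>}"
    have "p (c' \<odot> x' \<ominus> c \<odot> x) < 1" if c': "c' \<in> ball c \<delta>" and x': "x' \<in> ?B" for c' x'
    proof -
      have nc: "norm (c' - c) < \<delta>"
        using c' by (simp add: dist_norm norm_minus_commute)
      then have nc': "norm c' \<le> norm c + 1"
        using norm_triangle_ineq2[of c' c] \<delta>(2) by linarith
      have "c' \<odot> x' \<ominus> c \<odot> x = c' \<odot> (x' \<ominus> x) \<oplus> (c' - c) \<odot> x"
        using cx x' minus_minus_cancel[of "c \<odot> x" "c' \<odot> x" "c' \<odot> x'"]
        by (simp add: smult_minus smult_minus_left)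
      then have "p (c' \<odot> x' \<ominus> c \<odot> x) \<le> norm c' * p (x' \<ominus> x) + norm (c' - c) * p x"
        using seminorm_add[OF seminorm[OF p], of "c' \<odot> (x' \<ominus> x)" "(c' - c) \<odot> x"] cx x'
        by (simp add: seminorm_scale[OF seminorm[OF p]])
      moreover have "norm c' * p (x' \<ominus> x) \<le> (norm c + 1) * \<epsilon>"
        using nc' x' cx seminorm_nonneg[OF seminorm[OF p], of "x' \<ominus> x"] by (intro mult_mono) auto
      moreover have "norm (c' - c) * p x \<le> \<delta> * p x"
        using nc px by (intro mult_right_mono) auto
      ultimately show ?thesis
        using \<epsilon>(2) \<delta>(3) by linarith
    qed
    then show "\<exists>N. openin (prod_topology euclidean ?T) N \<and> z \<in> N \<and>
        (\<forall>y\<in>N. p ((case y of (c, x) \<Rightarrow> c \<odot> x) \<ominus> (case z of (c, x) \<Rightarrow> c \<odot> x)) < 1)"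
      using openin_ball[OF p cx(2)] mem_ball_center[OF p cx(2) \<epsilon>(1)] cx \<delta>(1)
      by (intro exI[of _ "ball c \<delta> \<times> ?B"]) (auto simp: openin_prod_Times_iff)
  qed auto
  show "Hausdorff_space ?T"
    unfolding Hausdorff_space_def
  proof (intro allI impI)
    fix x y assume "x \<in> topspace ?T \<and> y \<in> topspace ?T \<and> x \<noteq> y"
    then have xy: "x \<in> carrier V" "y \<in> carrier V" "x \<noteq> y"
      by auto
    then have "x \<ominus> y \<noteq> \<zero>"
      using eq_if_minus_zero by blast
    then obtain p where p: "p \<in> S" "p (x \<ominus> y) \<noteq> 0"
      using sep[of "x \<ominus> y"] xy by auto
    \<comment> \<open>Balls of half the distance are disjoint by the triangle inequality.\<close>
    define e where "e = p (x \<ominus> y) / 2"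
    have e: "0 < e"
      using p seminorm_nonneg[OF seminorm[OF p(1)], of "x \<ominus> y"] xy by (simp add: e_def)
    have "\<not> (p (z \<ominus> x) < e \<and> p (z \<ominus> y) < e)" if z: "z \<in> carrier V" for z
    proof -
      have "\<ominus> (z \<ominus> x) = x \<ominus> z"
        using z xy by (simp add: a_minus_def minus_add a_comm)
      then have "p (x \<ominus> z) = p (z \<ominus> x)"
        using seminorm_neg[OF seminorm[OF p(1)], of "z \<ominus> x"] z xy by simp
      then show ?thesis
        using seminorm_triangle[OF seminorm[OF p(1)] xy(2) z xy(1)] by (auto simp: e_def)
    qed
    then show "\<exists>A B. openin ?T A \<and> openin ?T B \<and> x \<in> A \<and> y \<in> B \<and> disjnt A B"
      using openin_ball[OF p(1)] mem_ball_center[OF p(1) _ e] xy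
      by (intro exI[of _ "{z \<in> carrier V. p (z \<ominus> x) < e}"] exI[of _ "{z \<in> carrier V. p (z \<ominus> y) < e}"])
        (auto simp: disjnt_def)
  qed
next
  let ?T = "seminorm_topology S"
  fix U assume "openin ?T U \<and> \<zero> \<in> U"
  then obtain p where p: "p \<in> S" "\<And>y. y \<in> carrier V \<Longrightarrow> p (y \<ominus> \<zero>) < 1 \<Longrightarrow> y \<in> U"
    unfolding openin_seminorm_topology by blast
  define C where "C = {y \<in> carrier V. p (y \<ominus> \<zero>) < 1}"
  have "convex_in V C"
  proof (rule convex_inI)
    fix x y and t :: real assume x: "x \<in> C" and y: "y \<in> C" and t: "0 \<le> t" "t \<le> 1"
    have xy: "x \<in> carrier V" "y \<in> carrier V" "p x < 1" "p y < 1"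
      using x y by (auto simp: C_def)
    let ?z = "of_real t \<odot> x \<oplus> of_real (1 - t) \<odot> y"
    have "p ?z \<le> t * p x + (1 - t) * p y"
      using xy t seminorm_add[OF seminorm[OF p(1)], of "of_real t \<odot> x" "of_real (1 - t) \<odot> y"]
        seminorm_scale[OF seminorm[OF p(1)] xy(1), of "of_real t"]
        seminorm_scale[OF seminorm[OF p(1)] xy(2), of "of_real (1 - t)"]
      by (simp del: of_real_diff)
    also have "\<dots> < 1"
      using convex_bound_lt[OF xy(3,4), of t "1 - t"] t by simp
    finally show "?z \<in> C"
      using xy by (simp add: C_def)
  qed (auto simp: C_def)
  then have "convex_in (with_topology V ?T) C"
    by (simp add: convex_in_def)
  then show "\<exists>C. openin ?T C \<and> convex_in (with_topology V ?T) C \<and> \<zero> \<in> C \<and> C \<subseteq> U"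
    using openin_ball[OF p(1) zero_closed, of 1] mem_ball_center[OF p(1) zero_closed, of 1] p(2)
    by (intro exI[of _ C]) (auto simp: C_def)
qed

lemma kspace_seminorm_with_topology:
  "kspace.seminorm (with_topology V T) = seminorm"
proof -
  interpret E: kspace "with_topology V T"
    using vector_sp by (simp add: kspace_def)
  show ?thesis
    by (auto simp: E.seminorm_def seminorm_def fun_eq_iff)
qed

text \<open>Some \<open>q\<close> in the family has its open unit ball inside the region where
  \<open>p \<le> 1\<close>. Dividing \<open>x\<close> by any \<open>s > q x\<close> moves it into
  that ball, so \<open>p x \<le> s\<close>, and \<open>s\<close> may approach
  \<open>q x\<close>.\<close>

lemma continuous_seminorm_dominated:
  assumes TVS: "TVS (with_topology V (seminorm_topology S))"
    and p: "tvs_space.continuous_seminorm (with_topology V (seminorm_topology S)) p"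
  obtains q where "q \<in> S" "\<And>x. x \<in> carrier V \<Longrightarrow> p x \<le> q x"
proof -
  interpret E: tvs_space "with_topology V (seminorm_topology S)"
    by (rule tvs_space.intro) fact
  obtain U where U: "openin (seminorm_topology S) U" "\<zero> \<in> U" "\<And>x. x \<in> U \<Longrightarrow> p x \<le> 1"
    and sp: "seminorm p"
    using p by (auto simp: E.continuous_seminorm_def kspace_seminorm_with_topology)
  then obtain q where q: "q \<in> S" "\<And>y. y \<in> carrier V \<Longrightarrow> q (y \<ominus> \<zero>) < 1 \<Longrightarrow> y \<in> U"
    unfolding openin_seminorm_topology by blast
  have "p x \<le> q x" if x: "x \<in> carrier V" for x
  proof (rule dense_ge)
    fix s assume s: "q x < s"
    then have s0: "0 < s"
      using seminorm_nonneg[OF seminorm[OF q(1)] x] by linarith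
    have "q (of_real (1 / s) \<odot> x) < 1"
      using s s0 x seminorm_scale[OF seminorm[OF q(1)] x, of "of_real (1 / s)"]
      by (simp add: norm_divide)
    then have "p (of_real (1 / s) \<odot> x) \<le> 1"
      using q(2)[of "of_real (1 / s) \<odot> x"] x by (intro U(3)) auto
    then show "p x \<le> s"
      using s0 x seminorm_scale[OF sp x, of "of_real (1 / s)"] by (simp add: norm_divide)
  qed
  with q(1) that show thesis
    by blast
qed

lemma coarser_seminorm_topology:
  assumes TVS: "TVS (with_topology V T)"
    and S: "\<And>p. p \<in> S \<Longrightarrow> tvs_space.continuous_seminorm (with_topology V T) p"
  shows "coarser (seminorm_topology S) T"
  unfolding coarser_def
proof (intro allI impI)
  interpret E: tvs_space "with_topology V T"
    by (rule tvs_space.intro) fact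
  fix U assume U: "openin (seminorm_topology S) U"
  show "openin T U"
  proof (subst openin_subopen, intro ballI)
    fix x assume x: "x \<in> U"
    then obtain p where p: "p \<in> S" "\<And>y. y \<in> carrier V \<Longrightarrow> p (y \<ominus> x) < 1 \<Longrightarrow> y \<in> U"
      using U unfolding openin_seminorm_topology by blast
    have xV: "x \<in> carrier V"
      using U x by (auto simp: openin_seminorm_topology)
    show "\<exists>N. openin T N \<and> x \<in> N \<and> N \<subseteq> U"
      using E.openin_seminorm_ball[OF S[OF p(1)], of x] mem_ball_center[OF p(1) xV, of 1] p(2) xV
      by (intro exI[of _ "{y \<in> carrier V. p (y \<ominus> x) < 1}"]) auto
  qed
qed

end

lemma continuous_map_seminorm_topologies:
  assumes "seminorm_family V S" "seminorm_family W S'" and h: "h \<in> linear_maps V W"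
    and le: "\<And>p. p \<in> S' \<Longrightarrow> \<exists>q\<in>S. \<forall>x\<in>carrier V. p (h x) \<le> q x"
  shows "continuous_map (kspace.seminorm_topology V S) (kspace.seminorm_topology W S') h"
proof -
  interpret V: seminorm_family V S by fact
  interpret W: seminorm_family W S' by fact
  have h_minus: "h (y \<ominus>\<^bsub>V\<^esub> x) = h y \<ominus>\<^bsub>W\<^esub> h x" if "x \<in> carrier V" "y \<in> carrier V" for x y
    using that linear_mapsD(1)[OF h] linear_mapsD(4)[OF h that(1), of "-1"]
    by (simp add: a_minus_def linear_mapsD(3)[OF h] V.smult_minus_1 W.smult_minus_1)
  show ?thesis
  proof (rule W.continuous_map_into_seminorm_topology)
    fix x p assume x: "x \<in> topspace (V.seminorm_topology S)" and p: "p \<in> S'"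
    then have xV: "x \<in> carrier V"
      by simp
    obtain q where q: "q \<in> S" "\<And>x. x \<in> carrier V \<Longrightarrow> p (h x) \<le> q x"
      using le[OF p] by blast
    have "p (h y \<ominus>\<^bsub>W\<^esub> h x) < 1" if "y \<in> carrier V" "q (y \<ominus>\<^bsub>V\<^esub> x) < 1" for y
      using q(2)[of "y \<ominus>\<^bsub>V\<^esub> x"] h_minus[OF xV that(1)] xV that by simp
    then show "\<exists>N. openin (V.seminorm_topology S) N \<and> x \<in> N \<and> (\<forall>y\<in>N. p (h y \<ominus>\<^bsub>W\<^esub> h x) < 1)"
      using V.openin_ball[OF q(1) xV, of 1] V.mem_ball_center[OF q(1) xV, of 1]
      by (intro exI[of _ "{y \<in> carrier V. q (y \<ominus>\<^bsub>V\<^esub> x) < 1}"]) auto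
  qed (use linear_mapsD(1)[OF h] in auto)
qed

section \<open>The weak and the Mackey topology\<close>

text \<open>\<open>F\<close> is the prospective dual as a set of functions. Stating the theory for
  \<open>F\<close>, detached from a chu object, makes topologies of different pairings with the same
  functionals directly comparable.\<close>

locale functional_space = kspace V
  for V :: "('k::real_or_complex, 'a) module" (structure) +
  fixes F :: "('a \<Rightarrow> 'k) set"
  assumes linear: "F \<subseteq> linear_maps V ground"
    and zero_mem: "(\<lambda>x\<in>carrier V. 0) \<in> F"
    and add_mem: "f \<in> F \<Longrightarrow> g \<in> F \<Longrightarrow> (\<lambda>x\<in>carrier V. f x + g x) \<in> F"
    and scale_mem: "f \<in> F \<Longrightarrow> (\<lambda>x\<in>carrier V. c * f x) \<in> F"
    and separating: "x \<in> carrier V \<Longrightarrow> (\<And>f. f \<in> F \<Longrightarrow> f x = 0) \<Longrightarrow> x = \<zero>"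
begin

text \<open>The closure of the seminorms \<open>norm (f x)\<close> under sums and multiples that
  \<open>seminorm_family\<close> demands, generated inductively so that properties can be checked
  rule by rule.\<close>

inductive_set weak_seminorms :: "('a \<Rightarrow> real) set" where
  weak_null: "(\<lambda>_. 0) \<in> weak_seminorms"
| weak_norm: "f \<in> F \<Longrightarrow> (\<lambda>x. norm (f x)) \<in> weak_seminorms"
| weak_plus: "p \<in> weak_seminorms \<Longrightarrow> q \<in> weak_seminorms \<Longrightarrow> (\<lambda>x. p x + q x) \<in> weak_seminorms"
| weak_times: "p \<in> weak_seminorms \<Longrightarrow> 0 \<le> c \<Longrightarrow> (\<lambda>x. c * p x) \<in> weak_seminorms"

text \<open>
  A topology has dual \<open>F\<close> only if every functional that is dominated by a continuous seminorm
  lies in \<open>F\<close>. The splitting of functionals makes the set of all seminorms with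
  this property closed under sums, so that it generates the strongest dual topology.
\<close>

definition mackey_seminorms :: "('a \<Rightarrow> real) set" where
  "mackey_seminorms = {p. seminorm p \<and>
     (\<forall>\<phi>\<in>linear_maps V ground. \<forall>C\<ge>0. (\<forall>x\<in>carrier V. norm (\<phi> x) \<le> C * p x) \<longrightarrow> \<phi> \<in> F)}"

lemma mackeyI:
  assumes "seminorm p" "\<And>\<phi> C. \<lbrakk>\<phi> \<in> linear_maps V ground; 0 \<le> C;
    \<And>x. x \<in> carrier V \<Longrightarrow> norm (\<phi> x) \<le> C * p x\<rbrakk> \<Longrightarrow> \<phi> \<in> F"
  shows "p \<in> mackey_seminorms"
  using assms by (simp add: mackey_seminorms_def)

lemma mackeyD:
  assumes "p \<in> mackey_seminorms"
  shows "seminorm p"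
    and "\<lbrakk>\<phi> \<in> linear_maps V ground; 0 \<le> C; \<And>x. x \<in> carrier V \<Longrightarrow> norm (\<phi> x) \<le> C * p x\<rbrakk> \<Longrightarrow> \<phi> \<in> F"
  using assms by (auto simp: mackey_seminorms_def)

lemma mem_functionalsI:
  assumes "\<phi> \<in> linear_maps V ground" "(\<lambda>x\<in>carrier V. g x) \<in> F"
    "\<And>x. x \<in> carrier V \<Longrightarrow> \<phi> x = g x"
  shows "\<phi> \<in> F"
proof -
  have "\<phi> = (\<lambda>x\<in>carrier V. g x)"
    using assms(3) linear_mapsD(2)[OF assms(1)] by (intro extensionalityI[of _ "carrier V"]) auto
  then show ?thesis
    using assms(2) by simp
qed

lemma null_mackey: "(\<lambda>_. 0) \<in> mackey_seminorms"
  by (rule mackeyI[OF seminorm_null]) (auto intro: mem_functionalsI[OF _ zero_mem])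

lemma plus_mackey:
  assumes p: "p \<in> mackey_seminorms" and q: "q \<in> mackey_seminorms"
  shows "(\<lambda>x. p x + q x) \<in> mackey_seminorms"
proof (rule mackeyI)
  show "seminorm (\<lambda>x. p x + q x)"
    using mackeyD(1)[OF p] mackeyD(1)[OF q] by (rule seminorm_plus)
  fix \<phi> C assume \<phi>: "\<phi> \<in> linear_maps V ground" and C: "0 \<le> C"
    and le: "\<And>x. x \<in> carrier V \<Longrightarrow> norm (\<phi> x) \<le> C * (p x + q x)"
  have "norm (\<phi> x) \<le> C * p x + C * q x" if "x \<in> carrier V" for x
    using le[OF that] by (simp add: distrib_left)
  then obtain \<phi>1 \<phi>2 where \<phi>12: "\<phi>1 \<in> linear_maps V ground" "\<phi>2 \<in> linear_maps V ground"
    "\<And>x. x \<in> carrier V \<Longrightarrow> \<phi> x = \<phi>1 x + \<phi>2 x"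
    "\<And>x. x \<in> carrier V \<Longrightarrow> norm (\<phi>1 x) \<le> 2 * (C * p x)"
    "\<And>x. x \<in> carrier V \<Longrightarrow> norm (\<phi>2 x) \<le> 2 * (C * q x)"
    using split_functional[OF \<phi> seminorm_times[OF mackeyD(1)[OF p] C]
        seminorm_times[OF mackeyD(1)[OF q] C]] by blast
  \<comment> \<open>The doubled constant from the splitting is absorbed, since membership in the
    Mackey family admits every constant.\<close>
  have "\<phi>1 \<in> F" "\<phi>2 \<in> F"
    using mackeyD(2)[OF p \<phi>12(1), of "2 * C"] mackeyD(2)[OF q \<phi>12(2), of "2 * C"] \<phi>12(4,5) C
    by (auto simp: mult.assoc)
  then show "\<phi> \<in> F"
    using \<phi>12(3) by (intro mem_functionalsI[OF \<phi> add_mem]) auto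
qed

lemma times_mackey:
  assumes p: "p \<in> mackey_seminorms" and c: "0 \<le> c"
  shows "(\<lambda>x. c * p x) \<in> mackey_seminorms"
proof (rule mackeyI)
  show "seminorm (\<lambda>x. c * p x)"
    using mackeyD(1)[OF p] c by (rule seminorm_times)
  fix \<phi> C assume "\<phi> \<in> linear_maps V ground" "0 \<le> C"
    "\<And>x. x \<in> carrier V \<Longrightarrow> norm (\<phi> x) \<le> C * (c * p x)"
  then show "\<phi> \<in> F"
    using mackeyD(2)[OF p, of \<phi> "C * c"] c by (simp add: mult.assoc)
qed

text \<open>A functional dominated by a multiple of \<open>norm (f x)\<close> vanishes on the kernel
  of \<open>f\<close>, hence is a multiple of \<open>f\<close>: with \<open>f u \<noteq> 0\<close>,
  the vector \<open>x \<ominus> (f x / f u) \<odot> u\<close> lies in that kernel.\<close>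

lemma norm_mackey:
  assumes f: "f \<in> F"
  shows "(\<lambda>x. norm (f x)) \<in> mackey_seminorms"
proof (rule mackeyI)
  have f_lin: "f \<in> linear_maps V ground"
    using f linear by blast
  then show "seminorm (\<lambda>x. norm (f x))"
    by (rule seminorm_norm_functional)
  fix \<phi> C assume \<phi>: "\<phi> \<in> linear_maps V ground" and C: "0 \<le> C"
    and le: "\<And>x. x \<in> carrier V \<Longrightarrow> norm (\<phi> x) \<le> C * norm (f x)"
  show "\<phi> \<in> F"
  proof (cases "\<exists>x\<in>carrier V. f x \<noteq> 0")
    case False
    then have "\<phi> x = 0" if "x \<in> carrier V" for x
      using le[OF that] that by simp
    then show ?thesis
      by (intro mem_functionalsI[OF \<phi> zero_mem]) auto
  next
    case True
    then obtain u where u: "u \<in> carrier V" "f u \<noteq> 0"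
      by blast
    have "\<phi> x = \<phi> u / f u * f x" if x: "x \<in> carrier V" for x
    proof -
      have "f (x \<ominus> (f x / f u) \<odot> u) = 0"
        using x u linear_mapsD(4)[OF f_lin u(1), of "f x / f u"] by (simp add: functional_minus[OF f_lin])
      then have "\<phi> (x \<ominus> (f x / f u) \<odot> u) = 0"
        using le[of "x \<ominus> (f x / f u) \<odot> u"] x u by simp
      then show ?thesis
        using x u linear_mapsD(4)[OF \<phi> u(1), of "f x / f u"]
        by (simp add: functional_minus[OF \<phi>] mult.commute)
    qed
    then show ?thesis
      by (rule mem_functionalsI[OF \<phi> scale_mem[OF f, of "\<phi> u / f u"]])
  qed
qed

lemma weak_subset_mackey: "weak_seminorms \<subseteq> mackey_seminorms"
proof
  show "p \<in> mackey_seminorms" if "p \<in> weak_seminorms" for p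
    using that by induction (auto intro: null_mackey norm_mackey plus_mackey times_mackey)
qed

sublocale mackey: seminorm_family V mackey_seminorms
  by unfold_locales (auto intro: mackeyD null_mackey plus_mackey times_mackey)

sublocale weak: seminorm_family V weak_seminorms
  using weak_subset_mackey mackey.seminorm
  by unfold_locales (auto intro: weak_seminorms.intros)

definition dual_to :: "'a topology \<Rightarrow> bool" where
  "dual_to T \<longleftrightarrow> TVS (with_topology V T) \<and> carrier (tdual (with_topology V T)) = F"

text \<open>One argument serves both extremes. Containing the weak seminorms makes every member of
  \<open>F\<close> continuous and separates points; staying within the Mackey seminorms forces every
  continuous functional into \<open>F\<close>, because it is dominated by a member of
  \<open>S\<close>.\<close>

lemma dual_to_seminorm_topology:
  assumes S: "seminorm_family V S" and weak: "weak_seminorms \<subseteq> S" and mackey: "S \<subseteq> mackey_seminorms"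
  shows "dual_to (seminorm_topology S)"
proof -
  interpret S: seminorm_family V S by fact
  have TVS: "TVS (with_topology V (seminorm_topology S))"
  proof (rule S.TVS_seminorm_topology)
    fix x assume "x \<in> carrier V" "x \<noteq> \<zero>"
    then obtain f where "f \<in> F" "f x \<noteq> 0"
      using separating by blast
    then show "\<exists>p\<in>S. p x \<noteq> 0"
      using weak weak_norm by (intro bexI[of _ "\<lambda>x. norm (f x)"]) auto
  qed
  interpret E: tvs_space "with_topology V (seminorm_topology S)"
    by (rule tvs_space.intro) fact
  have "\<phi> \<in> carrier (tdual (with_topology V (seminorm_topology S))) \<longleftrightarrow> \<phi> \<in> F" for \<phi>
  proof
    assume \<phi>: "\<phi> \<in> carrier (tdual (with_topology V (seminorm_topology S)))"
    then have lin: "\<phi> \<in> linear_maps V ground"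
      by (simp add: E.tdual_carrier)
    have "E.continuous_seminorm (\<lambda>x. norm (\<phi> x))"
      using E.continuous_functional_iff[of \<phi>] \<phi> lin by simp
    then obtain q where "q \<in> S" "\<And>x. x \<in> carrier V \<Longrightarrow> norm (\<phi> x) \<le> q x"
      using S.continuous_seminorm_dominated[OF TVS] by blast
    then show "\<phi> \<in> F"
      using mackey mackeyD(2)[of q \<phi> 1] lin by auto
  next
    assume \<phi>: "\<phi> \<in> F"
    then have lin: "\<phi> \<in> linear_maps V ground"
      using linear by blast
    have mem: "(\<lambda>x. norm (\<phi> x)) \<in> S"
      using weak weak_norm[OF \<phi>] by blast
    have "E.continuous_seminorm (\<lambda>x. norm (\<phi> x))"
      unfolding E.continuous_seminorm_def S.kspace_seminorm_with_topology
    proof (intro conjI exI[of _ "{y \<in> carrier V. norm (\<phi> (y \<ominus> \<zero>)) < 1}"])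
      show "openin (vtop (with_topology V (seminorm_topology S))) {y \<in> carrier V. norm (\<phi> (y \<ominus> \<zero>)) < 1}"
        using S.openin_ball[OF mem zero_closed, of 1] by simp
      show "\<zero>\<^bsub>with_topology V (seminorm_topology S)\<^esub> \<in> {y \<in> carrier V. norm (\<phi> (y \<ominus> \<zero>)) < 1}"
        using S.mem_ball_center[OF mem zero_closed, of 1] by simp
    qed (auto intro: seminorm_norm_functional[OF lin])
    then show "\<phi> \<in> carrier (tdual (with_topology V (seminorm_topology S)))"
      using E.continuous_functional_iff[of \<phi>] lin by simp
  qed
  then show ?thesis
    using TVS by (auto simp: dual_to_def)
qed

lemma dual_to_weak: "dual_to (seminorm_topology weak_seminorms)"
  using weak_subset_mackey by (intro dual_to_seminorm_topology weak.seminorm_family_axioms) auto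

lemma dual_to_mackey: "dual_to (seminorm_topology mackey_seminorms)"
  using weak_subset_mackey by (intro dual_to_seminorm_topology mackey.seminorm_family_axioms) auto

text \<open>The generators \<open>norm (f x)\<close> are continuous for any topology whose dual is
  \<open>F\<close>, and continuous seminorms are closed under the remaining rules.\<close>

lemma weak_coarsest:
  assumes "dual_to T"
  shows "coarser (seminorm_topology weak_seminorms) T"
proof (rule weak.coarser_seminorm_topology)
  show TVS: "TVS (with_topology V T)"
    using assms by (simp add: dual_to_def)
  interpret E: tvs_space "with_topology V T"
    by (rule tvs_space.intro) fact
  fix p assume "p \<in> weak_seminorms"
  then show "E.continuous_seminorm p"
  proof induction
    case (weak_norm f)
    then show ?case
      using E.continuous_functional_iff[of f] assms linear by (auto simp: dual_to_def)
  qed (auto intro: E.continuous_seminorm_null E.continuous_seminorm_plus E.continuous_seminorm_times)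
qed

text \<open>A continuous seminorm of a dual topology is a Mackey seminorm: whatever functional it
  dominates is continuous and therefore lies in \<open>F\<close>. By local convexity such seminorms
  describe all open sets.\<close>

lemma mackey_finest:
  assumes "dual_to T"
  shows "coarser T (seminorm_topology mackey_seminorms)"
  unfolding coarser_def mackey.openin_seminorm_topology
proof (intro allI impI conjI ballI)
  have TVS: "TVS (with_topology V T)"
    using assms by (simp add: dual_to_def)
  interpret E: tvs_space "with_topology V T"
    by (rule tvs_space.intro) fact
  fix U assume U: "openin T U"
  then show "U \<subseteq> carrier V"
    using E.openin_subset_carrier by simp
  fix x assume x: "x \<in> U"
  obtain p where p: "E.continuous_seminorm p" "\<And>y. y \<in> carrier V \<Longrightarrow> p (y \<ominus> x) < 1 \<Longrightarrow> y \<in> U"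
    using E.open_contains_seminorm_ball[of U x] U x by auto
  have "p \<in> mackey_seminorms"
  proof (rule mackeyI)
    show "seminorm p"
      using p(1) by (simp add: E.continuous_seminorm_def mackey.kspace_seminorm_with_topology)
    fix \<phi> C assume \<phi>: "\<phi> \<in> linear_maps V ground" and C: "0 \<le> C"
      and le: "\<And>x. x \<in> carrier V \<Longrightarrow> norm (\<phi> x) \<le> C * p x"
    have "E.continuous_seminorm (\<lambda>x. norm (\<phi> x))"
      using le \<phi> by (intro E.continuous_seminorm_mono[OF E.continuous_seminorm_times[OF p(1) C]]
          E.seminorm_norm_functional) auto
    then show "\<phi> \<in> F"
      using E.continuous_functional_iff[of \<phi>] \<phi> assms by (simp add: dual_to_def)
  qed
  with p(2) show "\<exists>p\<in>mackey_seminorms. \<forall>y\<in>carrier V. p (y \<ominus> x) < 1 \<longrightarrow> y \<in> U"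
    by blast
qed

end

text \<open>For the weak topologies a bound for \<open>p (h x)\<close> is built along the generation
  of \<open>p\<close>. For the Mackey topologies \<open>p (h x)\<close> is itself a Mackey seminorm:
  a functional that it dominates extends along \<open>h\<close> to some \<open>\<psi>\<close>
  dominated by a multiple of \<open>p\<close>, so \<open>\<psi>\<close> lies in \<open>G\<close> and
  its composition with \<open>h\<close> in \<open>F\<close>.\<close>

lemma continuous_adjointable:
  assumes "functional_space V F" "functional_space W G" and h: "h \<in> linear_maps V W"
    and adj: "\<And>g. g \<in> G \<Longrightarrow> (\<lambda>x\<in>carrier V. g (h x)) \<in> F"
  shows "continuous_map (kspace.seminorm_topology V (functional_space.weak_seminorms F))
      (kspace.seminorm_topology W (functional_space.weak_seminorms G)) h"
    and "continuous_map (kspace.seminorm_topology V (functional_space.mackey_seminorms V F))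
      (kspace.seminorm_topology W (functional_space.mackey_seminorms W G)) h"
proof -
  interpret V: functional_space V F by fact
  interpret W: functional_space W G by fact
  have "\<exists>q\<in>V.weak_seminorms. \<forall>x\<in>carrier V. p (h x) \<le> q x" if "p \<in> W.weak_seminorms" for p
    using that
  proof induction
    case weak_null
    then show ?case
      using V.weak_null by auto
  next
    case (weak_norm g)
    then show ?case
      using V.weak_norm[OF adj[OF weak_norm]] by (auto intro!: bexI[OF _ V.weak_norm[OF adj]])
  next
    case (weak_plus p p')
    then obtain q q' where "q \<in> V.weak_seminorms" "\<forall>x\<in>carrier V. p (h x) \<le> q x"
      "q' \<in> V.weak_seminorms" "\<forall>x\<in>carrier V. p' (h x) \<le> q' x"
      by blast
    then show ?case
      by (intro bexI[OF _ V.weak_plus[of q q']]) (auto intro: add_mono)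
  next
    case (weak_times p c)
    then obtain q where "q \<in> V.weak_seminorms" "\<forall>x\<in>carrier V. p (h x) \<le> q x"
      by blast
    then show ?case
      using weak_times by (intro bexI[OF _ V.weak_times[of q c]]) (auto intro: mult_left_mono)
  qed
  then show "continuous_map (V.seminorm_topology V.weak_seminorms)
      (W.seminorm_topology W.weak_seminorms) h"
    by (intro continuous_map_seminorm_topologies[OF V.weak.seminorm_family_axioms
        W.weak.seminorm_family_axioms h])
  have "(\<lambda>x. p (h x)) \<in> V.mackey_seminorms" if p: "p \<in> W.mackey_seminorms" for p
  proof (rule V.mackeyI)
    have sp: "W.seminorm p"
      using p by (rule W.mackeyD)
    show "V.seminorm (\<lambda>x. p (h x))"
      using linear_mapsD[OF h] W.seminorm_add[OF sp] W.seminorm_scale[OF sp]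
      by (simp add: V.seminorm_def)
    fix \<phi> C assume \<phi>: "\<phi> \<in> linear_maps V ground" and C: "0 \<le> C"
      and le: "\<And>x. x \<in> carrier V \<Longrightarrow> norm (\<phi> x) \<le> C * p (h x)"
    obtain \<psi> where \<psi>: "\<psi> \<in> linear_maps W ground" "\<And>y. y \<in> carrier W \<Longrightarrow> norm (\<psi> y) \<le> 2 * (C * p y)"
      "\<And>x. x \<in> carrier V \<Longrightarrow> \<psi> (h x) = \<phi> x"
      using extend_functional_along[OF V.kspace_axioms W.kspace_axioms h \<phi> W.seminorm_times[OF sp C] le]
      by blast
    have "\<psi> \<in> G"
      using W.mackeyD(2)[OF p \<psi>(1), of "2 * C"] \<psi>(2) C by (simp add: mult.assoc)
    then show "\<phi> \<in> F"
      using \<psi>(3) by (intro V.mem_functionalsI[OF \<phi> adj]) auto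
  qed
  then have "\<exists>q\<in>V.mackey_seminorms. \<forall>x\<in>carrier V. p (h x) \<le> q x" if "p \<in> W.mackey_seminorms" for p
    using that by (intro bexI[of _ "\<lambda>x. p (h x)"]) auto
  then show "continuous_map (V.seminorm_topology V.mackey_seminorms)
      (W.seminorm_topology W.mackey_seminorms) h"
    by (intro continuous_map_seminorm_topologies[OF V.mackey.seminorm_family_axioms
        W.mackey.seminorm_family_axioms h])
qed

section \<open>Dual topologies of a pairing\<close>

lemma map_space_simps [simp]:
  "carrier (map_space F V W) = F"
  "\<zero>\<^bsub>map_space F V W\<^esub> = (\<lambda>x\<in>carrier V. \<zero>\<^bsub>W\<^esub>)"
  "f \<oplus>\<^bsub>map_space F V W\<^esub> g = (\<lambda>x\<in>carrier V. f x \<oplus>\<^bsub>W\<^esub> g x)"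
  "c \<odot>\<^bsub>map_space F V W\<^esub> f = (\<lambda>x\<in>carrier V. c \<odot>\<^bsub>W\<^esub> f x)"
  by (simp_all add: map_space_def)

lemma vector_sp_map_space:
  assumes "vector_sp W" and F: "F \<subseteq> carrier V \<rightarrow>\<^sub>E carrier W"
    and zero: "(\<lambda>x\<in>carrier V. \<zero>\<^bsub>W\<^esub>) \<in> F"
    and add: "\<And>f g. f \<in> F \<Longrightarrow> g \<in> F \<Longrightarrow> (\<lambda>x\<in>carrier V. f x \<oplus>\<^bsub>W\<^esub> g x) \<in> F"
    and scale: "\<And>c f. f \<in> F \<Longrightarrow> (\<lambda>x\<in>carrier V. c \<odot>\<^bsub>W\<^esub> f x) \<in> F"
  shows "vector_sp (map_space F V W)"
proof -
  interpret W: kspace W by (rule kspace.intro) fact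
  have mem: "f x \<in> carrier W" if "f \<in> F" "x \<in> carrier V" for f x
    using F that by blast
  have ext: "(\<lambda>x\<in>carrier V. f x) = f" if "f \<in> F" for f
    using F that by (intro extensional_restrict) (auto simp: PiE_def)
  show ?thesis
  proof (rule vector_spI)
    fix f assume "f \<in> carrier (map_space F V W)"
    then have f: "f \<in> F" by simp
    show "\<zero>\<^bsub>map_space F V W\<^esub> \<oplus>\<^bsub>map_space F V W\<^esub> f = f"
      using ext[OF f] by (simp add: mem[OF f] cong: restrict_cong)
    show "1 \<odot>\<^bsub>map_space F V W\<^esub> f = f"
      using ext[OF f] by (simp add: mem[OF f] cong: restrict_cong)
  qed (auto simp: add scale zero mem W.a_ac W.smult_add_left W.smult_add_right
      W.smult_smult intro!: restrict_ext)
qed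

lemma linear_maps_closed:
  assumes "vector_sp V" "vector_sp W"
  shows "(\<lambda>x\<in>carrier V. \<zero>\<^bsub>W\<^esub>) \<in> linear_maps V W"
    and "f \<in> linear_maps V W \<Longrightarrow> g \<in> linear_maps V W \<Longrightarrow>
      (\<lambda>x\<in>carrier V. f x \<oplus>\<^bsub>W\<^esub> g x) \<in> linear_maps V W"
    and "f \<in> linear_maps V W \<Longrightarrow> (\<lambda>x\<in>carrier V. c \<odot>\<^bsub>W\<^esub> f x) \<in> linear_maps V W"
proof -
  interpret V: kspace V by (rule kspace.intro) fact
  interpret W: kspace W by (rule kspace.intro) fact
  show "(\<lambda>x\<in>carrier V. \<zero>\<^bsub>W\<^esub>) \<in> linear_maps V W"
    by (rule linear_mapsI) auto
  assume f: "f \<in> linear_maps V W"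
  show "(\<lambda>x\<in>carrier V. c \<odot>\<^bsub>W\<^esub> f x) \<in> linear_maps V W"
    by (rule linear_mapsI)
      (auto simp: linear_mapsD[OF f] W.smult_add_right W.smult_smult mult.commute)
  assume g: "g \<in> linear_maps V W"
  show "(\<lambda>x\<in>carrier V. f x \<oplus>\<^bsub>W\<^esub> g x) \<in> linear_maps V W"
  proof (rule linear_mapsI)
    fix x y assume "x \<in> carrier V" "y \<in> carrier V"
    then show "(\<lambda>x\<in>carrier V. f x \<oplus>\<^bsub>W\<^esub> g x) (x \<oplus>\<^bsub>V\<^esub> y) =
        (\<lambda>x\<in>carrier V. f x \<oplus>\<^bsub>W\<^esub> g x) x \<oplus>\<^bsub>W\<^esub> (\<lambda>x\<in>carrier V. f x \<oplus>\<^bsub>W\<^esub> g x) y"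
      using W.add_add_swap[of "f x" "f y" "g x" "g y"]
      by (simp add: linear_mapsD(1,3)[OF f] linear_mapsD(1,3)[OF g])
  qed (auto simp: linear_mapsD(1,4)[OF f] linear_mapsD(1,4)[OF g] W.smult_add_right)
qed

lemma truncate_simps [simp]:
  "carrier (module.truncate M) = carrier M" "zero (module.truncate M) = zero M"
  "add (module.truncate M) = add M" "smult (module.truncate M) = smult M"
  by (simp_all add: module.defs)

lemma truncate_with_topology [simp]: "module.truncate (with_topology M T) = M"
  by (simp add: with_topology_def module.defs tvs.defs)

lemma linear_maps_truncate [simp]:
  "linear_maps (module.truncate M) W = linear_maps M W"
  "linear_maps W (module.truncate M) = linear_maps W M"
  by (simp_all add: linear_maps_def)

lemma vector_sp_truncate:
  assumes "vector_sp M"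
  shows "vector_sp (module.truncate M)"
proof -
  interpret kspace M by (rule kspace.intro) fact
  show ?thesis
    by (rule vector_spI) (auto simp: a_ac smult_add_left smult_add_right smult_smult)
qed

lemma bilinear_linear_map:
  assumes "\<And>v v'. v \<in> carrier V \<Longrightarrow> v' \<in> carrier V \<Longrightarrow> b (v \<oplus>\<^bsub>V\<^esub> v') = b v + b v'"
    and "\<And>c v. v \<in> carrier V \<Longrightarrow> b (c \<odot>\<^bsub>V\<^esub> v) = c * b v"
    and "vector_sp V"
  shows "(\<lambda>v\<in>carrier V. b v) \<in> linear_maps V ground"
proof -
  interpret kspace V by (rule kspace.intro) fact
  show ?thesis
    by (rule linear_mapsI) (auto simp: assms)
qed

text \<open>Stated for one side of the pairing only; exchanging the two arguments of
  \<open>b\<close> gives the other half of \<open>is_chuI\<close>. Injectivity is reduced to a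
  trivial kernel by passing to differences.\<close>

lemma linear_map_pairing:
  assumes "vector_sp V" "vector_sp W"
    and add_left: "\<And>v v' w. \<lbrakk>v \<in> carrier V; v' \<in> carrier V; w \<in> carrier W\<rbrakk> \<Longrightarrow>
      b (v \<oplus>\<^bsub>V\<^esub> v') w = b v w + b v' w"
    and scale_left: "\<And>c v w. \<lbrakk>v \<in> carrier V; w \<in> carrier W\<rbrakk> \<Longrightarrow> b (c \<odot>\<^bsub>V\<^esub> v) w = c * b v w"
    and add_right: "\<And>v w w'. \<lbrakk>v \<in> carrier V; w \<in> carrier W; w' \<in> carrier W\<rbrakk> \<Longrightarrow>
      b v (w \<oplus>\<^bsub>W\<^esub> w') = b v w + b v w'"
    and scale_right: "\<And>c v w. \<lbrakk>v \<in> carrier V; w \<in> carrier W\<rbrakk> \<Longrightarrow> b v (c \<odot>\<^bsub>W\<^esub> w) = c * b v w"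
    and nondeg: "\<And>v. v \<in> carrier V \<Longrightarrow> (\<And>w. w \<in> carrier W \<Longrightarrow> b v w = 0) \<Longrightarrow> v = \<zero>\<^bsub>V\<^esub>"
  shows "(\<lambda>v\<in>carrier V. \<lambda>w\<in>carrier W. b v w) \<in> linear_maps V (alg_dual W)"
    and "inj_on (\<lambda>v\<in>carrier V. \<lambda>w\<in>carrier W. b v w) (carrier V)"
proof -
  interpret V: kspace V by (rule kspace.intro) fact
  interpret W: kspace W by (rule kspace.intro) fact
  show "(\<lambda>v\<in>carrier V. \<lambda>w\<in>carrier W. b v w) \<in> linear_maps V (alg_dual W)"
    by (rule linear_mapsI)
      (auto simp: alg_dual_def add_left scale_left intro!: bilinear_linear_map add_right scale_right
        W.vector_sp restrict_ext)
  show "inj_on (\<lambda>v\<in>carrier V. \<lambda>w\<in>carrier W. b v w) (carrier V)"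
  proof (rule inj_onI)
    fix v v' assume v: "v \<in> carrier V" and v': "v' \<in> carrier V"
      and eq: "(\<lambda>v\<in>carrier V. \<lambda>w\<in>carrier W. b v w) v = (\<lambda>v\<in>carrier V. \<lambda>w\<in>carrier W. b v w) v'"
    have "b (v \<ominus>\<^bsub>V\<^esub> v') w = 0" if w: "w \<in> carrier W" for w
    proof -
      have "(\<lambda>v\<in>carrier V. b v w) \<in> linear_maps V ground"
        using w by (intro bilinear_linear_map add_left scale_left V.vector_sp)
      from V.functional_minus[OF this v v'] have "b (v \<ominus>\<^bsub>V\<^esub> v') w = b v w - b v' w"
        using v v' by simp
      moreover have "b v w = b v' w"
        using fun_cong[OF eq, of w] v v' w by simp
      ultimately show ?thesis
        by simp
    qed
    then show "v = v'"
      using V.eq_if_minus_zero[OF v v'] nondeg[OF V.minus_closed[OF v v']] by blast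
  qed
qed

lemma is_chuI:
  fixes P :: "('k::real_or_complex, 'a, 'b) chu"
  defines "V \<equiv> lspace P" and "W \<equiv> rspace P" and "b \<equiv> pairing P"
  assumes "vector_sp V" "vector_sp W"
    and "\<And>v v' w. \<lbrakk>v \<in> carrier V; v' \<in> carrier V; w \<in> carrier W\<rbrakk> \<Longrightarrow>
      b (v \<oplus>\<^bsub>V\<^esub> v') w = b v w + b v' w"
    and "\<And>c v w. \<lbrakk>v \<in> carrier V; w \<in> carrier W\<rbrakk> \<Longrightarrow> b (c \<odot>\<^bsub>V\<^esub> v) w = c * b v w"
    and "\<And>v w w'. \<lbrakk>v \<in> carrier V; w \<in> carrier W; w' \<in> carrier W\<rbrakk> \<Longrightarrow>
      b v (w \<oplus>\<^bsub>W\<^esub> w') = b v w + b v w'"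
    and "\<And>c v w. \<lbrakk>v \<in> carrier V; w \<in> carrier W\<rbrakk> \<Longrightarrow> b v (c \<odot>\<^bsub>W\<^esub> w) = c * b v w"
    and "\<And>v. v \<in> carrier V \<Longrightarrow> (\<And>w. w \<in> carrier W \<Longrightarrow> b v w = 0) \<Longrightarrow> v = \<zero>\<^bsub>V\<^esub>"
    and "\<And>w. w \<in> carrier W \<Longrightarrow> (\<And>v. v \<in> carrier V \<Longrightarrow> b v w = 0) \<Longrightarrow> w = \<zero>\<^bsub>W\<^esub>"
  shows "is_chu P"
proof -
  have "(\<lambda>v\<in>carrier V. \<lambda>w\<in>carrier W. b v w) \<in> linear_maps V (alg_dual W)"
    "inj_on (\<lambda>v\<in>carrier V. \<lambda>w\<in>carrier W. b v w) (carrier V)"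
    by (rule linear_map_pairing; (rule assms(4-10); assumption?; blast?))+
  moreover have "(\<lambda>w\<in>carrier W. \<lambda>v\<in>carrier V. b v w) \<in> linear_maps W (alg_dual V)"
    "inj_on (\<lambda>w\<in>carrier W. \<lambda>v\<in>carrier V. b v w) (carrier W)"
    by (rule linear_map_pairing; (rule assms(4-9,11); assumption?; blast?))+
  ultimately show ?thesis
    using assms(4,5) by (simp add: is_chu_def left_map_def right_map_def V_def W_def b_def)
qed

section \<open>Chu objects and their weak and Mackey topologies\<close>

locale chu_pair =
  fixes P :: "('k::real_or_complex, 'a, 'b) chu"
  assumes is_chu: "is_chu P"
begin

sublocale l: kspace "lspace P"
  using is_chu by (simp add: kspace_def is_chu_def)

sublocale r: kspace "rspace P"
  using is_chu by (simp add: kspace_def is_chu_def)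

lemma left_map_linear: "left_map P \<in> linear_maps (lspace P) (alg_dual (rspace P))"
  using is_chu by (simp add: is_chu_def)

lemma right_map_linear: "right_map P \<in> linear_maps (rspace P) (alg_dual (lspace P))"
  using is_chu by (simp add: is_chu_def)

lemma pairing_left:
  assumes "w \<in> carrier (rspace P)"
  shows "v \<in> carrier (lspace P) \<Longrightarrow> v' \<in> carrier (lspace P) \<Longrightarrow>
      pairing P (v \<oplus>\<^bsub>lspace P\<^esub> v') w = pairing P v w + pairing P v' w"
    and "v \<in> carrier (lspace P) \<Longrightarrow> pairing P (c \<odot>\<^bsub>lspace P\<^esub> v) w = c * pairing P v w"
    and "pairing P \<zero>\<^bsub>lspace P\<^esub> w = 0"
proof -
  have "right_map P w \<in> linear_maps (lspace P) ground"
    using linear_mapsD(1)[OF right_map_linear assms] by (simp add: alg_dual_def)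
  note lin = linear_mapsD(3,4)[OF this]
  show "v \<in> carrier (lspace P) \<Longrightarrow> v' \<in> carrier (lspace P) \<Longrightarrow>
      pairing P (v \<oplus>\<^bsub>lspace P\<^esub> v') w = pairing P v w + pairing P v' w"
    using lin(1)[of v v'] assms by (simp add: right_map_def)
  show scale: "v \<in> carrier (lspace P) \<Longrightarrow> pairing P (c \<odot>\<^bsub>lspace P\<^esub> v) w = c * pairing P v w" for c v
    using lin(2)[of v c] assms by (simp add: right_map_def)
  show "pairing P \<zero>\<^bsub>lspace P\<^esub> w = 0"
    using scale[OF l.zero_closed, of 0] by simp
qed

lemma pairing_right:
  assumes "v \<in> carrier (lspace P)"
  shows "w \<in> carrier (rspace P) \<Longrightarrow> w' \<in> carrier (rspace P) \<Longrightarrow>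
      pairing P v (w \<oplus>\<^bsub>rspace P\<^esub> w') = pairing P v w + pairing P v w'"
    and "w \<in> carrier (rspace P) \<Longrightarrow> pairing P v (c \<odot>\<^bsub>rspace P\<^esub> w) = c * pairing P v w"
    and "pairing P v \<zero>\<^bsub>rspace P\<^esub> = 0"
proof -
  have "left_map P v \<in> linear_maps (rspace P) ground"
    using linear_mapsD(1)[OF left_map_linear assms] by (simp add: alg_dual_def)
  note lin = linear_mapsD(3,4)[OF this]
  show "w \<in> carrier (rspace P) \<Longrightarrow> w' \<in> carrier (rspace P) \<Longrightarrow>
      pairing P v (w \<oplus>\<^bsub>rspace P\<^esub> w') = pairing P v w + pairing P v w'"
    using lin(1)[of w w'] assms by (simp add: left_map_def)
  show scale: "w \<in> carrier (rspace P) \<Longrightarrow> pairing P v (c \<odot>\<^bsub>rspace P\<^esub> w) = c * pairing P v w" for c w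
    using lin(2)[of w c] assms by (simp add: left_map_def)
  show "pairing P v \<zero>\<^bsub>rspace P\<^esub> = 0"
    using scale[OF r.zero_closed, of 0] by simp
qed

lemma nondegenerate_left:
  assumes "v \<in> carrier (lspace P)" "\<And>w. w \<in> carrier (rspace P) \<Longrightarrow> pairing P v w = 0"
  shows "v = \<zero>\<^bsub>lspace P\<^esub>"
proof -
  have "left_map P v = left_map P \<zero>\<^bsub>lspace P\<^esub>"
    using assms pairing_left(3) by (simp add: left_map_def cong: restrict_cong)
  then show ?thesis
    using is_chu assms(1) unfolding is_chu_def by (metis inj_onD l.zero_closed)
qed

lemma nondegenerate_right:
  assumes "w \<in> carrier (rspace P)" "\<And>v. v \<in> carrier (lspace P) \<Longrightarrow> pairing P v w = 0"
  shows "w = \<zero>\<^bsub>rspace P\<^esub>"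
proof -
  have "right_map P w = right_map P \<zero>\<^bsub>rspace P\<^esub>"
    using assms pairing_right(3) by (simp add: right_map_def cong: restrict_cong)
  then show ?thesis
    using is_chu assms(1) unfolding is_chu_def by (metis inj_onD r.zero_closed)
qed

abbreviation functionals :: "('a \<Rightarrow> 'k) set" where
  "functionals \<equiv> right_map P ` carrier (rspace P)"

sublocale functional_space "lspace P" functionals
proof
  show "functionals \<subseteq> linear_maps (lspace P) ground"
    using linear_mapsD(1)[OF right_map_linear] by (auto simp: alg_dual_def)
  show "(\<lambda>x\<in>carrier (lspace P). 0) \<in> functionals"
    by (rule image_eqI[OF _ r.zero_closed])
      (simp add: right_map_def pairing_right(3) cong: restrict_cong)
next
  fix f g assume "f \<in> functionals" "g \<in> functionals"
  then obtain w w' where w: "w \<in> carrier (rspace P)" "f = right_map P w"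
    and w': "w' \<in> carrier (rspace P)" "g = right_map P w'"
    by blast
  show "(\<lambda>x\<in>carrier (lspace P). f x + g x) \<in> functionals"
    using w w' linear_mapsD(3)[OF right_map_linear w(1) w'(1)]
    by (intro image_eqI[of _ _ "w \<oplus>\<^bsub>rspace P\<^esub> w'"]) (auto simp: alg_dual_def)
next
  fix f c assume "f \<in> functionals"
  then obtain w where w: "w \<in> carrier (rspace P)" "f = right_map P w"
    by blast
  show "(\<lambda>x\<in>carrier (lspace P). c * f x) \<in> functionals"
    using w linear_mapsD(4)[OF right_map_linear w(1), of c]
    by (intro image_eqI[of _ _ "c \<odot>\<^bsub>rspace P\<^esub> w"]) (auto simp: alg_dual_def)
next
  fix x assume "x \<in> carrier (lspace P)" "\<And>f. f \<in> functionals \<Longrightarrow> f x = 0"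
  then show "x = \<zero>\<^bsub>lspace P\<^esub>"
    by (intro nondegenerate_left) (force simp: right_map_def)+
qed

text \<open>Linearity and injectivity of \<open>right_map P\<close> already belong to a chu object,
  so only its image matters. Being a dual topology thus depends on \<open>P\<close> through the left
  space and the set of functionals alone.\<close>

lemma dual_topology_iff: "dual_topology P T \<longleftrightarrow> dual_to T"
proof
  show "dual_to T" if "dual_topology P T"
    using that unfolding dual_topology_def dual_to_def bij_betw_def by blast
next
  assume T: "dual_to T"
  have "right_map P \<in> linear_maps (rspace P) (tdual (with_topology (lspace P) T))"
  proof (rule linear_mapsI)
    show "right_map P w \<in> carrier (tdual (with_topology (lspace P) T))" if "w \<in> carrier (rspace P)" for w
      using T that by (simp add: dual_to_def)
  qed (use linear_mapsD[OF right_map_linear] in \<open>auto simp: alg_dual_def tdual_def L_space_def\<close>)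
  moreover have "inj_on (right_map P) (carrier (rspace P))"
    using is_chu by (simp add: is_chu_def)
  ultimately show "dual_topology P T"
    using T unfolding dual_topology_def dual_to_def bij_betw_def by blast
qed

lemma coarser_antisym: "coarser S T \<Longrightarrow> coarser T S \<Longrightarrow> S = T"
  by (auto simp: coarser_def topology_eq)

text \<open>The description determines at most one topology because \<open>coarser\<close> is
  antisymmetric; the generated topology meets it by \<open>dual_to_weak\<close> and
  \<open>weak_coarsest\<close>.\<close>

lemma weak_topology_eq: "weak_topology P = l.seminorm_topology weak_seminorms"
  unfolding weak_topology_def dual_topology_iff
proof (rule the_equality)
  fix T assume T: "dual_to T \<and> (\<forall>S. dual_to S \<longrightarrow> coarser T S)"
  show "T = l.seminorm_topology weak_seminorms"
    using T dual_to_weak weak_coarsest[of T] by (intro coarser_antisym) auto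
qed (use dual_to_weak weak_coarsest in auto)

lemma mackey_topology_eq: "mackey_topology P = l.seminorm_topology mackey_seminorms"
  unfolding mackey_topology_def dual_topology_iff
proof (rule the_equality)
  fix T assume T: "dual_to T \<and> (\<forall>S. dual_to S \<longrightarrow> coarser S T)"
  show "T = l.seminorm_topology mackey_seminorms"
    using T dual_to_mackey mackey_finest[of T] by (intro coarser_antisym) auto
qed (use dual_to_mackey mackey_finest in auto)

end

text \<open>The second component of a morphism is an adjoint of the first: composing the functional
  of \<open>w\<close> with \<open>h\<close> gives the functional of \<open>g w\<close>, which is the
  hypothesis of \<open>continuous_adjointable\<close>.\<close>

lemma chu_hom_continuous:
  assumes "is_chu P" "is_chu Q" and hg: "(h, g) \<in> chu_hom P Q"
  shows "continuous_map (weak_topology P) (weak_topology Q) h"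
    and "continuous_map (mackey_topology P) (mackey_topology Q) h"
proof -
  interpret P: chu_pair P by (rule chu_pair.intro) fact
  interpret Q: chu_pair Q by (rule chu_pair.intro) fact
  have h: "h \<in> linear_maps (lspace P) (lspace Q)" and g: "g \<in> linear_maps (rspace Q) (rspace P)"
    and adj: "\<And>v w. v \<in> carrier (lspace P) \<Longrightarrow> w \<in> carrier (rspace Q) \<Longrightarrow>
      pairing Q (h v) w = pairing P v (g w)"
    using hg by (auto simp: chu_hom_def)
  have "(\<lambda>x\<in>carrier (lspace P). f (h x)) \<in> P.functionals" if f: "f \<in> Q.functionals" for f
  proof -
    obtain w where w: "w \<in> carrier (rspace Q)" "f = right_map Q w"
      using f by blast
    then have "(\<lambda>x\<in>carrier (lspace P). f (h x)) = right_map P (g w)"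
      using adj linear_mapsD(1)[OF h] linear_mapsD(1)[OF g]
      by (auto simp: right_map_def intro!: restrict_ext)
    then show ?thesis
      using linear_mapsD(1)[OF g] w by blast
  qed
  note cont = continuous_adjointable[OF P.functional_space_axioms Q.functional_space_axioms h this]
  show "continuous_map (weak_topology P) (weak_topology Q) h"
    unfolding P.weak_topology_eq Q.weak_topology_eq by (rule cont)
  show "continuous_map (mackey_topology P) (mackey_topology Q) h"
    unfolding P.mackey_topology_eq Q.mackey_topology_eq by (rule cont)
qed

section \<open>The pairing of a space with its dual\<close>

lemma tdual_simps [simp]:
  "\<zero>\<^bsub>tdual V\<^esub> = (\<lambda>x\<in>carrier V. 0)"
  "\<phi> \<oplus>\<^bsub>tdual V\<^esub> \<psi> = (\<lambda>x\<in>carrier V. \<phi> x + \<psi> x)"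
  "c \<odot>\<^bsub>tdual V\<^esub> \<phi> = (\<lambda>x\<in>carrier V. c * \<phi> x)"
  by (simp_all add: tdual_def L_space_def)

lemma T_functor_simps [simp]:
  "lspace (T_functor V) = module.truncate V" "rspace (T_functor V) = tdual V"
  "pairing (T_functor V) v \<phi> = \<phi> v"
  by (simp_all add: T_functor_def)

text \<open>The continuity hypotheses on the target are listed separately so that the lemma applies
  both to a space \<open>W\<close> and to \<open>ground\<close>, where they are immediate.\<close>

lemma vector_sp_L_space:
  assumes "vector_sp V" "vector_sp W" "topspace (vtop W) = carrier W"
    and add: "continuous_map (prod_topology (vtop W) (vtop W)) (vtop W) (\<lambda>(x, y). x \<oplus>\<^bsub>W\<^esub> y)"
    and scale: "\<And>c. continuous_map (vtop W) (vtop W) (\<lambda>x. c \<odot>\<^bsub>W\<^esub> x)"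
    and V: "topspace (vtop V) = carrier V"
  shows "vector_sp (L_space V W)"
proof -
  interpret V: kspace V by (rule kspace.intro) fact
  interpret W: kspace W by (rule kspace.intro) fact
  have cong: "continuous_map (vtop V) (vtop W) (\<lambda>x\<in>carrier V. f x)"
    if "continuous_map (vtop V) (vtop W) f" for f
    using continuous_map_eq[OF that, of "\<lambda>x\<in>carrier V. f x"] V by simp
  show ?thesis
    unfolding L_space_def
  proof (rule vector_sp_map_space)
    show "L V W \<subseteq> carrier V \<rightarrow>\<^sub>E carrier W"
      by (auto simp: L_def linear_maps_def)
    show "(\<lambda>x\<in>carrier V. \<zero>\<^bsub>W\<^esub>) \<in> L V W"
    proof -
      have "(\<lambda>x\<in>carrier V. \<zero>\<^bsub>W\<^esub>) \<in> linear_maps V W"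
        using linear_maps_closed(1)[OF assms(1,2)] .
      moreover have "continuous_map (vtop V) (vtop W) (\<lambda>x\<in>carrier V. \<zero>\<^bsub>W\<^esub>)"
        by (rule cong) (simp add: assms(3))
      ultimately show ?thesis
        by (simp add: L_def)
    qed
    fix f g assume f: "f \<in> L V W" and g: "g \<in> L V W"
    then have lin: "f \<in> linear_maps V W" "g \<in> linear_maps V W"
      and cont: "continuous_map (vtop V) (vtop W) f" "continuous_map (vtop V) (vtop W) g"
      by (auto simp: L_def)
    have "(\<lambda>x\<in>carrier V. f x \<oplus>\<^bsub>W\<^esub> g x) \<in> linear_maps V W"
      using linear_maps_closed(2)[OF assms(1,2) lin] .
    moreover have "continuous_map (vtop V) (vtop W) (\<lambda>x. f x \<oplus>\<^bsub>W\<^esub> g x)"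
      using continuous_map_compose[OF continuous_map_pairedI[OF cont] add] by (simp add: o_def)
    ultimately show "(\<lambda>x\<in>carrier V. f x \<oplus>\<^bsub>W\<^esub> g x) \<in> L V W"
      using cong by (simp add: L_def)
    fix c
    have "(\<lambda>x\<in>carrier V. c \<odot>\<^bsub>W\<^esub> f x) \<in> linear_maps V W"
      using linear_maps_closed(3)[OF assms(1,2) lin(1)] .
    moreover have "continuous_map (vtop V) (vtop W) (\<lambda>x. c \<odot>\<^bsub>W\<^esub> f x)"
      using continuous_map_compose[OF cont(1) scale] by (simp add: o_def)
    ultimately show "(\<lambda>x\<in>carrier V. c \<odot>\<^bsub>W\<^esub> f x) \<in> L V W"
      using cong by (simp add: L_def)
  qed fact
qed

context tvs_space
begin

lemma vector_sp_tdual: "vector_sp (tdual E)"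
  unfolding tdual_def
proof (rule vector_sp_L_space[OF vector_sp vector_sp_ground])
  have "continuous_map euclidean euclidean (\<lambda>z :: 'k \<times> 'k. fst z + snd z)"
    by (simp add: continuous_on_add continuous_on_fst continuous_on_snd)
  then show "continuous_map (prod_topology (vtop ground) (vtop ground)) (vtop ground)
      (\<lambda>(x, y). x \<oplus>\<^bsub>ground\<^esub> (y :: 'k))"
    by (simp add: euclidean_product_topology case_prod_unfold)
  show "continuous_map (vtop ground) (vtop ground) (\<lambda>x. c \<odot>\<^bsub>ground\<^esub> (x :: 'k))" for c
    by (simp add: continuous_on_mult_left)
qed auto

text \<open>Separation of points: extend the functional \<open>c \<cdot> x \<mapsto> c p(x)\<close> from the line through \<open>x\<close>.\<close>

lemma tdual_separates:
  assumes x: "x \<in> carrier E" "x \<noteq> \<zero>"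
  obtains \<phi> where "\<phi> \<in> carrier (tdual E)" "\<phi> x \<noteq> 0"
proof -
  \<comment> \<open>A neighbourhood of zero that misses \<open>x\<close> contains the open unit ball
    of a continuous seminorm, which therefore satisfies \<open>1 \<le> p x\<close>.\<close>
  obtain U A where U: "openin (vtop E) U" "\<zero> \<in> U" "x \<notin> U"
    using TVS x unfolding TVS_def Hausdorff_space_def disjnt_def by (metis disjoint_iff zero_closed)
  then obtain p where p: "continuous_seminorm p" "\<And>y. y \<in> carrier E \<Longrightarrow> p (y \<ominus> \<zero>) < 1 \<Longrightarrow> y \<in> U"
    using open_contains_seminorm_ball by metis
  have sp: "seminorm p"
    using p(1) by (simp add: continuous_seminorm_def)
  have px: "1 \<le> p x"
    using p(2)[OF x(1)] U(3) x(1) by force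
  have "(\<lambda>c. c \<odot> x) \<in> linear_maps ground E"
    using x(1) by (intro linear_mapsI) (auto simp: smult_add_left smult_smult)
  moreover have "(\<lambda>c. c * of_real (p x)) \<in> linear_maps ground ground"
    by (intro linear_mapsI) (auto simp: algebra_simps)
  moreover have "norm (c * of_real (p x)) \<le> p (c \<odot> x)" for c :: 'k
    using px by (simp add: norm_mult seminorm_scale[OF sp x(1)])
  ultimately obtain \<phi> where \<phi>: "\<phi> \<in> linear_maps E ground"
    "\<And>y. y \<in> carrier E \<Longrightarrow> norm (\<phi> y) \<le> 2 * p y" "\<And>c. \<phi> (c \<odot> x) = c * of_real (p x)"
    using extend_functional_along[OF kspace.intro[OF vector_sp_ground] kspace_axioms, of "\<lambda>c. c \<odot> x"
        "\<lambda>c. c * of_real (p x)" p] sp by auto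
  have "\<phi> x = of_real (p x)"
    using \<phi>(3)[of 1] x(1) by simp
  moreover have "continuous_seminorm (\<lambda>y. norm (\<phi> y))"
    using \<phi>(2) by (intro continuous_seminorm_mono[OF continuous_seminorm_times[OF p(1), of 2]]
        seminorm_norm_functional[OF \<phi>(1)]) auto
  ultimately show thesis
    using that[of \<phi>] continuous_functional_iff[OF \<phi>(1)] px by auto
qed

lemma tdual_linear: "\<phi> \<in> carrier (tdual E) \<Longrightarrow> \<phi> \<in> linear_maps E ground"
  by (simp add: tdual_carrier)

text \<open>Nondegeneracy on the left is separation of points by continuous functionals. On the
  right it is extensionality, as the elements of the dual are functions.\<close>

lemma is_chu_T_functor: "is_chu (T_functor E)"
proof (rule is_chuI)
  show "vector_sp (lspace (T_functor E))" "vector_sp (rspace (T_functor E))"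
    using vector_sp by (simp_all add: vector_sp_truncate vector_sp_tdual)
next
  fix v assume v: "v \<in> carrier (lspace (T_functor E))"
    and null: "\<And>w. w \<in> carrier (rspace (T_functor E)) \<Longrightarrow> pairing (T_functor E) v w = 0"
  show "v = \<zero>\<^bsub>lspace (T_functor E)\<^esub>"
  proof (rule ccontr)
    assume "v \<noteq> \<zero>\<^bsub>lspace (T_functor E)\<^esub>"
    then obtain \<phi> where "\<phi> \<in> carrier (tdual E)" "\<phi> v \<noteq> 0"
      using v tdual_separates[of v] by auto
    then show False
      using null[of \<phi>] by simp
  qed
next
  fix w assume w: "w \<in> carrier (rspace (T_functor E))"
    and null: "\<And>v. v \<in> carrier (lspace (T_functor E)) \<Longrightarrow> pairing (T_functor E) v w = 0"
  then show "w = \<zero>\<^bsub>rspace (T_functor E)\<^esub>"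
    using linear_mapsD(2)[OF tdual_linear, of w]
    by (auto intro!: extensionalityI[of _ "carrier E"])
qed (auto simp: linear_mapsD(3)[OF tdual_linear] linear_mapsD(4)[OF tdual_linear])

lemma right_map_T_functor: "right_map (T_functor E) ` carrier (rspace (T_functor E)) = carrier (tdual E)"
proof -
  have "right_map (T_functor E) \<phi> = \<phi>" if "\<phi> \<in> carrier (tdual E)" for \<phi>
    using linear_mapsD(2)[OF tdual_linear[OF that]] that
    by (auto simp: right_map_def T_functor_def extensional_restrict)
  then show ?thesis
    by (simp add: T_functor_def cong: image_cong_simp)
qed

end

text \<open>Replacing \<open>W\<close> by the dual of a dual topology keeps the left space and the
  set of functionals, hence the class of all dual topologies and its extreme members. This places
  the values of \<open>R\<close> and of its Mackey counterpart in \<open>TVS_w\<close> and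
  \<open>TVS_m\<close>.\<close>

lemma topology_of_T_functor:
  assumes "is_chu P" and T: "dual_topology P T"
  shows "weak_topology (T_functor (with_topology (lspace P) T)) = weak_topology P"
    and "mackey_topology (T_functor (with_topology (lspace P) T)) = mackey_topology P"
proof -
  interpret P: chu_pair P by (rule chu_pair.intro) fact
  have T': "P.dual_to T"
    using T by (simp add: P.dual_topology_iff)
  interpret E: tvs_space "with_topology (lspace P) T"
    using T' by (simp add: tvs_space_def P.dual_to_def)
  interpret Q: chu_pair "T_functor (with_topology (lspace P) T)"
    by (rule chu_pair.intro) (rule E.is_chu_T_functor)
  have Q: "lspace (T_functor (with_topology (lspace P) T)) = lspace P" "Q.functionals = P.functionals"
    using E.right_map_T_functor T' unfolding P.dual_to_def by (simp, metis)
  have "dual_topology (T_functor (with_topology (lspace P) T)) S \<longleftrightarrow> dual_topology P S" for S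
    using Q.dual_topology_iff[of S] P.dual_topology_iff[of S] by (simp only: Q)
  then show "weak_topology (T_functor (with_topology (lspace P) T)) = weak_topology P"
    "mackey_topology (T_functor (with_topology (lspace P) T)) = mackey_topology P"
    by (simp_all add: weak_topology_def mackey_topology_def)
qed

lemma dual_topology_weak_mackey:
  assumes "is_chu P"
  shows "dual_topology P (weak_topology P)" "dual_topology P (mackey_topology P)"
proof -
  interpret chu_pair P by (rule chu_pair.intro) fact
  show "dual_topology P (weak_topology P)" "dual_topology P (mackey_topology P)"
    by (simp_all add: dual_topology_iff weak_topology_eq mackey_topology_eq dual_to_weak dual_to_mackey)
qed

lemma TVS_w_with_weak_topology:
  assumes "is_chu P"
  shows "TVS_w (with_topology (lspace P) (weak_topology P))"
  using topology_of_T_functor[OF assms dual_topology_weak_mackey(1)[OF assms]] dual_topology_weak_mackey(1)[OF assms]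
  by (simp add: TVS_w_def dual_topology_def)

lemma TVS_m_with_mackey_topology:
  assumes "is_chu P"
  shows "TVS_m (with_topology (lspace P) (mackey_topology P))"
  using topology_of_T_functor[OF assms dual_topology_weak_mackey(2)[OF assms]] dual_topology_weak_mackey(2)[OF assms]
  by (simp add: TVS_m_def dual_topology_def)

text \<open>With the identity on the common right space, both \<open>\<alpha>\<close> and
  \<open>\<beta>\<close> become chu morphisms, so \<open>chu_hom_continuous\<close> makes them
  continuous in both directions for both topologies. That \<open>P'\<close> is a chu object is
  transported from \<open>P\<close> first, since its topologies are meaningful only then.\<close>

lemma isomorphic_pairs:
  assumes P: "is_chu P" and vs: "vector_sp (lspace P')" and rspace: "rspace P' = rspace P"
    and \<alpha>: "\<alpha> \<in> linear_maps (lspace P') (lspace P)" and \<beta>: "\<beta> \<in> linear_maps (lspace P) (lspace P')"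
    and \<alpha>\<beta>: "\<And>x. x \<in> carrier (lspace P) \<Longrightarrow> \<alpha> (\<beta> x) = x"
    and \<beta>\<alpha>: "\<And>x. x \<in> carrier (lspace P') \<Longrightarrow> \<beta> (\<alpha> x) = x"
    and pairing: "\<And>x t. x \<in> carrier (lspace P') \<Longrightarrow> t \<in> carrier (rspace P) \<Longrightarrow>
      pairing P' x t = pairing P (\<alpha> x) t"
  shows "is_chu P'"
    and "with_topology (lspace P) (weak_topology P) \<cong>\<^sub>T with_topology (lspace P') (weak_topology P')"
    and "with_topology (lspace P) (mackey_topology P) \<cong>\<^sub>T with_topology (lspace P') (mackey_topology P')"
proof -
  interpret P: chu_pair P by (rule chu_pair.intro) fact
  interpret l': kspace "lspace P'" by (rule kspace.intro) fact
  note \<alpha>_mem = linear_mapsD(1)[OF \<alpha>] and \<beta>_mem = linear_mapsD(1)[OF \<beta>]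
  have \<beta>0: "\<beta> \<zero>\<^bsub>lspace P\<^esub> = \<zero>\<^bsub>lspace P'\<^esub>"
    using linear_mapsD(4)[OF \<beta> P.l.zero_closed, of 0] \<beta>_mem[OF P.l.zero_closed] by simp
  show P': "is_chu P'"
  proof (rule is_chuI)
    show "v = \<zero>\<^bsub>lspace P'\<^esub>"
      if "v \<in> carrier (lspace P')" "\<And>w. w \<in> carrier (rspace P') \<Longrightarrow> pairing P' v w = 0" for v
    proof -
      have "\<alpha> v = \<zero>\<^bsub>lspace P\<^esub>"
        using that by (intro P.nondegenerate_left) (auto simp: rspace pairing \<alpha>_mem)
      then show ?thesis
        using \<beta>\<alpha>[OF that(1)] \<beta>0 by simp
    qed
    show "w = \<zero>\<^bsub>rspace P'\<^esub>"
      if w: "w \<in> carrier (rspace P')" "\<And>v. v \<in> carrier (lspace P') \<Longrightarrow> pairing P' v w = 0" for w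
    proof -
      have "pairing P v w = 0" if "v \<in> carrier (lspace P)" for v
        using w(2)[of "\<beta> v"] pairing[of "\<beta> v" w] that w(1) by (simp add: rspace \<beta>_mem \<alpha>\<beta>)
      then show ?thesis
        using w(1) P.nondegenerate_right by (simp add: rspace)
    qed
  qed (use vs P.r.vector_sp in \<open>auto simp: rspace pairing \<alpha>_mem linear_mapsD(3,4)[OF \<alpha>]
      P.pairing_left P.pairing_right\<close>)
  define i where "i = (\<lambda>t\<in>carrier (rspace P). t)"
  have i: "i \<in> linear_maps (rspace P) (rspace P)"
    by (rule linear_mapsI) (auto simp: i_def)
  have "(\<alpha>, i) \<in> chu_hom P' P"
    using \<alpha> i by (auto simp: chu_hom_def rspace pairing i_def)
  then have cont_\<alpha>: "continuous_map (weak_topology P') (weak_topology P) \<alpha>"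
    "continuous_map (mackey_topology P') (mackey_topology P) \<alpha>"
    using chu_hom_continuous[OF P' P] by blast+
  have "(\<beta>, i) \<in> chu_hom P P'"
    using \<beta> i by (auto simp: chu_hom_def rspace pairing \<beta>_mem \<alpha>\<beta> i_def)
  then have cont_\<beta>: "continuous_map (weak_topology P) (weak_topology P') \<beta>"
    "continuous_map (mackey_topology P) (mackey_topology P') \<beta>"
    using chu_hom_continuous[OF P P'] by blast+
  show "with_topology (lspace P) (weak_topology P) \<cong>\<^sub>T with_topology (lspace P') (weak_topology P')"
    "with_topology (lspace P) (mackey_topology P) \<cong>\<^sub>T with_topology (lspace P') (mackey_topology P')"
    unfolding tvs_iso_def L_def
    by (rule bexI[of _ \<beta>], rule bexI[of _ \<alpha>];
        use \<alpha> \<beta> \<alpha>\<beta> \<beta>\<alpha> cont_\<alpha> cont_\<beta> in simp)+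
qed

section \<open>Tensor products\<close>

lemma lookup_fscale [simp]: "Poly_Mapping.lookup (fscale c r) k = c * Poly_Mapping.lookup r k"
  by (simp add: fscale_def map.rep_eq when_def)

interpretation fscale: Modules.module "fscale :: 'k::real_or_complex \<Rightarrow> ('x \<Rightarrow>\<^sub>0 'k) \<Rightarrow> ('x \<Rightarrow>\<^sub>0 'k)"
  by unfold_locales
    (auto intro!: poly_mapping_eqI simp: lookup_add algebra_simps)

lemma keys_fscale: "Poly_Mapping.keys (fscale c r) \<subseteq> Poly_Mapping.keys r"
  by (auto simp: in_keys_iff)

definition bilinear_form ::
  "('k::real_or_complex, 'a, 'y) module_scheme \<Rightarrow> ('k, 'b, 'z) module_scheme
    \<Rightarrow> ('a \<Rightarrow> 'b \<Rightarrow> 'k) \<Rightarrow> bool" where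
  "bilinear_form V W b \<longleftrightarrow>
     (\<forall>v\<in>carrier V. \<forall>v'\<in>carrier V. \<forall>w\<in>carrier W. b (v \<oplus>\<^bsub>V\<^esub> v') w = b v w + b v' w) \<and>
     (\<forall>c. \<forall>v\<in>carrier V. \<forall>w\<in>carrier W. b (c \<odot>\<^bsub>V\<^esub> v) w = c * b v w) \<and>
     (\<forall>v\<in>carrier V. \<forall>w\<in>carrier W. \<forall>w'\<in>carrier W. b v (w \<oplus>\<^bsub>W\<^esub> w') = b v w + b v w') \<and>
     (\<forall>c. \<forall>v\<in>carrier V. \<forall>w\<in>carrier W. b v (c \<odot>\<^bsub>W\<^esub> w) = c * b v w)"

definition free_lift :: "('x \<Rightarrow> 'k::real_or_complex) \<Rightarrow> ('x \<Rightarrow>\<^sub>0 'k) \<Rightarrow> 'k" where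
  "free_lift b r = (\<Sum>k\<in>Poly_Mapping.keys r. Poly_Mapping.lookup r k * b k)"

text \<open>The support of a sum may shrink by cancellation; summing over a common finite superset
  makes additivity termwise.\<close>

lemma free_lift_superset:
  assumes "finite A" "Poly_Mapping.keys r \<subseteq> A"
  shows "free_lift b r = (\<Sum>k\<in>A. Poly_Mapping.lookup r k * b k)"
  unfolding free_lift_def using assms
  by (intro sum.mono_neutral_left) (auto simp: in_keys_iff)

lemma free_lift_add: "free_lift b (r + s) = free_lift b r + free_lift b s"
proof -
  let ?A = "Poly_Mapping.keys r \<union> Poly_Mapping.keys s"
  have "free_lift b (r + s) = (\<Sum>k\<in>?A. Poly_Mapping.lookup (r + s) k * b k)"
    by (rule free_lift_superset) (auto dest: subsetD[OF keys_add])
  also have "\<dots> = (\<Sum>k\<in>?A. Poly_Mapping.lookup r k * b k) + (\<Sum>k\<in>?A. Poly_Mapping.lookup s k * b k)"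
    by (simp add: lookup_add distrib_right sum.distrib)
  also have "\<dots> = free_lift b r + free_lift b s"
    by (simp add: free_lift_superset[of ?A])
  finally show ?thesis .
qed

lemma free_lift_scale: "free_lift b (fscale c r) = c * free_lift b r"
  using free_lift_superset[OF _ keys_fscale, of r b c]
  by (simp add: free_lift_def sum_distrib_left mult.assoc)

lemma free_lift_diff: "free_lift b (r - s) = free_lift b r - free_lift b s"
  using free_lift_add[of b "r - s" s] by simp

lemma free_lift_single [simp]: "free_lift b (Poly_Mapping.single k c) = c * b k"
  by (simp add: free_lift_def)

section \<open>The tensor product as a vector space and its universal property\<close>

locale tensor_pair = V: kspace V + W: kspace W
  for V :: "('k::real_or_complex, 'a, 'y) module_scheme" and W :: "('k, 'b, 'z) module_scheme"
begin

abbreviation "T \<equiv> tensor V W"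
abbreviation "N \<equiv> tensor_relations V W"
abbreviation "cls \<equiv> tensor_class V W"
abbreviation "pure \<equiv> pure_tensor V W"

lemma N_simps: "0 \<in> N" "m \<in> N \<Longrightarrow> n \<in> N \<Longrightarrow> m + n \<in> N" "m \<in> N \<Longrightarrow> n \<in> N \<Longrightarrow> m - n \<in> N"
  "n \<in> N \<Longrightarrow> fscale c n \<in> N" "n \<in> N \<Longrightarrow> - n \<in> N"
  unfolding tensor_relations_def
  by (auto intro: fscale.span_zero fscale.span_add fscale.span_diff fscale.span_scale fscale.span_neg)

lemma class_eq_iff: "cls r = cls s \<longleftrightarrow> r - s \<in> N"
proof
  assume "cls r = cls s"
  then have "r \<in> cls s"
    using N_simps(1) by (force simp: tensor_class_def)
  then show "r - s \<in> N"
    by (auto simp: tensor_class_def)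
next
  assume rs: "r - s \<in> N"
  have "r + n = s + ((r - s) + n)" "s + n = r + (n - (r - s))" for n
    by (simp_all add: algebra_simps)
  then show "cls r = cls s"
    unfolding tensor_class_def using rs N_simps(2,3) by blast
qed

lemma tensor_zero: "\<zero>\<^bsub>T\<^esub> = cls 0"
  by (simp add: tensor_def)

lemma tensor_add: "cls r \<oplus>\<^bsub>T\<^esub> cls s = cls (r + s)"
proof -
  have "{a + b | a b. a \<in> cls r \<and> b \<in> cls s} = cls (r + s)"
  proof (intro equalityI subsetI)
    fix x assume "x \<in> {a + b | a b. a \<in> cls r \<and> b \<in> cls s}"
    then obtain m n where "x = (r + m) + (s + n)" "m \<in> N" "n \<in> N"
      by (auto simp: tensor_class_def)
    then show "x \<in> cls (r + s)"
      by (auto simp: tensor_class_def N_simps(2) algebra_simps intro!: exI[of _ "m + n"])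
  next
    fix x assume "x \<in> cls (r + s)"
    then obtain n where "x = (r + 0) + (s + n)" "n \<in> N"
      by (auto simp: tensor_class_def algebra_simps)
    then show "x \<in> {a + b | a b. a \<in> cls r \<and> b \<in> cls s}"
      unfolding tensor_class_def using N_simps(1) by blast
  qed
  then show ?thesis
    by (simp add: tensor_def)
qed

lemma tensor_smult: "c \<odot>\<^bsub>T\<^esub> cls r = cls (fscale c r)"
proof -
  have "{fscale c a + n | a n. a \<in> cls r \<and> n \<in> N} = cls (fscale c r)"
  proof (intro equalityI subsetI)
    fix x assume "x \<in> {fscale c a + n | a n. a \<in> cls r \<and> n \<in> N}"
    then obtain m n where "x = fscale c (r + m) + n" "m \<in> N" "n \<in> N"
      by (auto simp: tensor_class_def)
    then show "x \<in> cls (fscale c r)"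
      by (auto simp: tensor_class_def N_simps fscale.scale_right_distrib add.assoc
          intro!: exI[of _ "fscale c m + n"])
  next
    fix x assume "x \<in> cls (fscale c r)"
    then obtain n where "x = fscale c (r + 0) + n" "n \<in> N"
      by (auto simp: tensor_class_def)
    then show "x \<in> {fscale c a + n | a n. a \<in> cls r \<and> n \<in> N}"
      unfolding tensor_class_def using N_simps(1) by blast
  qed
  then show ?thesis
    by (simp add: tensor_def)
qed

lemma tensor_carrier:
  "t \<in> carrier T \<longleftrightarrow> (\<exists>r. t = cls r \<and> Poly_Mapping.keys r \<subseteq> carrier V \<times> carrier W)"
  by (auto simp: tensor_def)

lemma vector_sp_tensor: "vector_sp T"
proof (rule vector_spI)
  show "x \<oplus>\<^bsub>T\<^esub> y \<in> carrier T" if xy: "x \<in> carrier T" "y \<in> carrier T" for x y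
  proof -
    obtain r s where "x = cls r" "Poly_Mapping.keys r \<subseteq> carrier V \<times> carrier W"
      "y = cls s" "Poly_Mapping.keys s \<subseteq> carrier V \<times> carrier W"
      using xy by (auto simp: tensor_carrier)
    then show ?thesis
      using keys_add[of r s] by (auto simp: tensor_carrier tensor_add intro!: exI[of _ "r + s"])
  qed
  show "c \<odot>\<^bsub>T\<^esub> x \<in> carrier T" if x: "x \<in> carrier T" for c x
  proof -
    obtain r where "x = cls r" "Poly_Mapping.keys r \<subseteq> carrier V \<times> carrier W"
      using x by (auto simp: tensor_carrier)
    then show ?thesis
      using keys_fscale[of c r] by (auto simp: tensor_carrier tensor_smult intro!: exI[of _ "fscale c r"])
  qed
  show "\<zero>\<^bsub>T\<^esub> \<in> carrier T"
    by (auto simp: tensor_carrier tensor_zero intro!: exI[of _ 0])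
qed (auto simp: tensor_carrier tensor_add tensor_smult tensor_zero ac_simps
    fscale.scale_left_distrib fscale.scale_right_distrib)

sublocale T: kspace T
  by (rule kspace.intro) (rule vector_sp_tensor)

lemma pure_mem [simp, intro]: "v \<in> carrier V \<Longrightarrow> w \<in> carrier W \<Longrightarrow> pure v w \<in> carrier T"
  by (auto simp: tensor_carrier pure_tensor_def)

lemma pure_add_left:
  assumes "v \<in> carrier V" "v' \<in> carrier V" "w \<in> carrier W"
  shows "pure (v \<oplus>\<^bsub>V\<^esub> v') w = pure v w \<oplus>\<^bsub>T\<^esub> pure v' w"
  unfolding pure_tensor_def tensor_add class_eq_iff diff_diff_eq[symmetric]
  using assms unfolding tensor_relations_def by (intro fscale.span_base) blast

lemma pure_add_right:
  assumes "v \<in> carrier V" "w \<in> carrier W" "w' \<in> carrier W"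
  shows "pure v (w \<oplus>\<^bsub>W\<^esub> w') = pure v w \<oplus>\<^bsub>T\<^esub> pure v w'"
  unfolding pure_tensor_def tensor_add class_eq_iff diff_diff_eq[symmetric]
  using assms unfolding tensor_relations_def by (intro fscale.span_base) blast

lemma pure_smult_left:
  assumes "v \<in> carrier V" "w \<in> carrier W"
  shows "pure (c \<odot>\<^bsub>V\<^esub> v) w = c \<odot>\<^bsub>T\<^esub> pure v w"
  unfolding pure_tensor_def tensor_smult class_eq_iff
  using assms unfolding tensor_relations_def by (intro fscale.span_base) blast

lemma pure_smult_right:
  assumes "v \<in> carrier V" "w \<in> carrier W"
  shows "pure v (c \<odot>\<^bsub>W\<^esub> w) = c \<odot>\<^bsub>T\<^esub> pure v w"
  unfolding pure_tensor_def tensor_smult class_eq_iff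
  using assms unfolding tensor_relations_def by (intro fscale.span_base) blast

lemma pure_zero_left: "w \<in> carrier W \<Longrightarrow> pure \<zero>\<^bsub>V\<^esub> w = \<zero>\<^bsub>T\<^esub>"
  using pure_smult_left[OF V.zero_closed, of w 0] by simp

lemma pure_zero_right: "v \<in> carrier V \<Longrightarrow> pure v \<zero>\<^bsub>W\<^esub> = \<zero>\<^bsub>T\<^esub>"
  using pure_smult_right[OF _ W.zero_closed, of v 0] by simp

text \<open>A list records the number of terms of a representation, which is the induction measure
  in \<open>tsum_eq_zero\<close>.\<close>

definition tsum :: "('a \<times> 'b) list \<Rightarrow> ('a \<times> 'b \<Rightarrow>\<^sub>0 'k) set" where
  "tsum xs = foldr (\<lambda>(v, w) t. pure v w \<oplus>\<^bsub>T\<^esub> t) xs \<zero>\<^bsub>T\<^esub>"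

lemma tsum_simps [simp]:
  "tsum [] = \<zero>\<^bsub>T\<^esub>" "tsum ((v, w) # xs) = pure v w \<oplus>\<^bsub>T\<^esub> tsum xs"
  by (simp_all add: tsum_def)

lemma tsum_mem [simp, intro]: "set xs \<subseteq> carrier V \<times> carrier W \<Longrightarrow> tsum xs \<in> carrier T"
  by (induction xs) auto

text \<open>Coefficients are absorbed into the left factors, so plain sums of pure tensors exhaust
  the tensor product.\<close>

lemma tensor_eq_tsum:
  assumes "t \<in> carrier T"
  obtains xs where "set xs \<subseteq> carrier V \<times> carrier W" "t = tsum xs"
proof -
  have "\<exists>xs. set xs \<subseteq> carrier V \<times> carrier W \<and> cls r = tsum xs"
    if "Poly_Mapping.keys r \<subseteq> carrier V \<times> carrier W" for r
    using that
  proof (induction r rule: Poly_Mapping.update_induct)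
    case const
    show ?case
      by (rule exI[of _ "[]"]) (simp add: tensor_zero)
  next
    case (update f k c)
    have "Poly_Mapping.update k c f = fscale c (Poly_Mapping.single k 1) + f"
      using update(1)
      by (intro poly_mapping_eqI) (auto simp: lookup_update lookup_add lookup_single in_keys_iff when_def)
    moreover obtain v w where k: "k = (v, w)" "v \<in> carrier V" "w \<in> carrier W"
      using update by (cases k) (auto simp: keys_update)
    ultimately have "cls (Poly_Mapping.update k c f) = pure (c \<odot>\<^bsub>V\<^esub> v) w \<oplus>\<^bsub>T\<^esub> cls f"
      by (simp only: pure_smult_left) (simp add: pure_tensor_def tensor_smult tensor_add)
    moreover obtain xs where "set xs \<subseteq> carrier V \<times> carrier W" "cls f = tsum xs"
      using update by (auto simp: keys_update)
    ultimately show ?case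
      using k by (intro exI[of _ "(c \<odot>\<^bsub>V\<^esub> v, w) # xs"]) auto
  qed
  then show thesis
    using assms that by (auto simp: tensor_carrier)
qed

lemma linear_tsum:
  assumes l: "l \<in> linear_maps T ground" and xs: "set xs \<subseteq> carrier V \<times> carrier W"
  shows "l (tsum xs) = (\<Sum>(v, w)\<leftarrow>xs. l (pure v w))"
  using xs
proof (induction xs)
  case Nil
  show ?case
    using linear_mapsD(4)[OF l T.zero_closed, of 0] by simp
next
  case (Cons x xs)
  then show ?case
    by (cases x) (simp add: linear_mapsD(3)[OF l])
qed

context
  fixes b :: "'a \<Rightarrow> 'b \<Rightarrow> 'k"
  assumes b: "bilinear_form V W b"
begin

lemma free_lift_relation: "n \<in> N \<Longrightarrow> free_lift (\<lambda>(v, w). b v w) n = 0"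
  unfolding tensor_relations_def
proof (induction rule: fscale.span_induct_alt)
  case base
  show ?case by (simp add: free_lift_def)
next
  case (step c x y)
  then show ?case
    using b by (auto simp: bilinear_form_def free_lift_add free_lift_scale free_lift_diff)
qed

text \<open>The linear extension of \<open>b\<close> to the free vector space kills all bilinearity
  relations, so its value on a coset is independent of the representative picked by choice.\<close>

lemma tensor_lift_exists:
  "\<exists>l. l \<in> linear_maps T ground \<and> (\<forall>v\<in>carrier V. \<forall>w\<in>carrier W. l (pure v w) = b v w)"
proof -
  let ?f = "free_lift (\<lambda>(v, w). b v w)"
  define l where "l = (\<lambda>t\<in>carrier T. ?f (SOME r. t = cls r))"
  have l: "l (cls r) = ?f r" if "cls r \<in> carrier T" for r
  proof -
    have "cls r = cls (SOME s. cls r = cls s)"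
      by (rule someI) simp
    then have "?f (r - (SOME s. cls r = cls s)) = 0"
      by (intro free_lift_relation) (simp only: class_eq_iff[symmetric])
    then show ?thesis
      using that by (simp add: l_def free_lift_diff)
  qed
  have "l \<in> linear_maps T ground"
  proof (rule linear_mapsI)
    show "l \<in> extensional (carrier T)"
      by (simp add: l_def)
    fix x y assume xy: "x \<in> carrier T" "y \<in> carrier T"
    then obtain r s where rs: "x = cls r" "y = cls s"
      by (auto simp: tensor_carrier)
    have "cls (r + s) \<in> carrier T"
      using T.a_closed[OF xy] by (simp add: rs tensor_add)
    then show "l (x \<oplus>\<^bsub>T\<^esub> y) = l x \<oplus>\<^bsub>ground\<^esub> l y"
      using xy by (simp add: rs l tensor_add free_lift_add)
  next
    fix c x assume x: "x \<in> carrier T"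
    then obtain r where r: "x = cls r"
      by (auto simp: tensor_carrier)
    have "cls (fscale c r) \<in> carrier T"
      using T.smult_mem[OF x] by (simp add: r tensor_smult)
    then show "l (c \<odot>\<^bsub>T\<^esub> x) = c \<odot>\<^bsub>ground\<^esub> l x"
      using x by (simp add: r l tensor_smult free_lift_scale)
  qed simp
  moreover have "l (pure v w) = b v w" if "v \<in> carrier V" "w \<in> carrier W" for v w
    using pure_mem[OF that] l by (simp add: pure_tensor_def)
  ultimately show ?thesis
    by blast
qed

lemma tensor_lift:
  "tensor_lift V W b \<in> linear_maps T ground"
  "v \<in> carrier V \<Longrightarrow> w \<in> carrier W \<Longrightarrow> tensor_lift V W b (pure v w) = b v w"
proof -
  let ?P = "\<lambda>l. l \<in> linear_maps T ground \<and> (\<forall>v\<in>carrier V. \<forall>w\<in>carrier W. l (pure v w) = b v w)"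
  have "\<exists>!l. ?P l"
  proof (rule ex_ex1I[OF tensor_lift_exists])
    fix l l' assume l: "?P l" and l': "?P l'"
    show "l = l'"
    proof (rule linear_maps_eqI)
      fix t assume "t \<in> carrier T"
      then obtain xs where xs: "set xs \<subseteq> carrier V \<times> carrier W" "t = tsum xs"
        by (rule tensor_eq_tsum)
      have "(\<Sum>(v, w)\<leftarrow>xs. l (pure v w)) = (\<Sum>(v, w)\<leftarrow>xs. l' (pure v w))"
        using l l' xs(1) by (intro arg_cong[where f = sum_list] map_cong) auto
      then show "l t = l' t"
        using l l' xs by (simp add: linear_tsum)
    qed (use l l' in auto)
  qed
  from theI'[OF this] have "?P (tensor_lift V W b)"
    unfolding tensor_lift_def .
  then show "tensor_lift V W b \<in> linear_maps T ground"
    "v \<in> carrier V \<Longrightarrow> w \<in> carrier W \<Longrightarrow> tensor_lift V W b (pure v w) = b v w"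
    by auto
qed

lemma tensor_lift_tsum:
  assumes "set xs \<subseteq> carrier V \<times> carrier W"
  shows "tensor_lift V W b (tsum xs) = (\<Sum>(v, w)\<leftarrow>xs. b v w)"
proof -
  have "(\<Sum>(v, w)\<leftarrow>xs. tensor_lift V W b (pure v w)) = (\<Sum>(v, w)\<leftarrow>xs. b v w)"
    using assms tensor_lift(2) by (intro arg_cong[where f = sum_list] map_cong) auto
  then show ?thesis
    using linear_tsum[OF tensor_lift(1) assms] by simp
qed

end

text \<open>The combination of left factors that collects in front of \<open>w'\<close> when every
  right factor \<open>w\<close> is shifted by \<open>c w\<close> times \<open>w'\<close>. It is used
  with \<open>c\<close> the pairing with a fixed vector.\<close>

definition weighted_sum :: "('b \<Rightarrow> 'k) \<Rightarrow> ('a \<times> 'b) list \<Rightarrow> 'a" where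
  "weighted_sum c xs = foldr (\<lambda>(v, w) s. c w \<odot>\<^bsub>V\<^esub> v \<oplus>\<^bsub>V\<^esub> s) xs \<zero>\<^bsub>V\<^esub>"

lemma weighted_sum_simps [simp]:
  "weighted_sum c [] = \<zero>\<^bsub>V\<^esub>"
  "weighted_sum c ((v, w) # xs) = c w \<odot>\<^bsub>V\<^esub> v \<oplus>\<^bsub>V\<^esub> weighted_sum c xs"
  by (simp_all add: weighted_sum_def)

lemma weighted_sum_mem [simp, intro]:
  "set xs \<subseteq> carrier V \<times> carrier W \<Longrightarrow> weighted_sum c xs \<in> carrier V"
  by (induction xs) auto

lemma pure_minus_right:
  assumes "v \<in> carrier V" "w \<in> carrier W" "w' \<in> carrier W"
  shows "pure v (w \<ominus>\<^bsub>W\<^esub> c \<odot>\<^bsub>W\<^esub> w') = pure v w \<ominus>\<^bsub>T\<^esub> pure (c \<odot>\<^bsub>V\<^esub> v) w'"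
proof -
  have "pure v (\<ominus>\<^bsub>W\<^esub> (c \<odot>\<^bsub>W\<^esub> w')) = (-1) \<odot>\<^bsub>T\<^esub> (c \<odot>\<^bsub>T\<^esub> pure v w')"
    using assms by (simp add: W.smult_minus_1[symmetric] pure_smult_right)
  then show ?thesis
    using assms by (simp add: a_minus_def pure_add_right pure_smult_left T.smult_minus_1)
qed

text \<open>Bilinearity moves the scalar \<open>c w\<close> from the right to the left factor of
  each correction term; all corrections then share the right factor \<open>w'\<close> and merge into
  one pure tensor.\<close>

lemma tsum_shift:
  assumes "set xs \<subseteq> carrier V \<times> carrier W" "w' \<in> carrier W"
  shows "tsum (map (\<lambda>(v, w). (v, w \<ominus>\<^bsub>W\<^esub> c w \<odot>\<^bsub>W\<^esub> w')) xs) = tsum xs \<ominus>\<^bsub>T\<^esub> pure (weighted_sum c xs) w'"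
  using assms(1)
proof (induction xs)
  case Nil
  then show ?case
    using assms(2) by (simp add: pure_zero_left)
next
  case (Cons x xs)
  obtain v w where x: "x = (v, w)" "v \<in> carrier V" "w \<in> carrier W"
    using Cons.prems by (cases x) auto
  then show ?case
    using Cons assms(2) by (simp add: pure_minus_right pure_add_left T.add_minus_add)
qed

end

section \<open>The internal hom\<close>

lemma chu_hom_space_simps [simp]:
  "carrier (chu_hom_space P Q) = chu_hom P Q"
  "\<zero>\<^bsub>chu_hom_space P Q\<^esub> = (\<lambda>x\<in>carrier (lspace P). \<zero>\<^bsub>lspace Q\<^esub>, \<lambda>y\<in>carrier (rspace Q). \<zero>\<^bsub>rspace P\<^esub>)"
  "(f, g) \<oplus>\<^bsub>chu_hom_space P Q\<^esub> (f', g') =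
    (\<lambda>x\<in>carrier (lspace P). f x \<oplus>\<^bsub>lspace Q\<^esub> f' x, \<lambda>y\<in>carrier (rspace Q). g y \<oplus>\<^bsub>rspace P\<^esub> g' y)"
  "c \<odot>\<^bsub>chu_hom_space P Q\<^esub> (f, g) =
    (\<lambda>x\<in>carrier (lspace P). c \<odot>\<^bsub>lspace Q\<^esub> f x, \<lambda>y\<in>carrier (rspace Q). c \<odot>\<^bsub>rspace P\<^esub> g y)"
  by (simp_all add: chu_hom_space_def Let_def)

lemma vector_sp_linear_maps:
  assumes "vector_sp V" "vector_sp W"
  shows "vector_sp (map_space (linear_maps V W) V W)"
  using assms linear_maps_closed[OF assms]
  by (intro vector_sp_map_space) (auto simp: linear_maps_def)

lemma chu_homD:
  assumes "(f, g) \<in> chu_hom P Q"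
  shows "f \<in> linear_maps (lspace P) (lspace Q)" "g \<in> linear_maps (rspace Q) (rspace P)"
    "v \<in> carrier (lspace P) \<Longrightarrow> w \<in> carrier (rspace Q) \<Longrightarrow> pairing Q (f v) w = pairing P v (g w)"
  using assms by (auto simp: chu_hom_def)

locale chu_pairs = P: chu_pair P + Q: chu_pair Q
  for P :: "('k::real_or_complex, 'a, 'b) chu" and Q :: "('k, 'c, 'd) chu"
begin

sublocale tensor_pair "lspace P" "rspace Q" ..

text \<open>The operations are componentwise in two spaces of linear maps, from which the axioms are
  inherited. What remains is closure: adjointness of the two components survives sums and
  multiples.\<close>

lemma vector_sp_chu_hom_space: "vector_sp (chu_hom_space P Q)"
proof -
  let ?F = "map_space (linear_maps (lspace P) (lspace Q)) (lspace P) (lspace Q)"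
  let ?G = "map_space (linear_maps (rspace Q) (rspace P)) (rspace Q) (rspace P)"
  interpret F: kspace ?F
    by (rule kspace.intro) (rule vector_sp_linear_maps[OF P.l.vector_sp Q.l.vector_sp])
  interpret G: kspace ?G
    by (rule kspace.intro) (rule vector_sp_linear_maps[OF Q.r.vector_sp P.r.vector_sp])
  have H: "z \<oplus>\<^bsub>chu_hom_space P Q\<^esub> z' = (fst z \<oplus>\<^bsub>?F\<^esub> fst z', snd z \<oplus>\<^bsub>?G\<^esub> snd z')"
    "c \<odot>\<^bsub>chu_hom_space P Q\<^esub> z = (c \<odot>\<^bsub>?F\<^esub> fst z, c \<odot>\<^bsub>?G\<^esub> snd z)"
    "\<zero>\<^bsub>chu_hom_space P Q\<^esub> = (\<zero>\<^bsub>?F\<^esub>, \<zero>\<^bsub>?G\<^esub>)" for z z' c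
    by (cases z; cases z'; simp)+
  have mem: "fst z \<in> carrier ?F" "snd z \<in> carrier ?G" if "z \<in> chu_hom P Q" for z
    using that by (auto simp: chu_hom_def)
  have homI: "(f, g) \<in> chu_hom P Q" if "f \<in> carrier ?F" "g \<in> carrier ?G"
    "\<And>v w. v \<in> carrier (lspace P) \<Longrightarrow> w \<in> carrier (rspace Q) \<Longrightarrow> pairing Q (f v) w = pairing P v (g w)"
    for f g
    using that by (simp add: chu_hom_def)
  show ?thesis
  proof (rule vector_spI)
    fix z z' c assume z: "z \<in> carrier (chu_hom_space P Q)"
    then have fg: "(fst z, snd z) \<in> chu_hom P Q"
      by simp
    note m = linear_mapsD(1)[OF chu_homD(1)[OF fg]] linear_mapsD(1)[OF chu_homD(2)[OF fg]]
    have "(c \<odot>\<^bsub>?F\<^esub> fst z, c \<odot>\<^bsub>?G\<^esub> snd z) \<in> chu_hom P Q"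
    proof (rule homI)
      show "c \<odot>\<^bsub>?F\<^esub> fst z \<in> carrier ?F" "c \<odot>\<^bsub>?G\<^esub> snd z \<in> carrier ?G"
        using mem z by (auto simp del: map_space_simps)
    qed (simp add: m P.pairing_right Q.pairing_left chu_homD(3)[OF fg])
    then show "c \<odot>\<^bsub>chu_hom_space P Q\<^esub> z \<in> carrier (chu_hom_space P Q)"
      unfolding H by simp
    assume z': "z' \<in> carrier (chu_hom_space P Q)"
    then have fg': "(fst z', snd z') \<in> chu_hom P Q"
      by simp
    note m' = linear_mapsD(1)[OF chu_homD(1)[OF fg']] linear_mapsD(1)[OF chu_homD(2)[OF fg']]
    have "(fst z \<oplus>\<^bsub>?F\<^esub> fst z', snd z \<oplus>\<^bsub>?G\<^esub> snd z') \<in> chu_hom P Q"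
    proof (rule homI)
      show "fst z \<oplus>\<^bsub>?F\<^esub> fst z' \<in> carrier ?F" "snd z \<oplus>\<^bsub>?G\<^esub> snd z' \<in> carrier ?G"
        using mem z z' by (auto simp del: map_space_simps)
    qed (simp add: m m' P.pairing_right Q.pairing_left chu_homD(3)[OF fg] chu_homD(3)[OF fg'])
    then show "z \<oplus>\<^bsub>chu_hom_space P Q\<^esub> z' \<in> carrier (chu_hom_space P Q)"
      unfolding H by simp
  next
    have "(\<zero>\<^bsub>?F\<^esub>, \<zero>\<^bsub>?G\<^esub>) \<in> chu_hom P Q"
    proof (rule homI)
      show "\<zero>\<^bsub>?F\<^esub> \<in> carrier ?F" "\<zero>\<^bsub>?G\<^esub> \<in> carrier ?G"
        by (rule F.zero_closed G.zero_closed)+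
    qed (simp add: P.pairing_right(3) Q.pairing_left(3))
    then show "\<zero>\<^bsub>chu_hom_space P Q\<^esub> \<in> carrier (chu_hom_space P Q)"
      unfolding H by simp
  qed (simp_all add: H mem F.a_ac G.a_ac
      F.smult_add_left G.smult_add_left F.smult_add_right G.smult_add_right
      F.smult_smult G.smult_smult del: map_space_simps chu_hom_space_simps(2-4))
qed

lemma bilinear_form_hom:
  assumes "(f, g) \<in> chu_hom P Q"
  shows "bilinear_form (lspace P) (rspace Q) (\<lambda>v w. pairing Q (f v) w)"
  using linear_mapsD[OF chu_homD(1)[OF assms]]
  by (auto simp: bilinear_form_def Q.pairing_left Q.pairing_right)

lemma bilinear_form_rank_one:
  assumes "\<phi> \<in> carrier (rspace P)" "x \<in> carrier (lspace Q)"
  shows "bilinear_form (lspace P) (rspace Q) (\<lambda>v w. pairing P v \<phi> * pairing Q x w)"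
  using assms by (auto simp: bilinear_form_def P.pairing_left Q.pairing_right algebra_simps)

lemma pairing_weighted_sum:
  assumes "set xs \<subseteq> carrier (lspace P) \<times> carrier (rspace Q)" "\<phi> \<in> carrier (rspace P)"
  shows "pairing P (weighted_sum c xs) \<phi> = (\<Sum>(v, w)\<leftarrow>xs. pairing P v \<phi> * c w)"
  using assms(1)
proof (induction xs)
  case (Cons x xs)
  then show ?case
    using assms(2) by (cases x) (simp add: P.pairing_left)
qed (simp add: P.pairing_left assms)

text \<open>
  Induction on the number of pure tensors: if some \<open>x\<close> has \<open>\<langle>x, w\<rangle> = 1\<close>, then \<open>v\<close> is a
  combination of the other left factors, so \<open>v \<otimes> w\<close> can be absorbed into the other terms.
\<close>

lemma tsum_eq_zero:
  assumes "set xs \<subseteq> carrier (lspace P) \<times> carrier (rspace Q)"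
    and "\<And>\<phi> x. \<phi> \<in> carrier (rspace P) \<Longrightarrow> x \<in> carrier (lspace Q) \<Longrightarrow>
      (\<Sum>(v, w)\<leftarrow>xs. pairing P v \<phi> * pairing Q x w) = 0"
  shows "tsum xs = \<zero>\<^bsub>T\<^esub>"
  using assms
proof (induction xs rule: length_induct)
  case (1 xs)
  note IH = 1(1) and xs = 1(2) and null = 1(3)
  show ?case
  proof (cases xs)
    case (Cons y ys)
    obtain v w where y: "y = (v, w)" and v: "v \<in> carrier (lspace P)" and w: "w \<in> carrier (rspace Q)"
      and ys: "set ys \<subseteq> carrier (lspace P) \<times> carrier (rspace Q)"
      using xs Cons by (cases y) auto
    show ?thesis
    proof (cases "\<exists>x\<in>carrier (lspace Q). pairing Q x w \<noteq> 0")
      case False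
      \<comment> \<open>Nondegeneracy gives \<open>w = 0\<close>, so the first term vanishes and the
        shorter list inherits the hypothesis.\<close>
      then have w0: "w = \<zero>\<^bsub>rspace Q\<^esub>"
        using w by (intro Q.nondegenerate_right) auto
      have "tsum ys = \<zero>\<^bsub>T\<^esub>"
      proof (rule IH[rule_format])
        show "(\<Sum>(v, w)\<leftarrow>ys. pairing P v \<phi> * pairing Q x w) = 0"
          if "\<phi> \<in> carrier (rspace P)" "x \<in> carrier (lspace Q)" for \<phi> x
          using null[OF that] False that by (simp add: Cons y)
      qed (use ys Cons in auto)
      then show ?thesis
        using v by (simp add: Cons y w0 pure_zero_right)
    next
      case True
      then obtain x0 where x0: "x0 \<in> carrier (lspace Q)" "pairing Q x0 w \<noteq> 0"
        by blast
      \<comment> \<open>Rescaled so that the pairing with \<open>w\<close> is 1, which isolates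
        \<open>v\<close> with coefficient 1 in the hypothesis.\<close>
      define x where "x = (1 / pairing Q x0 w) \<odot>\<^bsub>lspace Q\<^esub> x0"
      have x: "x \<in> carrier (lspace Q)" "pairing Q x w = 1"
        using x0 w by (simp_all add: x_def Q.pairing_left)
      define c where "c = pairing Q x"
      \<comment> \<open>The hypothesis for this fixed \<open>x\<close> and all \<open>\<phi>\<close>
        says that every \<open>\<phi>\<close> annihilates this combination.\<close>
      have "v \<oplus>\<^bsub>lspace P\<^esub> weighted_sum c ys = \<zero>\<^bsub>lspace P\<^esub>"
      proof (rule P.nondegenerate_left)
        fix \<phi> assume \<phi>: "\<phi> \<in> carrier (rspace P)"
        show "pairing P (v \<oplus>\<^bsub>lspace P\<^esub> weighted_sum c ys) \<phi> = 0"
          using null[OF \<phi> x(1)] v ys \<phi> x(2)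
          by (simp add: P.pairing_left pairing_weighted_sum Cons y c_def)
      qed (use v ys in auto)
      then have v_eq: "weighted_sum c ys = \<ominus>\<^bsub>lspace P\<^esub> v"
        using v ys by (metis P.l.a_comm P.l.minus_equality weighted_sum_mem)
      define ys' where "ys' = map (\<lambda>(v', w'). (v', w' \<ominus>\<^bsub>rspace Q\<^esub> c w' \<odot>\<^bsub>rspace Q\<^esub> w)) ys"
      have ys': "set ys' \<subseteq> carrier (lspace P) \<times> carrier (rspace Q)"
        using ys w by (auto simp: ys'_def)
      have "pure (\<ominus>\<^bsub>lspace P\<^esub> v) w = \<ominus>\<^bsub>T\<^esub> pure v w"
        using pure_smult_left[OF v w, of "-1"] v w by (simp add: P.l.smult_minus_1 T.smult_minus_1)
      \<comment> \<open>Shifting subtracts the pure tensor of \<open>weighted_sum c ys\<close> and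
        \<open>w\<close>. As that sum is the negative of \<open>v\<close>, this adds back the
        missing term: the same tensor with one summand fewer.\<close>
      then have "tsum ys' = tsum xs"
        using tsum_shift[OF ys w, of c] v w ys
        by (simp add: ys'_def v_eq Cons y a_minus_def T.a_comm)
      moreover have "tsum ys' = \<zero>\<^bsub>T\<^esub>"
      proof (rule IH[rule_format])
        show "length ys' < length xs"
          by (simp add: ys'_def Cons)
        fix \<phi> z assume \<phi>z: "\<phi> \<in> carrier (rspace P)" "z \<in> carrier (lspace Q)"
        \<comment> \<open>These sums are values of a functional on the tensor product, so they agree
          for two lists that represent the same tensor.\<close>
        show "(\<Sum>(v, w)\<leftarrow>ys'. pairing P v \<phi> * pairing Q z w) = 0"
          using tensor_lift_tsum[OF bilinear_form_rank_one[OF \<phi>z] ys']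
            tensor_lift_tsum[OF bilinear_form_rank_one[OF \<phi>z] xs] null[OF \<phi>z] calculation
          by simp
      qed (rule ys')
      ultimately show ?thesis
        by simp
    qed
  qed simp
qed

lemma internal_hom_simps [simp]:
  "lspace (chu_internal_hom P Q) = chu_hom_space P Q"
  "rspace (chu_internal_hom P Q) = T"
  "pairing (chu_internal_hom P Q) (f, g) = tensor_lift (lspace P) (rspace Q) (\<lambda>v w. pairing Q (f v) w)"
  by (simp_all add: chu_internal_hom_def)

text \<open>The supply of morphisms that detects tensors: pairing against them reproduces the
  products occurring in \<open>tsum_eq_zero\<close>.\<close>

lemma rank_one_hom:
  assumes \<phi>: "\<phi> \<in> carrier (rspace P)" and x: "x \<in> carrier (lspace Q)"
  shows "(\<lambda>v\<in>carrier (lspace P). pairing P v \<phi> \<odot>\<^bsub>lspace Q\<^esub> x,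
    \<lambda>w\<in>carrier (rspace Q). pairing Q x w \<odot>\<^bsub>rspace P\<^esub> \<phi>) \<in> chu_hom P Q"
proof -
  have "(\<lambda>v\<in>carrier (lspace P). pairing P v \<phi> \<odot>\<^bsub>lspace Q\<^esub> x) \<in> linear_maps (lspace P) (lspace Q)"
    using assms by (intro linear_mapsI) (auto simp: P.pairing_left Q.l.smult_add_left Q.l.smult_smult)
  moreover have "(\<lambda>w\<in>carrier (rspace Q). pairing Q x w \<odot>\<^bsub>rspace P\<^esub> \<phi>) \<in> linear_maps (rspace Q) (rspace P)"
    using assms by (intro linear_mapsI) (auto simp: Q.pairing_right P.r.smult_add_left P.r.smult_smult)
  ultimately show ?thesis
    using assms by (simp add: chu_hom_def Q.pairing_left P.pairing_right)
qed

lemma pairing_tsum: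
  assumes "(f, g) \<in> chu_hom P Q" "set xs \<subseteq> carrier (lspace P) \<times> carrier (rspace Q)"
  shows "pairing (chu_internal_hom P Q) (f, g) (tsum xs) = (\<Sum>(v, w)\<leftarrow>xs. pairing Q (f v) w)"
  unfolding internal_hom_simps by (rule tensor_lift_tsum[OF bilinear_form_hom[OF assms(1)] assms(2)])

text \<open>If a morphism pairs to zero with all pure tensors, its first component vanishes by
  nondegeneracy of \<open>Q\<close>, and its second by adjointness and nondegeneracy of
  \<open>P\<close>. A tensor annihilated by all morphisms is annihilated by those of rank one and
  vanishes by \<open>tsum_eq_zero\<close>.\<close>

theorem is_chu_internal_hom: "is_chu (chu_internal_hom P Q)"
proof (rule is_chuI; unfold internal_hom_simps)
  show "vector_sp (chu_hom_space P Q)" by (rule vector_sp_chu_hom_space)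
  show "vector_sp T" by (rule vector_sp_tensor)
next
  fix z z' t assume z: "z \<in> carrier (chu_hom_space P Q)" and z': "z' \<in> carrier (chu_hom_space P Q)"
    and t: "t \<in> carrier T"
  interpret H: kspace "chu_hom_space P Q"
    by (rule kspace.intro) (rule vector_sp_chu_hom_space)
  obtain f g f' g' where fg: "z = (f, g)" "z' = (f', g')"
    by (cases z, cases z')
  obtain xs where xs: "set xs \<subseteq> carrier (lspace P) \<times> carrier (rspace Q)" "t = tsum xs"
    using t by (rule tensor_eq_tsum)
  have hom: "(f, g) \<in> chu_hom P Q" "(f', g') \<in> chu_hom P Q"
    using z z' by (simp_all add: fg)
  have sum: "(f, g) \<oplus>\<^bsub>chu_hom_space P Q\<^esub> (f', g') \<in> chu_hom P Q"
    using H.a_closed[OF z z'] by (simp only: fg chu_hom_space_simps(1))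
  \<comment> \<open>The lift is known to be linear in the tensor; additivity in the morphism is
    verified on a representation by pure tensors.\<close>
  have "(\<Sum>(v, w)\<leftarrow>xs. pairing Q ((\<lambda>x\<in>carrier (lspace P). f x \<oplus>\<^bsub>lspace Q\<^esub> f' x) v) w) =
      (\<Sum>(v, w)\<leftarrow>xs. pairing Q (f v) w) + (\<Sum>(v, w)\<leftarrow>xs. pairing Q (f' v) w)"
    using xs(1)
  proof (induction xs)
    case (Cons a xs)
    then show ?case
      using linear_mapsD(1)[OF chu_homD(1)[OF hom(1)]] linear_mapsD(1)[OF chu_homD(1)[OF hom(2)]]
      by (cases a) (simp add: Q.pairing_left)
  qed simp
  then show "pairing (chu_internal_hom P Q) (z \<oplus>\<^bsub>chu_hom_space P Q\<^esub> z') t =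
      pairing (chu_internal_hom P Q) z t + pairing (chu_internal_hom P Q) z' t"
    using pairing_tsum[OF _ xs(1)] sum hom by (simp only: fg xs(2) chu_hom_space_simps)
next
  fix c z t assume z: "z \<in> carrier (chu_hom_space P Q)" and t: "t \<in> carrier T"
  interpret H: kspace "chu_hom_space P Q"
    by (rule kspace.intro) (rule vector_sp_chu_hom_space)
  obtain f g where fg: "z = (f, g)"
    by (cases z)
  obtain xs where xs: "set xs \<subseteq> carrier (lspace P) \<times> carrier (rspace Q)" "t = tsum xs"
    using t by (rule tensor_eq_tsum)
  have hom: "(f, g) \<in> chu_hom P Q"
    using z by (simp add: fg)
  have scaled: "c \<odot>\<^bsub>chu_hom_space P Q\<^esub> (f, g) \<in> chu_hom P Q"
    using H.smult_mem[OF z] by (simp only: fg chu_hom_space_simps(1))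
  have "(\<Sum>(v, w)\<leftarrow>xs. pairing Q ((\<lambda>x\<in>carrier (lspace P). c \<odot>\<^bsub>lspace Q\<^esub> f x) v) w) =
      c * (\<Sum>(v, w)\<leftarrow>xs. pairing Q (f v) w)"
    using xs(1)
  proof (induction xs)
    case (Cons a xs)
    then show ?case
      using linear_mapsD(1)[OF chu_homD(1)[OF hom]]
      by (cases a) (simp add: Q.pairing_left distrib_left)
  qed simp
  then show "pairing (chu_internal_hom P Q) (c \<odot>\<^bsub>chu_hom_space P Q\<^esub> z) t =
      c * pairing (chu_internal_hom P Q) z t"
    using pairing_tsum[OF _ xs(1)] scaled hom by (simp only: fg xs(2) chu_hom_space_simps)
next
  fix z t t' assume z: "z \<in> carrier (chu_hom_space P Q)" and t: "t \<in> carrier T" "t' \<in> carrier T"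
  obtain f g where fg: "z = (f, g)" "(f, g) \<in> chu_hom P Q"
    using z by (cases z) auto
  show "pairing (chu_internal_hom P Q) z (t \<oplus>\<^bsub>T\<^esub> t') =
      pairing (chu_internal_hom P Q) z t + pairing (chu_internal_hom P Q) z t'"
    using linear_mapsD(3)[OF tensor_lift(1)[OF bilinear_form_hom[OF fg(2)]] t] by (simp add: fg)
next
  fix c z t assume z: "z \<in> carrier (chu_hom_space P Q)" and t: "t \<in> carrier T"
  obtain f g where fg: "z = (f, g)" "(f, g) \<in> chu_hom P Q"
    using z by (cases z) auto
  show "pairing (chu_internal_hom P Q) z (c \<odot>\<^bsub>T\<^esub> t) = c * pairing (chu_internal_hom P Q) z t"
    using linear_mapsD(4)[OF tensor_lift(1)[OF bilinear_form_hom[OF fg(2)]] t] by (simp add: fg)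
next
  fix z assume z: "z \<in> carrier (chu_hom_space P Q)"
    and null: "\<And>t. t \<in> carrier T \<Longrightarrow> pairing (chu_internal_hom P Q) z t = 0"
  obtain f g where fg: "z = (f, g)" "(f, g) \<in> chu_hom P Q"
    using z by (cases z) auto
  note f = chu_homD(1)[OF fg(2)] and g = chu_homD(2)[OF fg(2)]
  have null: "pairing Q (f v) w = 0" if "v \<in> carrier (lspace P)" "w \<in> carrier (rspace Q)" for v w
    using null[OF pure_mem[OF that]] tensor_lift(2)[OF bilinear_form_hom[OF fg(2)] that] by (simp add: fg)
  have "f v = \<zero>\<^bsub>lspace Q\<^esub>" if "v \<in> carrier (lspace P)" for v
    using null that linear_mapsD(1)[OF f that] by (intro Q.nondegenerate_left) auto
  then have "f = (\<lambda>v\<in>carrier (lspace P). \<zero>\<^bsub>lspace Q\<^esub>)"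
    using linear_mapsD(2)[OF f] by (intro extensionalityI[of _ "carrier (lspace P)"]) auto
  moreover have "g w = \<zero>\<^bsub>rspace P\<^esub>" if "w \<in> carrier (rspace Q)" for w
    using null that linear_mapsD(1)[OF g that] chu_homD(3)[OF fg(2) _ that]
    by (intro P.nondegenerate_right) auto
  then have "g = (\<lambda>w\<in>carrier (rspace Q). \<zero>\<^bsub>rspace P\<^esub>)"
    using linear_mapsD(2)[OF g] by (intro extensionalityI[of _ "carrier (rspace Q)"]) auto
  ultimately show "z = \<zero>\<^bsub>chu_hom_space P Q\<^esub>"
    by (simp add: fg)
next
  fix t assume t: "t \<in> carrier T"
    and null: "\<And>z. z \<in> carrier (chu_hom_space P Q) \<Longrightarrow> pairing (chu_internal_hom P Q) z t = 0"
  obtain xs where xs: "set xs \<subseteq> carrier (lspace P) \<times> carrier (rspace Q)" "t = tsum xs"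
    using t by (rule tensor_eq_tsum)
  have "(\<Sum>(v, w)\<leftarrow>xs. pairing P v \<phi> * pairing Q x w) = 0"
    if \<phi>: "\<phi> \<in> carrier (rspace P)" and x: "x \<in> carrier (lspace Q)" for \<phi> x
  proof -
    note hom = rank_one_hom[OF \<phi> x]
    have "(\<Sum>(v, w)\<leftarrow>xs. pairing P v \<phi> * pairing Q x w) =
        (\<Sum>(v, w)\<leftarrow>xs. pairing Q ((\<lambda>v\<in>carrier (lspace P). pairing P v \<phi> \<odot>\<^bsub>lspace Q\<^esub> x) v) w)"
      using xs(1) x by (induction xs) (auto simp: Q.pairing_left)
    then show ?thesis
      using null[unfolded chu_hom_space_simps(1), OF hom] pairing_tsum[OF hom xs(1)]
      by (simp only: xs(2))
  qed
  then show "t = \<zero>\<^bsub>T\<^esub>"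
    unfolding xs(2) by (intro tsum_eq_zero xs(1))
qed

end

section \<open>Comparison of the internal hom with the continuous linear maps\<close>

lemma tensor_truncate: "tensor (module.truncate V) W = tensor V W"
proof -
  have "tensor_relations (module.truncate V) W = tensor_relations V W"
    by (simp add: tensor_relations_def)
  moreover from this have "tensor_class (module.truncate V) W = tensor_class V W"
    by (simp add: tensor_class_def fun_eq_iff)
  ultimately show ?thesis
    by (simp add: tensor_def)
qed

lemma tensor_lift_truncate: "tensor_lift (module.truncate V) W b = tensor_lift V W b"
proof -
  have "pure_tensor (module.truncate V) W = pure_tensor V W"
    by (simp add: pure_tensor_def tensor_class_def tensor_relations_def fun_eq_iff)
  then show ?thesis
    by (simp add: tensor_lift_def tensor_truncate)
qed

lemma L_pair_simps [simp]:
  "lspace (L_pair V W) = L_space V W" "rspace (L_pair V W) = tensor V (tdual W)"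
  "pairing (L_pair V W) f = tensor_lift V (tdual W) (\<lambda>v w'. w' (f v))"
  by (simp_all add: L_pair_def)

lemma L_space_simps [simp]:
  "carrier (L_space V W) = L V W"
  "f \<oplus>\<^bsub>L_space V W\<^esub> g = (\<lambda>x\<in>carrier V. f x \<oplus>\<^bsub>W\<^esub> g x)"
  "c \<odot>\<^bsub>L_space V W\<^esub> f = (\<lambda>x\<in>carrier V. c \<odot>\<^bsub>W\<^esub> f x)"
  by (simp_all add: L_space_def)

definition transpose_map ::
  "('k::real_or_complex, 'a) tvs \<Rightarrow> ('k, 'b) tvs \<Rightarrow> ('a \<Rightarrow> 'b) \<Rightarrow> ('b \<Rightarrow> 'k) \<Rightarrow> 'a \<Rightarrow> 'k" where
  "transpose_map V W f = (\<lambda>\<phi>\<in>carrier (tdual W). \<lambda>v\<in>carrier V. \<phi> (f v))"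

text \<open>The weak and the Mackey case differ only in how \<open>cont\<close> is obtained; the
  isomorphism of pairs and both topological consequences are common to them.\<close>

lemma L_pair_iso:
  assumes "TVS V" "TVS W"
    and cont: "\<And>f g. (f, g) \<in> chu_hom (T_functor V) (T_functor W) \<Longrightarrow> f \<in> L V W"
  defines "P \<equiv> chu_internal_hom (T_functor V) (T_functor W)"
  shows "is_chu P" "is_chu (L_pair V W)"
    and "with_topology (lspace P) (weak_topology P) \<cong>\<^sub>T
      with_topology (L_space V W) (weak_topology (L_pair V W))"
    and "with_topology (lspace P) (mackey_topology P) \<cong>\<^sub>T
      with_topology (L_space V W) (mackey_topology (L_pair V W))"
proof -
  interpret V: tvs_space V by (rule tvs_space.intro) fact
  interpret W: tvs_space W by (rule tvs_space.intro) fact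
  interpret H: chu_pairs "T_functor V" "T_functor W"
    by (intro chu_pairs.intro chu_pair.intro V.is_chu_T_functor W.is_chu_T_functor)
  show chu: "is_chu P"
    unfolding P_def by (rule H.is_chu_internal_hom)
  have hom: "(f, transpose_map V W f) \<in> chu_hom (T_functor V) (T_functor W)" if f: "f \<in> L V W" for f
  proof -
    have lin: "f \<in> linear_maps V W" and fc: "continuous_map (vtop V) (vtop W) f"
      using f by (auto simp: L_def)
    have "(\<lambda>v\<in>carrier V. \<phi> (f v)) \<in> carrier (tdual V)" if \<phi>: "\<phi> \<in> carrier (tdual W)" for \<phi>
    proof -
      note \<phi>l = W.tdual_linear[OF \<phi>]
      have "continuous_map (vtop V) euclidean (\<phi> \<circ> f)"
        using fc \<phi> by (intro continuous_map_compose) (auto simp: W.tdual_carrier)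
      then have "continuous_map (vtop V) euclidean (\<lambda>v\<in>carrier V. \<phi> (f v))"
        by (rule continuous_map_eq) simp
      moreover have "(\<lambda>v\<in>carrier V. \<phi> (f v)) \<in> linear_maps V ground"
        by (rule linear_mapsI) (auto simp: linear_mapsD[OF lin] linear_mapsD(3,4)[OF \<phi>l])
      ultimately show ?thesis
        by (simp add: V.tdual_carrier)
    qed
    moreover have "(\<lambda>x\<in>carrier W. \<phi> x + \<psi> x) \<in> carrier (tdual W)" "(\<lambda>x\<in>carrier W. c * \<phi> x) \<in> carrier (tdual W)"
      if "\<phi> \<in> carrier (tdual W)" "\<psi> \<in> carrier (tdual W)" for \<phi> \<psi> c
      using H.Q.r.a_closed[of \<phi> \<psi>] H.Q.r.smult_mem[of \<phi> c] that by simp_all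
    ultimately have "transpose_map V W f \<in> linear_maps (tdual W) (tdual V)"
      using linear_mapsD(1)[OF lin]
      by (intro linear_mapsI) (auto simp: transpose_map_def intro!: restrict_ext)
    then show ?thesis
      using lin by (simp add: chu_hom_def transpose_map_def)
  qed
  \<comment> \<open>Adjointness prescribes the value of \<open>g \<phi>\<close> at \<open>v\<close>
    as \<open>\<phi> (f v)\<close>, and elements of the dual are determined by their values.\<close>
  have unique: "g = transpose_map V W f" if fg: "(f, g) \<in> chu_hom (T_functor V) (T_functor W)" for f g
  proof -
    have g: "g \<in> linear_maps (tdual W) (tdual V)"
      using chu_homD(2)[OF fg] by simp
    have "g \<phi> = (\<lambda>v\<in>carrier V. \<phi> (f v))" if \<phi>: "\<phi> \<in> carrier (tdual W)" for \<phi>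
      using linear_mapsD(2)[OF V.tdual_linear[OF linear_mapsD(1)[OF g \<phi>]]] chu_homD(3)[OF fg, of _ \<phi>] \<phi>
      by (intro extensionalityI[of _ "carrier V"]) auto
    then show ?thesis
      using linear_mapsD(2)[OF g]
      by (intro extensionalityI[of _ "carrier (tdual W)"]) (auto simp: transpose_map_def)
  qed
  have vs: "vector_sp (L_space V W)"
  proof (rule vector_sp_L_space)
    show "continuous_map (prod_topology (vtop W) (vtop W)) (vtop W) (\<lambda>(x, y). x \<oplus>\<^bsub>W\<^esub> y)"
      using \<open>TVS W\<close> by (simp add: TVS_def)
  qed (auto simp: V.vector_sp W.vector_sp W.continuous_smult_const)
  interpret LS: kspace "L_space V W"
    by (rule kspace.intro) (rule vs)
  interpret HS: kspace "chu_hom_space (T_functor V) (T_functor W)"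
    by (rule kspace.intro) (rule H.vector_sp_chu_hom_space)
  define \<alpha> where "\<alpha> = (\<lambda>f\<in>L V W. (f, transpose_map V W f))"
  define \<beta> where "\<beta> = (\<lambda>z\<in>chu_hom (T_functor V) (T_functor W). fst z)"
  have \<alpha>_mem: "\<alpha> f \<in> chu_hom (T_functor V) (T_functor W)" if "f \<in> L V W" for f
    using that hom by (simp add: \<alpha>_def)
  have hom_eqI: "z = z'" if "z \<in> chu_hom (T_functor V) (T_functor W)"
    "z' \<in> chu_hom (T_functor V) (T_functor W)" "fst z = fst z'" for z z'
    using that by (metis prod.collapse unique)
  have \<beta>: "\<beta> \<in> linear_maps (lspace P) (L_space V W)"
  proof (rule linear_mapsI)
    fix z assume "z \<in> carrier (lspace P)"
    then show "\<beta> z \<in> carrier (L_space V W)"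
      using cont[of "fst z" "snd z"] by (simp add: P_def \<beta>_def)
  next
    show "\<beta> \<in> extensional (carrier (lspace P))"
      by (simp add: P_def \<beta>_def)
  next
    fix z z' assume "z \<in> carrier (lspace P)" "z' \<in> carrier (lspace P)"
    then show "\<beta> (z \<oplus>\<^bsub>lspace P\<^esub> z') = \<beta> z \<oplus>\<^bsub>L_space V W\<^esub> \<beta> z'"
      using HS.a_closed[of z z'] by (cases z, cases z') (simp add: P_def \<beta>_def)
  next
    fix c z assume "z \<in> carrier (lspace P)"
    then show "\<beta> (c \<odot>\<^bsub>lspace P\<^esub> z) = c \<odot>\<^bsub>L_space V W\<^esub> \<beta> z"
      using HS.smult_mem[of z c] by (cases z) (simp add: P_def \<beta>_def)
  qed
  have \<beta>\<alpha>: "\<beta> (\<alpha> f) = f" if "f \<in> L V W" for f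
    using that \<alpha>_mem[OF that] by (simp add: \<beta>_def) (simp add: \<alpha>_def)
  have \<beta>_inj: "z = z'" if "z \<in> chu_hom (T_functor V) (T_functor W)"
    "z' \<in> chu_hom (T_functor V) (T_functor W)" "\<beta> z = \<beta> z'" for z z'
    using that by (intro hom_eqI) (auto simp: \<beta>_def)
  \<comment> \<open>Linearity of \<open>\<alpha>\<close> follows from that of \<open>\<beta>\<close>
    and injectivity of \<open>\<beta>\<close>, which spares a comparison of transposes.\<close>
  have \<alpha>: "\<alpha> \<in> linear_maps (L_space V W) (lspace P)"
  proof (rule linear_mapsI)
    fix f g assume fg: "f \<in> carrier (L_space V W)" "g \<in> carrier (L_space V W)"
    show "\<alpha> (f \<oplus>\<^bsub>L_space V W\<^esub> g) = \<alpha> f \<oplus>\<^bsub>lspace P\<^esub> \<alpha> g"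
    proof (rule \<beta>_inj)
      show "\<alpha> (f \<oplus>\<^bsub>L_space V W\<^esub> g) \<in> chu_hom (T_functor V) (T_functor W)"
        using LS.a_closed[OF fg] by (intro \<alpha>_mem) (simp only: L_space_simps(1))
      show "\<alpha> f \<oplus>\<^bsub>lspace P\<^esub> \<alpha> g \<in> chu_hom (T_functor V) (T_functor W)"
        using HS.a_closed[of "\<alpha> f" "\<alpha> g"] \<alpha>_mem fg by (simp add: P_def)
      show "\<beta> (\<alpha> (f \<oplus>\<^bsub>L_space V W\<^esub> g)) = \<beta> (\<alpha> f \<oplus>\<^bsub>lspace P\<^esub> \<alpha> g)"
        using linear_mapsD(3)[OF \<beta>, of "\<alpha> f" "\<alpha> g"] \<beta>\<alpha> LS.a_closed[OF fg] \<alpha>_mem fg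
        by (simp add: P_def)
    qed
  next
    fix c f assume f: "f \<in> carrier (L_space V W)"
    show "\<alpha> (c \<odot>\<^bsub>L_space V W\<^esub> f) = c \<odot>\<^bsub>lspace P\<^esub> \<alpha> f"
    proof (rule \<beta>_inj)
      show "\<alpha> (c \<odot>\<^bsub>L_space V W\<^esub> f) \<in> chu_hom (T_functor V) (T_functor W)"
        using LS.smult_mem[OF f] by (intro \<alpha>_mem) (simp only: L_space_simps(1))
      show "c \<odot>\<^bsub>lspace P\<^esub> \<alpha> f \<in> chu_hom (T_functor V) (T_functor W)"
        using HS.smult_mem[of "\<alpha> f" c] \<alpha>_mem f by (simp add: P_def)
      show "\<beta> (\<alpha> (c \<odot>\<^bsub>L_space V W\<^esub> f)) = \<beta> (c \<odot>\<^bsub>lspace P\<^esub> \<alpha> f)"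
        using linear_mapsD(4)[OF \<beta>, of "\<alpha> f" c] \<beta>\<alpha> LS.smult_mem[OF f] \<alpha>_mem f
        by (simp add: P_def)
    qed
  qed (auto simp: P_def \<alpha>_def hom)
  have \<alpha>\<beta>: "\<alpha> (\<beta> z) = z" if z: "z \<in> chu_hom (T_functor V) (T_functor W)" for z
  proof (rule \<beta>_inj[OF \<alpha>_mem z \<beta>\<alpha>])
    show "\<beta> z \<in> L V W"
      using linear_mapsD(1)[OF \<beta>, of z] z by (simp add: P_def)
    then show "\<beta> z \<in> L V W" .
  qed
  note iso = isomorphic_pairs[of P "L_pair V W" \<alpha> \<beta>, OF chu]
  \<comment> \<open>Truncation forgets only the topology, so the two right spaces coincide
    literally, as \<open>isomorphic_pairs\<close> requires.\<close>
  have rspace: "rspace (L_pair V W) = rspace P"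
    by (simp add: P_def tensor_truncate)
  have pairing: "pairing (L_pair V W) f t = pairing P (\<alpha> f) t" if "f \<in> carrier (lspace (L_pair V W))" for f t
    using that by (simp add: P_def \<alpha>_def tensor_lift_truncate)
  show "is_chu (L_pair V W)"
    by (rule iso) (use vs rspace \<alpha> \<beta> \<alpha>\<beta> \<beta>\<alpha> pairing in \<open>simp_all add: P_def\<close>)
  show "with_topology (lspace P) (weak_topology P) \<cong>\<^sub>T
      with_topology (L_space V W) (weak_topology (L_pair V W))"
    unfolding L_pair_simps(1)[symmetric]
    by (rule iso) (use vs rspace \<alpha> \<beta> \<alpha>\<beta> \<beta>\<alpha> pairing in \<open>simp_all add: P_def\<close>)
  show "with_topology (lspace P) (mackey_topology P) \<cong>\<^sub>T
      with_topology (L_space V W) (mackey_topology (L_pair V W))"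
    unfolding L_pair_simps(1)[symmetric]
    by (rule iso) (use vs rspace \<alpha> \<beta> \<alpha>\<beta> \<beta>\<alpha> pairing in \<open>simp_all add: P_def\<close>)
qed

text \<open>The descriptions behind the two topologies are known to denote for chu objects. The
  conclusion therefore also records \<open>is_chu (L_pair V W)\<close> and that both sides of each
  isomorphism lie in the intended category.\<close>

theorem lemma4p3p3:
  fixes V :: "('k::real_or_complex, 'a) tvs" and W :: "('k, 'b) tvs"
  shows "(TVS_w V \<and> TVS_w W \<longrightarrow>
            is_chu (L_pair V W) \<and>
            TVS_w (Hom_w V W) \<and>
            TVS_w (with_topology (L_space V W) (weak_topology (L_pair V W))) \<and>
            Hom_w V W \<cong>\<^sub>T with_topology (L_space V W) (weak_topology (L_pair V W))) \<and>
         (TVS_m V \<and> TVS_m W \<longrightarrow>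
            is_chu (L_pair V W) \<and>
            TVS_m (Hom_m V W) \<and>
            TVS_m (with_topology (L_space V W) (mackey_topology (L_pair V W))) \<and>
            Hom_m V W \<cong>\<^sub>T with_topology (L_space V W) (mackey_topology (L_pair V W)))"
proof (rule conjI; rule impI)
  assume VW: "TVS_w V \<and> TVS_w W"
  then have tvs: "TVS V" "TVS W" and top: "vtop V = weak_topology (T_functor V)"
    "vtop W = weak_topology (T_functor W)"
    by (simp_all add: TVS_w_def)
  have chu: "is_chu (T_functor V)" "is_chu (T_functor W)"
    using tvs by (auto intro: tvs_space.is_chu_T_functor tvs_space.intro)
  \<comment> \<open>Membership in \<open>TVS_w\<close> identifies the given topologies with the weak
    ones of the associated pairs, for which the first component of a morphism is continuous.\<close>
  have "f \<in> L V W" if "(f, g) \<in> chu_hom (T_functor V) (T_functor W)" for f g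
    using chu_hom_continuous(1)[OF chu that] chu_homD(1)[OF that] by (simp add: L_def top)
  note iso = L_pair_iso[OF tvs this]
  show "is_chu (L_pair V W) \<and> TVS_w (Hom_w V W) \<and>
      TVS_w (with_topology (L_space V W) (weak_topology (L_pair V W))) \<and>
      Hom_w V W \<cong>\<^sub>T with_topology (L_space V W) (weak_topology (L_pair V W))"
    using iso(1,2,3) TVS_w_with_weak_topology[OF iso(1)] TVS_w_with_weak_topology[OF iso(2)]
    by (simp add: Hom_w_def R_functor_def)
next
  assume VW: "TVS_m V \<and> TVS_m W"
  then have tvs: "TVS V" "TVS W" and top: "vtop V = mackey_topology (T_functor V)"
    "vtop W = mackey_topology (T_functor W)"
    by (simp_all add: TVS_m_def)
  have chu: "is_chu (T_functor V)" "is_chu (T_functor W)"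
    using tvs by (auto intro: tvs_space.is_chu_T_functor tvs_space.intro)
  have "f \<in> L V W" if "(f, g) \<in> chu_hom (T_functor V) (T_functor W)" for f g
    using chu_hom_continuous(2)[OF chu that] chu_homD(1)[OF that] by (simp add: L_def top)
  note iso = L_pair_iso[OF tvs this]
  show "is_chu (L_pair V W) \<and> TVS_m (Hom_m V W) \<and>
      TVS_m (with_topology (L_space V W) (mackey_topology (L_pair V W))) \<and>
      Hom_m V W \<cong>\<^sub>T with_topology (L_space V W) (mackey_topology (L_pair V W))"
    using iso(1,2,4) TVS_m_with_mackey_topology[OF iso(1)] TVS_m_with_mackey_topology[OF iso(2)]
    by (simp add: Hom_m_def L_functor_def)
qed

end
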